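(* Let $\mathscr M$ be a cocomplete symmetric closed monoidal category. Then for any nonempty set $X$ the category $\mathscr M_{\mathbb S}(X)$ is cocomplete.
   Context: For a nonempty set $X$ and $A,B\in X$, let $\mathbb S_{\overline X}(A,B)$ be the category whose objects are finite sequences $t=(E_0,\dots,E_n)$ of elements of $X$ with $n\ge1$, $E_0=A$, $E_n=B$, and whose morphisms $(E_0,\dots,E_n)\to(E'_0,\dots,E'_m)$ are surjective nondecreasing maps $f:\{0,\dots,n-1\}\to\{0,\dots,m-1\}$ with $E'_j=E_{\min f^{-1}(j)}$ for $0\le j<m$. Concatenation $(E_0,\dots,E_n)\otimes(E_n,E'_1,\dots,E'_m)=(E_0,\dots,E_n,E'_1,\dots,E'_m)$, together with ordinal sum of maps, gives strictly associative functors $\otimes:\mathbb S_{\overline X}(A,B)\times\mathbb S_{\overline X}(B,C)\to\mathbb S_{\overline X}(A,C)$. $\mathscr M_{\mathbb S}(X)$ is the category of lax functors $F:(\mathbb S_{\overline X})^{2\text{-op}}\to\mathscr M$: an object consists of functors $F_{AB}:\mathbb S_{\overline X}(A,B)^{op}\to\mathscr M$ for $A,B\in X$, together with natural laxity maps $\varphi_{s,t}:F(s)\otimes F(t)\to F(s\otimes t)$ satisfying the usual associativity condition (no unit data). A morphism $\sigma:F\to G$ is a family of natural transformations $F_{AB}\to G_{AB}$ commuting with the laxity maps. *)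

theory Defs
  imports Main "HOL-Library.FuncSet"
begin

unbundle cardinal_syntax

section \<open>Categories, functors, colimits\<close>

record ('o, 'a) cat =
  Ob  :: "'o set"
  Ar  :: "'a set"
  Dom :: "'a \<Rightarrow> 'o"
  Cod :: "'a \<Rightarrow> 'o"
  Idn :: "'o \<Rightarrow> 'a"
  Cmp :: "'a \<Rightarrow> 'a \<Rightarrow> 'a" (infixl "\<cdot>\<index>" 65)

definition hom :: "('o, 'a, 'z) cat_scheme \<Rightarrow> 'o \<Rightarrow> 'o \<Rightarrow> 'a set" where
  "hom C a b = {f \<in> Ar C. Dom C f = a \<and> Cod C f = b}"

text \<open>\<open>g \<cdot> f\<close> is the composite of \<open>f\<close> followed by \<open>g\<close>.\<close>

locale category =
  fixes C :: "('o, 'a, 'z) cat_scheme" (structure)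
  assumes Dom_Ob: "f \<in> Ar C \<Longrightarrow> Dom C f \<in> Ob C"
    and Cod_Ob: "f \<in> Ar C \<Longrightarrow> Cod C f \<in> Ob C"
    and Idn_hom: "a \<in> Ob C \<Longrightarrow> Idn C a \<in> hom C a a"
    and Cmp_hom: "f \<in> hom C a b \<Longrightarrow> g \<in> hom C b c \<Longrightarrow> g \<cdot> f \<in> hom C a c"
    and Cmp_Idn_left: "f \<in> hom C a b \<Longrightarrow> Idn C b \<cdot> f = f"
    and Cmp_Idn_right: "f \<in> hom C a b \<Longrightarrow> f \<cdot> Idn C a = f"
    and Cmp_assoc: "f \<in> hom C a b \<Longrightarrow> g \<in> hom C b c \<Longrightarrow> h \<in> hom C c d
                    \<Longrightarrow> (h \<cdot> g) \<cdot> f = h \<cdot> (g \<cdot> f)"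

definition isom :: "('o, 'a, 'z) cat_scheme \<Rightarrow> 'o \<Rightarrow> 'o \<Rightarrow> 'a \<Rightarrow> bool" where
  "isom C a b f \<longleftrightarrow> f \<in> hom C a b \<and>
     (\<exists>g \<in> hom C b a. Cmp C g f = Idn C a \<and> Cmp C f g = Idn C b)"

definition op_cat :: "('o, 'a, 'z) cat_scheme \<Rightarrow> ('o, 'a) cat" where
  "op_cat C = \<lparr>Ob = Ob C, Ar = Ar C, Dom = Cod C, Cod = Dom C, Idn = Idn C,
               Cmp = (\<lambda>g f. Cmp C f g)\<rparr>"

record ('o1, 'a1, 'o2, 'a2) fnctr =
  fob :: "'o1 \<Rightarrow> 'o2"
  far :: "'a1 \<Rightarrow> 'a2"

locale cat_functor = C: category C + D: category D
  for C :: "('o1, 'a1, 'z1) cat_scheme" and D :: "('o2, 'a2, 'z2) cat_scheme" +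
  fixes F :: "('o1, 'a1, 'o2, 'a2) fnctr"
  assumes fob_Ob: "a \<in> Ob C \<Longrightarrow> fob F a \<in> Ob D"
    and far_hom: "f \<in> hom C a b \<Longrightarrow> far F f \<in> hom D (fob F a) (fob F b)"
    and far_Idn: "a \<in> Ob C \<Longrightarrow> far F (Idn C a) = Idn D (fob F a)"
    and far_Cmp: "f \<in> hom C a b \<Longrightarrow> g \<in> hom C b c
                  \<Longrightarrow> far F (Cmp C g f) = Cmp D (far F g) (far F f)"

definition nat_trans ::
  "('o1, 'a1, 'z1) cat_scheme \<Rightarrow> ('o2, 'a2, 'z2) cat_scheme \<Rightarrow>
   ('o1, 'a1, 'o2, 'a2) fnctr \<Rightarrow> ('o1, 'a1, 'o2, 'a2) fnctr \<Rightarrow> ('o1 \<Rightarrow> 'a2) \<Rightarrow> bool" where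
  "nat_trans C D F G \<eta> \<longleftrightarrow> cat_functor C D F \<and> cat_functor C D G \<and>
     (\<forall>a \<in> Ob C. \<eta> a \<in> hom D (fob F a) (fob G a)) \<and>
     (\<forall>f \<in> Ar C. Cmp D (\<eta> (Cod C f)) (far F f) = Cmp D (far G f) (\<eta> (Dom C f)))"

text \<open>\<open>L\<close> is left adjoint to \<open>R\<close> via the bijections \<open>\<theta> a b : D(L a, b) \<cong> C(a, R b)\<close>,
  natural in both variables.\<close>

definition adjunction ::
  "('o1, 'a1, 'z1) cat_scheme \<Rightarrow> ('o2, 'a2, 'z2) cat_scheme \<Rightarrow>
   ('o1, 'a1, 'o2, 'a2) fnctr \<Rightarrow> ('o2, 'a2, 'o1, 'a1) fnctr \<Rightarrow>
   ('o1 \<Rightarrow> 'o2 \<Rightarrow> 'a2 \<Rightarrow> 'a1) \<Rightarrow> bool" where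
  "adjunction C D L R \<theta> \<longleftrightarrow> cat_functor C D L \<and> cat_functor D C R \<and>
     (\<forall>a \<in> Ob C. \<forall>b \<in> Ob D. bij_betw (\<theta> a b) (hom D (fob L a) b) (hom C a (fob R b))) \<and>
     (\<forall>u \<in> Ar C. \<forall>v \<in> Ar D. \<forall>f \<in> hom D (fob L (Cod C u)) (Dom D v).
        \<theta> (Dom C u) (Cod D v) (Cmp D v (Cmp D f (far L u))) =
        Cmp C (far R v) (Cmp C (\<theta> (Cod C u) (Dom D v) f) u))"

definition cocone ::
  "('o1, 'a1, 'z1) cat_scheme \<Rightarrow> ('o2, 'a2, 'z2) cat_scheme \<Rightarrow>
   ('o1, 'a1, 'o2, 'a2) fnctr \<Rightarrow> 'o2 \<Rightarrow> ('o1 \<Rightarrow> 'a2) \<Rightarrow> bool" where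
  "cocone J C D c \<iota> \<longleftrightarrow> c \<in> Ob C \<and> (\<forall>j \<in> Ob J. \<iota> j \<in> hom C (fob D j) c) \<and>
     (\<forall>u \<in> Ar J. Cmp C (\<iota> (Cod J u)) (far D u) = \<iota> (Dom J u))"

definition is_colimit ::
  "('o1, 'a1, 'z1) cat_scheme \<Rightarrow> ('o2, 'a2, 'z2) cat_scheme \<Rightarrow>
   ('o1, 'a1, 'o2, 'a2) fnctr \<Rightarrow> 'o2 \<Rightarrow> ('o1 \<Rightarrow> 'a2) \<Rightarrow> bool" where
  "is_colimit J C D c \<iota> \<longleftrightarrow> cocone J C D c \<iota> \<and>
     (\<forall>c' \<iota>'. cocone J C D c' \<iota>' \<longrightarrow>
        (\<exists>!h. h \<in> hom C c c' \<and> (\<forall>j \<in> Ob J. Cmp C h (\<iota> j) = \<iota>' j)))"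

text \<open>The notion of a small set is a parameter: a set is small if its cardinality is below a
  cardinal \<open>\<kappa>\<close> (for a Grothendieck universe, \<open>\<kappa>\<close> is the corresponding inaccessible cardinal).
  Since a set of cardinality below \<open>\<kappa>\<close> is in bijection with a subset of \<open>Field \<kappa>\<close>, it is no
  restriction that the objects and arrows of index categories are taken from the type
  over which \<open>\<kappa>\<close> lives.\<close>

definition small_cat :: "'u rel \<Rightarrow> ('o, 'a, 'z) cat_scheme \<Rightarrow> bool" where
  "small_cat \<kappa> J \<longleftrightarrow> category J \<and> |Ob J| <o \<kappa> \<and> |Ar J| <o \<kappa>"

definition cocomplete :: "'u rel \<Rightarrow> ('o, 'a, 'z) cat_scheme \<Rightarrow> bool" where
  "cocomplete \<kappa> C \<longleftrightarrow> category C \<and>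
     (\<forall>(J :: ('u, 'u) cat) D. small_cat \<kappa> J \<and> cat_functor J C D \<longrightarrow>
        (\<exists>c \<iota>. is_colimit J C D c \<iota>))"


section \<open>Symmetric closed monoidal categories\<close>

record ('o, 'a) mon_cat = "('o, 'a) cat" +
  TOb   :: "'o \<Rightarrow> 'o \<Rightarrow> 'o" (infixl "\<odot>\<index>" 70)
  TAr   :: "'a \<Rightarrow> 'a \<Rightarrow> 'a" (infixl "\<otimes>\<index>" 70)
  Unit  :: "'o"
  Assoc :: "'o \<Rightarrow> 'o \<Rightarrow> 'o \<Rightarrow> 'a"
  LUnit :: "'o \<Rightarrow> 'a"
  RUnit :: "'o \<Rightarrow> 'a"
  Braid :: "'o \<Rightarrow> 'o \<Rightarrow> 'a"

locale monoidal_category = category M for M :: "('o, 'a, 'z) mon_cat_scheme" (structure) +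
  assumes TOb_Ob: "a \<in> Ob M \<Longrightarrow> b \<in> Ob M \<Longrightarrow> a \<odot> b \<in> Ob M"
    and TAr_hom: "f \<in> hom M a a' \<Longrightarrow> g \<in> hom M b b' \<Longrightarrow> f \<otimes> g \<in> hom M (a \<odot> b) (a' \<odot> b')"
    and TAr_Idn: "a \<in> Ob M \<Longrightarrow> b \<in> Ob M \<Longrightarrow> Idn M a \<otimes> Idn M b = Idn M (a \<odot> b)"
    and TAr_Cmp: "f \<in> hom M a a' \<Longrightarrow> f' \<in> hom M a' a'' \<Longrightarrow>
                  g \<in> hom M b b' \<Longrightarrow> g' \<in> hom M b' b'' \<Longrightarrow>
                  (f' \<cdot> f) \<otimes> (g' \<cdot> g) = (f' \<otimes> g') \<cdot> (f \<otimes> g)"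
    and Unit_Ob: "Unit M \<in> Ob M"
    and Assoc_isom: "a \<in> Ob M \<Longrightarrow> b \<in> Ob M \<Longrightarrow> c \<in> Ob M \<Longrightarrow>
                  isom M (a \<odot> b \<odot> c) (a \<odot> (b \<odot> c)) (Assoc M a b c)"
    and LUnit_isom: "a \<in> Ob M \<Longrightarrow> isom M (Unit M \<odot> a) a (LUnit M a)"
    and RUnit_isom: "a \<in> Ob M \<Longrightarrow> isom M (a \<odot> Unit M) a (RUnit M a)"
    and Assoc_natural: "f \<in> hom M a a' \<Longrightarrow> g \<in> hom M b b' \<Longrightarrow> h \<in> hom M c c' \<Longrightarrow>
                  Assoc M a' b' c' \<cdot> (f \<otimes> g \<otimes> h) = (f \<otimes> (g \<otimes> h)) \<cdot> Assoc M a b c"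
    and LUnit_natural: "f \<in> hom M a a' \<Longrightarrow>
                  LUnit M a' \<cdot> (Idn M (Unit M) \<otimes> f) = f \<cdot> LUnit M a"
    and RUnit_natural: "f \<in> hom M a a' \<Longrightarrow>
                  RUnit M a' \<cdot> (f \<otimes> Idn M (Unit M)) = f \<cdot> RUnit M a"
    and pentagon: "a \<in> Ob M \<Longrightarrow> b \<in> Ob M \<Longrightarrow> c \<in> Ob M \<Longrightarrow> d \<in> Ob M \<Longrightarrow>
                  Assoc M a b (c \<odot> d) \<cdot> Assoc M (a \<odot> b) c d =
                  (Idn M a \<otimes> Assoc M b c d) \<cdot> Assoc M a (b \<odot> c) d \<cdot> (Assoc M a b c \<otimes> Idn M d)"
    and triangle: "a \<in> Ob M \<Longrightarrow> b \<in> Ob M \<Longrightarrow>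
                  (Idn M a \<otimes> LUnit M b) \<cdot> Assoc M a (Unit M) b = RUnit M a \<otimes> Idn M b"

locale symmetric_monoidal_category = monoidal_category +
  assumes Braid_hom: "a \<in> Ob M \<Longrightarrow> b \<in> Ob M \<Longrightarrow> Braid M a b \<in> hom M (a \<odot> b) (b \<odot> a)"
    and Braid_natural: "f \<in> hom M a a' \<Longrightarrow> g \<in> hom M b b' \<Longrightarrow>
                  Braid M a' b' \<cdot> (f \<otimes> g) = (g \<otimes> f) \<cdot> Braid M a b"
    and Braid_symmetry: "a \<in> Ob M \<Longrightarrow> b \<in> Ob M \<Longrightarrow> Braid M b a \<cdot> Braid M a b = Idn M (a \<odot> b)"
    and hexagon: "a \<in> Ob M \<Longrightarrow> b \<in> Ob M \<Longrightarrow> c \<in> Ob M \<Longrightarrow>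
                  Assoc M b c a \<cdot> Braid M a (b \<odot> c) \<cdot> Assoc M a b c =
                  (Idn M b \<otimes> Braid M a c) \<cdot> Assoc M b a c \<cdot> (Braid M a b \<otimes> Idn M c)"

definition tensor_right :: "('o, 'a, 'z) mon_cat_scheme \<Rightarrow> 'o \<Rightarrow> ('o, 'a, 'o, 'a) fnctr" where
  "tensor_right M b = \<lparr>fob = (\<lambda>a. TOb M a b), far = (\<lambda>f. TAr M f (Idn M b))\<rparr>"

locale symmetric_closed_monoidal_category = symmetric_monoidal_category +
  assumes closed: "b \<in> Ob M \<Longrightarrow> \<exists>R \<theta>. adjunction M M (tensor_right M b) R \<theta>"


section \<open>The categories of sequences\<close>

text \<open>A sequence \<open>(E\<^sub>0, \<dots>, E\<^sub>n)\<close> is a list of length \<open>n + 1\<close>. An arrow is a triple consisting of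
  its source, the underlying map (\<open>undefined\<close> outside \<open>{0, \<dots>, n - 1}\<close>) and its target.\<close>

type_synonym 'x seq_arrow = "'x list \<times> (nat \<Rightarrow> nat) \<times> 'x list"

definition deg :: "'x list \<Rightarrow> nat" where
  "deg t = length t - 1"

definition seq_ob :: "'x set \<Rightarrow> 'x \<Rightarrow> 'x \<Rightarrow> 'x list set" where
  "seq_ob X A B = {t. set t \<subseteq> X \<and> 2 \<le> length t \<and> hd t = A \<and> last t = B}"

definition seq_ar :: "'x set \<Rightarrow> 'x \<Rightarrow> 'x \<Rightarrow> 'x seq_arrow set" where
  "seq_ar X A B = {(s, f, t). s \<in> seq_ob X A B \<and> t \<in> seq_ob X A B \<and>
     f \<in> {..<deg s} \<rightarrow>\<^sub>E {..<deg t} \<and> f ` {..<deg s} = {..<deg t} \<and> mono_on {..<deg s} f \<and>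
     (\<forall>j < deg t. t ! j = s ! Min {i \<in> {..<deg s}. f i = j})}"

definition seq_cat :: "'x set \<Rightarrow> 'x \<Rightarrow> 'x \<Rightarrow> ('x list, 'x seq_arrow) cat" where
  "seq_cat X A B = \<lparr>Ob = seq_ob X A B, Ar = seq_ar X A B,
     Dom = (\<lambda>(s, f, t). s), Cod = (\<lambda>(s, f, t). t),
     Idn = (\<lambda>t. (t, restrict id {..<deg t}, t)),
     Cmp = (\<lambda>(t, g, u) (s, f, t'). (s, compose {..<deg s} g f, u))\<rparr>"

definition concat_ob :: "'x list \<Rightarrow> 'x list \<Rightarrow> 'x list" where
  "concat_ob s t = s @ tl t"

text \<open>On arrows, concatenation is the ordinal sum of the underlying maps.\<close>

definition concat_ar :: "'x seq_arrow \<Rightarrow> 'x seq_arrow \<Rightarrow> 'x seq_arrow" where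
  "concat_ar = (\<lambda>(s, f, s') (t, g, t').
     (concat_ob s t,
      restrict (\<lambda>i. if i < deg s then f i else deg s' + g (i - deg s)) {..<deg s + deg t},
      concat_ob s' t'))"


section \<open>The category of lax functors\<close>

text \<open>All data of lax functors and of their morphisms are required to be \<open>undefined\<close> outside their
  intended domains, so that equality in HOL is equality of lax functors and of morphisms.\<close>

record ('x, 'o, 'a) lax_fun =
  lfun :: "'x \<Rightarrow> 'x \<Rightarrow> ('x list, 'x seq_arrow, 'o, 'a) fnctr"
  laxity :: "'x list \<Rightarrow> 'x list \<Rightarrow> 'a"

abbreviation lob :: "('x, 'o, 'a) lax_fun \<Rightarrow> 'x \<Rightarrow> 'x \<Rightarrow> 'x list \<Rightarrow> 'o" where
  "lob F A B t \<equiv> fob (lfun F A B) t"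

abbreviation lar :: "('x, 'o, 'a) lax_fun \<Rightarrow> 'x \<Rightarrow> 'x \<Rightarrow> 'x seq_arrow \<Rightarrow> 'a" where
  "lar F A B f \<equiv> far (lfun F A B) f"

definition lax_extensional :: "'x set \<Rightarrow> ('x, 'o, 'a) lax_fun \<Rightarrow> bool" where
  "lax_extensional X F \<longleftrightarrow>
     (\<forall>A B. \<not> (A \<in> X \<and> B \<in> X) \<longrightarrow> lfun F A B = undefined) \<and>
     (\<forall>A \<in> X. \<forall>B \<in> X. fob (lfun F A B) \<in> extensional (seq_ob X A B) \<and>
                      far (lfun F A B) \<in> extensional (seq_ar X A B)) \<and>
     (\<forall>s t. \<not> (\<exists>A \<in> X. \<exists>B \<in> X. \<exists>C \<in> X. s \<in> seq_ob X A B \<and> t \<in> seq_ob X B C)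
            \<longrightarrow> laxity F s t = undefined)"

text \<open>As \<open>F\<close> is contravariant on \<open>seq_cat X A B\<close>, arrows \<open>f : s \<rightarrow> s'\<close> and \<open>g : t \<rightarrow> t'\<close> give
  the naturality square \<open>\<phi>\<^bsub>s,t\<^esub> \<cdot> (F f \<otimes> F g) = F (f \<otimes> g) \<cdot> \<phi>\<^bsub>s',t'\<^esub>\<close> on \<open>F s' \<otimes> F t'\<close>.\<close>

locale lax_functor =
  fixes M :: "('o, 'a, 'z) mon_cat_scheme" (structure) and X :: "'x set"
    and F :: "('x, 'o, 'a) lax_fun"
  assumes lfun_functor: "A \<in> X \<Longrightarrow> B \<in> X \<Longrightarrow> cat_functor (op_cat (seq_cat X A B)) M (lfun F A B)"
    and laxity_hom: "A \<in> X \<Longrightarrow> B \<in> X \<Longrightarrow> C \<in> X \<Longrightarrow> s \<in> seq_ob X A B \<Longrightarrow> t \<in> seq_ob X B C \<Longrightarrow>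
      laxity F s t \<in> hom M (lob F A B s \<odot> lob F B C t) (lob F A C (concat_ob s t))"
    and laxity_natural: "A \<in> X \<Longrightarrow> B \<in> X \<Longrightarrow> C \<in> X \<Longrightarrow>
      f \<in> hom (seq_cat X A B) s s' \<Longrightarrow> g \<in> hom (seq_cat X B C) t t' \<Longrightarrow>
      laxity F s t \<cdot> (lar F A B f \<otimes> lar F B C g) = lar F A C (concat_ar f g) \<cdot> laxity F s' t'"
    and laxity_assoc: "A \<in> X \<Longrightarrow> B \<in> X \<Longrightarrow> C \<in> X \<Longrightarrow> D \<in> X \<Longrightarrow>
      s \<in> seq_ob X A B \<Longrightarrow> t \<in> seq_ob X B C \<Longrightarrow> u \<in> seq_ob X C D \<Longrightarrow>
      laxity F (concat_ob s t) u \<cdot> (laxity F s t \<otimes> Idn M (lob F C D u)) =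
      laxity F s (concat_ob t u) \<cdot> (Idn M (lob F A B s) \<otimes> laxity F t u) \<cdot>
        Assoc M (lob F A B s) (lob F B C t) (lob F C D u)"
    and extensional: "lax_extensional X F"

record ('x, 'o, 'a) lax_mor =
  msrc :: "('x, 'o, 'a) lax_fun"
  mtgt :: "('x, 'o, 'a) lax_fun"
  mcmp :: "'x \<Rightarrow> 'x \<Rightarrow> 'x list \<Rightarrow> 'a"

definition family_restrict :: "'x set \<Rightarrow> ('x \<Rightarrow> 'x \<Rightarrow> 'x list \<Rightarrow> 'a) \<Rightarrow> 'x \<Rightarrow> 'x \<Rightarrow> 'x list \<Rightarrow> 'a" where
  "family_restrict X \<sigma> =
     (\<lambda>A B t. if A \<in> X \<and> B \<in> X \<and> t \<in> seq_ob X A B then \<sigma> A B t else undefined)"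

locale lax_morphism = src: lax_functor M X "msrc \<sigma>" + tgt: lax_functor M X "mtgt \<sigma>"
  for M :: "('o, 'a, 'z) mon_cat_scheme" (structure) and X :: "'x set"
    and \<sigma> :: "('x, 'o, 'a) lax_mor" +
  assumes mcmp_natural: "A \<in> X \<Longrightarrow> B \<in> X \<Longrightarrow>
      nat_trans (op_cat (seq_cat X A B)) M (lfun (msrc \<sigma>) A B) (lfun (mtgt \<sigma>) A B) (mcmp \<sigma> A B)"
    and mcmp_laxity: "A \<in> X \<Longrightarrow> B \<in> X \<Longrightarrow> C \<in> X \<Longrightarrow> s \<in> seq_ob X A B \<Longrightarrow> t \<in> seq_ob X B C \<Longrightarrow>
      mcmp \<sigma> A C (concat_ob s t) \<cdot> laxity (msrc \<sigma>) s t =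
      laxity (mtgt \<sigma>) s t \<cdot> (mcmp \<sigma> A B s \<otimes> mcmp \<sigma> B C t)"
    and mcmp_extensional: "family_restrict X (mcmp \<sigma>) = mcmp \<sigma>"

definition lax_cat ::
  "('o, 'a, 'z) mon_cat_scheme \<Rightarrow> 'x set \<Rightarrow> (('x, 'o, 'a) lax_fun, ('x, 'o, 'a) lax_mor) cat" where
  "lax_cat M X = \<lparr>Ob = {F. lax_functor M X F}, Ar = {\<sigma>. lax_morphism M X \<sigma>},
     Dom = msrc, Cod = mtgt,
     Idn = (\<lambda>F. \<lparr>msrc = F, mtgt = F, mcmp = family_restrict X (\<lambda>A B t. Idn M (lob F A B t))\<rparr>),
     Cmp = (\<lambda>\<tau> \<sigma>. \<lparr>msrc = msrc \<sigma>, mtgt = mtgt \<tau>,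
       mcmp = family_restrict X (\<lambda>A B t. Cmp M (mcmp \<tau> A B t) (mcmp \<sigma> A B t))\<rparr>)\<rparr>"

end

theory Submission
  imports Defs
begin

text \<open>The degree \<open>n\<close> of a path \<open>(E\<^sub>0, \<dots>, E\<^sub>n)\<close> drops strictly along non-identity
  surjections and is additive under concatenation. So the colimit \<open>G\<close> of a diagram \<open>D\<close> of lax
  functors can be built by recursion on the degree: \<open>G t\<close> is the colimit in \<open>M\<close> of the objects
  \<open>D j t\<close>, of \<open>G t'\<close> for each non-identity \<open>t \<rightarrow> t'\<close>, and of \<open>G s \<odot> G u\<close> for each splitting
  \<open>t = s \<otimes> u\<close>, subject to exactly the equations that make \<open>G\<close> a lax functor under \<open>D\<close>.
  Each path has only finitely many outgoing surjections and splittings, so the diagram is small.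
  The universal property of \<open>G\<close> follows by the same recursion.\<close>

section \<open>Colimits of presentations\<close>

text \<open>Pointwise colimits do not carry laxity maps: out of the tensor product of the colimits
  at \<open>s\<close> and \<open>u\<close> one would need maps from
  \<open>D i s \<odot> D j u\<close> for different indices \<open>i\<close> and \<open>j\<close>,
  while laxity is given only for \<open>i = j\<close>. The objects \<open>G s \<odot> G u\<close> in
  the diagram at a concatenation supply these maps freely, and the equations tie them to the given
  ones. Identity arrows cannot take part in the recursion, as they do not lower the degree. They act
  as identities by definition, so functoriality and naturality have identity cases that no equation
  of the diagram covers. Splittings cause no such trouble: paths have at least one step, hence both
  factors are strictly shorter. The equations at \<open>t\<close> involve maps chosen at earlier
  stages, which is why colimits are taken of presentations by generators and equations and not of
  functors written down in advance. All pairs of end points are treated at once, in a single graded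
  category with a partial concatenation.\<close>

lemma homD:
  assumes "f \<in> hom C a b"
  shows "f \<in> Ar C" "Dom C f = a" "Cod C f = b"
  using assms by (auto simp: hom_def)

lemma (in category) hom_Ob: 
  assumes "f \<in> hom C a b"
  shows "a \<in> Ob C" "b \<in> Ob C"
  using assms Dom_Ob Cod_Ob by (auto simp: hom_def)

lemma in_hom_iff: "f \<in> hom C a b \<longleftrightarrow> f \<in> Ar C \<and> Dom C f = a \<and> Cod C f = b"
  by (auto simp: hom_def)

lemma Inl_Inr_in_Plus: "Inl a \<in> A <+> B \<longleftrightarrow> a \<in> A" "Inr b \<in> A <+> B \<longleftrightarrow> b \<in> B"
  by auto

section \<open>Transport of index categories and cardinality bounds\<close>

lemma small_inj:
  fixes \<kappa> :: "'u rel"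
  assumes "Card_order \<kappa>" "|A| <o \<kappa>"
  obtains e :: "'b \<Rightarrow> 'u" where "inj_on e A"
proof -
  have "|A| \<le>o |Field \<kappa>|"
    using ordLess_imp_ordLeq[OF assms(2)] ordIso_symmetric[OF card_of_Field_ordIso[OF assms(1)]]
    by (rule ordLeq_ordIso_trans)
  then obtain e :: "'b \<Rightarrow> 'u" where "inj_on e A"
    unfolding card_of_ordLeq[symmetric] by blast
  then show ?thesis by (rule that)
qed

text \<open>\<open>cocomplete\<close> only speaks of index categories whose objects and arrows lie
  in the type of \<open>\<kappa>\<close>. A small category over other types is copied into that type
  along injections \<open>e\<close> and \<open>d\<close>; a colimit of the copied diagram is then
  relabelled along \<open>e\<close>.\<close>

lemma cocomplete_colimit:
  fixes \<kappa> :: "'u rel" and J :: "('p, 'q) cat"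
  assumes \<kappa>: "Card_order \<kappa>" and C: "cocomplete \<kappa> C" and J: "small_cat \<kappa> J" and D: "cat_functor J C D"
  shows "\<exists>c \<iota>. is_colimit J C D c \<iota>"
proof -
  interpret D: cat_functor J C D by fact
  obtain e :: "'p \<Rightarrow> 'u" where e: "inj_on e (Ob J)"
    using small_inj[OF \<kappa>] J unfolding small_cat_def by metis
  obtain d :: "'q \<Rightarrow> 'u" where d: "inj_on d (Ar J)"
    using small_inj[OF \<kappa>] J unfolding small_cat_def by metis
  define e' where "e' = inv_into (Ob J) e"
  define d' where "d' = inv_into (Ar J) d"
  have e'[simp]: "x \<in> Ob J \<Longrightarrow> e' (e x) = x" for x using e by (simp add: e'_def)
  have d'[simp]: "x \<in> Ar J \<Longrightarrow> d' (d x) = x" for x using d by (simp add: d'_def)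
  define K :: "('u, 'u) cat" where "K = \<lparr>Ob = e ` Ob J, Ar = d ` Ar J, Dom = e \<circ> Dom J \<circ> d',
    Cod = e \<circ> Cod J \<circ> d', Idn = d \<circ> Idn J \<circ> e', Cmp = (\<lambda>g f. d (Cmp J (d' g) (d' f)))\<rparr>"
  have K_simps [simp]: "Ob K = e ` Ob J" "Ar K = d ` Ar J" 
    "f \<in> Ar J \<Longrightarrow> Dom K (d f) = e (Dom J f)" "f \<in> Ar J \<Longrightarrow> Cod K (d f) = e (Cod J f)"
    "a \<in> Ob J \<Longrightarrow> Idn K (e a) = d (Idn J a)"
    "f \<in> Ar J \<Longrightarrow> g \<in> Ar J \<Longrightarrow> Cmp K (d g) (d f) = d (Cmp J g f)" for f g a
    by (auto simp: K_def)
  have homE: "\<exists>a' b' f'. a = e a' \<and> b = e b' \<and> f = d f' \<and> f' \<in> hom J a' b' \<and> a' \<in> Ob J \<and> b' \<in> Ob J"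
    if "f \<in> hom K a b" for f a b
  proof -
    have "f \<in> d ` Ar J" using that by (simp add: in_hom_iff)
    then obtain f' where f': "f = d f'" "f' \<in> Ar J" by blast
    moreover have "a = e (Dom J f')" "b = e (Cod J f')" using that f' by (auto simp: in_hom_iff)
    ultimately show ?thesis using D.C.Dom_Ob[of f'] D.C.Cod_Ob[of f'] unfolding in_hom_iff by blast
  qed
  have inK: "f \<in> hom J a b \<Longrightarrow> d f \<in> hom K (e a) (e b)" for f a b
    by (auto simp: in_hom_iff)
  \<comment> \<open>Composability in \<open>K\<close> is an equality of images under
    \<open>e\<close>; injectivity on \<open>Ob J\<close> makes the underlying arrows composable in
    \<open>J\<close>.\<close>
  have cancel: "a \<in> Ob J \<Longrightarrow> b \<in> Ob J \<Longrightarrow> e a = e b \<Longrightarrow> a = b" for a b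
    using inj_on_eq_iff[OF e] by blast
  have IdnJ: "a \<in> Ob J \<Longrightarrow> Idn J a \<in> Ar J" for a
    by (rule homD(1)[OF D.C.Idn_hom])
  interpret K: category K
  proof
    fix f assume "f \<in> Ar K"
    then show "Dom K f \<in> Ob K" "Cod K f \<in> Ob K" using D.C.Dom_Ob D.C.Cod_Ob by auto
  next
    fix a assume "a \<in> Ob K"
    then show "Idn K a \<in> hom K a a" using D.C.Idn_hom inK by auto
  next
    fix f g a b c assume f: "f \<in> hom K a b" and g: "g \<in> hom K b c"
    obtain a' b' f' where 1: "a = e a'" "b = e b'" "f = d f'" "f' \<in> hom J a' b'" "a' \<in> Ob J" "b' \<in> Ob J"
      using homE[OF f] by blast
    obtain b'' c' g' where 2: "b = e b''" "c = e c'" "g = d g'" "g' \<in> hom J b'' c'" "b'' \<in> Ob J" "c' \<in> Ob J"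
      using homE[OF g] by blast
    have "b'' = b'" using cancel 1 2 by auto
    then have "Cmp J g' f' \<in> hom J a' c'" using 1 2 D.C.Cmp_hom by blast
    then show "Cmp K g f \<in> hom K a c" using 1 2 inK homD(1) by (metis K_simps(6))
  next
    fix f a b assume f: "f \<in> hom K a b"
    obtain a' b' f' where 1: "a = e a'" "b = e b'" "f = d f'" "f' \<in> hom J a' b'" "a' \<in> Ob J" "b' \<in> Ob J"
      using homE[OF f] by blast
    then show "Cmp K (Idn K b) f = f" "Cmp K f (Idn K a) = f"
      using D.C.Cmp_Idn_left[OF 1(4)] D.C.Cmp_Idn_right[OF 1(4)] IdnJ homD(1)[OF 1(4)] by simp_all
  next
    fix f g h a b c u assume f: "f \<in> hom K a b" and g: "g \<in> hom K b c" and h: "h \<in> hom K c u"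
    obtain a' b' f' where 1: "a = e a'" "b = e b'" "f = d f'" "f' \<in> hom J a' b'" "a' \<in> Ob J" "b' \<in> Ob J"
      using homE[OF f] by blast
    obtain b'' c' g' where 2: "b = e b''" "c = e c'" "g = d g'" "g' \<in> hom J b'' c'" "b'' \<in> Ob J" "c' \<in> Ob J"
      using homE[OF g] by blast
    obtain c'' u' h' where 3: "c = e c''" "u = e u'" "h = d h'" "h' \<in> hom J c'' u'" "c'' \<in> Ob J" "u' \<in> Ob J"
      using homE[OF h] by blast
    have eq: "b'' = b'" "c'' = c'" using cancel 1 2 3 by auto
    then have g': "g' \<in> hom J b' c'" and h': "h' \<in> hom J c' u'" using 2 3 by auto
    have "Cmp J g' f' \<in> hom J a' c'" "Cmp J h' g' \<in> hom J b' u'"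
      using 1(4) g' h' D.C.Cmp_hom by blast+
    then show "Cmp K (Cmp K h g) f = Cmp K h (Cmp K g f)"
      using 1 2 3 g' h' D.C.Cmp_assoc[OF 1(4) g' h'] by (simp add: homD(1))
  qed
  define D' where "D' = \<lparr>fob = fob D \<circ> e', far = far D \<circ> d'\<rparr>"
  have D'_simps[simp]: "a \<in> Ob J \<Longrightarrow> fob D' (e a) = fob D a" "f \<in> Ar J \<Longrightarrow> far D' (d f) = far D f" for a f
    by (auto simp: D'_def)
  have D': "cat_functor K C D'"
  proof
    fix a assume "a \<in> Ob K" then show "fob D' a \<in> Ob C" using D.fob_Ob by auto
  next
    fix f a b assume f: "f \<in> hom K a b"
    obtain a' b' f' where 1: "a = e a'" "b = e b'" "f = d f'" "f' \<in> hom J a' b'" "a' \<in> Ob J" "b' \<in> Ob J"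
      using homE[OF f] by blast
    then show "far D' f \<in> hom C (fob D' a) (fob D' b)" using D.far_hom by (simp add: homD(1))
  next
    fix a assume "a \<in> Ob K" then show "far D' (Idn K a) = Idn C (fob D' a)" 
      using D.far_Idn IdnJ by auto
  next
    fix f g a b c assume f: "f \<in> hom K a b" and g: "g \<in> hom K b c"
    obtain a' b' f' where 1: "a = e a'" "b = e b'" "f = d f'" "f' \<in> hom J a' b'" "a' \<in> Ob J" "b' \<in> Ob J"
      using homE[OF f] by blast
    obtain b'' c' g' where 2: "b = e b''" "c = e c'" "g = d g'" "g' \<in> hom J b'' c'" "b'' \<in> Ob J" "c' \<in> Ob J"
      using homE[OF g] by blast
    have "b'' = b'" using cancel 1 2 by auto
    then have g': "g' \<in> hom J b' c'" using 2 by simp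
    then show "far D' (Cmp K g f) = Cmp C (far D' g) (far D' f)"
      using 1 2 D.far_Cmp[OF 1(4) g'] D.C.Cmp_hom[OF 1(4) g'] by (simp add: homD(1))
  qed
  have "small_cat \<kappa> K"
    using J K.category_axioms by (auto simp: small_cat_def intro: ordLeq_ordLess_trans[OF card_of_image])
  with D' C obtain c \<iota> where c: "is_colimit K C D' c \<iota>"
    unfolding cocomplete_def by blast
  have cocone_iff: "cocone K C D' x \<tau> \<longleftrightarrow> cocone J C D x (\<tau> \<circ> e)" for x \<tau>
    using D.C.Dom_Ob D.C.Cod_Ob by (auto simp: cocone_def)
  have "is_colimit J C D c (\<iota> \<circ> e)"
    unfolding is_colimit_def
  proof (intro conjI allI impI)
    show "cocone J C D c (\<iota> \<circ> e)" using c cocone_iff by (auto simp: is_colimit_def)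
    fix c' \<tau> assume \<tau>: "cocone J C D c' \<tau>"
    then have "cocone K C D' c' (\<tau> \<circ> e')"
      unfolding cocone_iff using D.C.Dom_Ob D.C.Cod_Ob by (auto simp: cocone_def)
    then have "\<exists>!h. h \<in> hom C c c' \<and> (\<forall>j \<in> Ob K. Cmp C h (\<iota> j) = (\<tau> \<circ> e') j)"
      using c unfolding is_colimit_def by blast
    then show "\<exists>!h. h \<in> hom C c c' \<and> (\<forall>j \<in> Ob J. Cmp C h ((\<iota> \<circ> e) j) = \<tau> j)"
      by simp
  qed
  then show ?thesis by blast
qed

lemma finite_card_of_less:
  assumes "Card_order \<kappa>" "infinite (Field \<kappa>)" "finite A"
  shows "|A| <o \<kappa>"
  by (rule finite_ordLess_infinite[OF card_of_Well_order card_order_on_well_order_on[OF assms(1)]])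
    (simp_all add: assms Field_card_of)

text \<open>Induction over the finite factor: one more element adds a copy of \<open>B\<close>, and
  sets smaller than an infinite cardinal are closed under binary unions.\<close>

lemma card_of_finite_Times_less:
  assumes "Card_order \<kappa>" "infinite (Field \<kappa>)" "finite A" "|B| <o \<kappa>"
  shows "|A \<times> B| <o \<kappa>"
  using assms(3)
proof (induction A rule: finite_induct)
  case empty
  show ?case by (rule finite_card_of_less[OF assms(1,2)]) simp
next
  case (insert a A)
  have "insert a A \<times> B = (Pair a ` B) \<union> (A \<times> B)" by auto
  then show ?case
    using card_of_Un_ordLess_infinite_Field[OF assms(2,1) ordLeq_ordLess_trans[OF card_of_image assms(4)] insert.IH]
    by simp
qed

text \<open>A presentation consists of generators \<open>i \<in> I\<close> of type \<open>ob i\<close> and of relations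
  \<open>(i, p, i', q)\<close>, which stand for the equation \<open>k i \<cdot> p = k i' \<cdot> q\<close>.\<close>

definition presentation ::
  "('o, 'a, 'z) cat_scheme \<Rightarrow> 'i set \<Rightarrow> ('i \<Rightarrow> 'o) \<Rightarrow> ('i \<times> 'a \<times> 'i \<times> 'a) set \<Rightarrow> bool" where
  "presentation C I ob R \<longleftrightarrow> (\<forall>i \<in> I. ob i \<in> Ob C) \<and>
     (\<forall>(i, p, i', q) \<in> R. i \<in> I \<and> i' \<in> I \<and> (\<exists>x. p \<in> hom C x (ob i) \<and> q \<in> hom C x (ob i')))"

definition presented_cocone ::
  "('o, 'a, 'z) cat_scheme \<Rightarrow> 'i set \<Rightarrow> ('i \<Rightarrow> 'o) \<Rightarrow> ('i \<times> 'a \<times> 'i \<times> 'a) set \<Rightarrow> 'o \<Rightarrow> ('i \<Rightarrow> 'a) \<Rightarrow> bool" where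
  "presented_cocone C I ob R c k \<longleftrightarrow> c \<in> Ob C \<and> (\<forall>i \<in> I. k i \<in> hom C (ob i) c) \<and>
     (\<forall>(i, p, i', q) \<in> R. Cmp C (k i) p = Cmp C (k i') q)"

definition presented_colimit ::
  "('o, 'a, 'z) cat_scheme \<Rightarrow> 'i set \<Rightarrow> ('i \<Rightarrow> 'o) \<Rightarrow> ('i \<times> 'a \<times> 'i \<times> 'a) set \<Rightarrow> 'o \<Rightarrow> ('i \<Rightarrow> 'a) \<Rightarrow> bool" where
  "presented_colimit C I ob R c k \<longleftrightarrow> presented_cocone C I ob R c k \<and>
     (\<forall>c' k'. presented_cocone C I ob R c' k' \<longrightarrow>
        (\<exists>!h. h \<in> hom C c c' \<and> (\<forall>i \<in> I. Cmp C h (k i) = k' i)))"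

section \<open>Existence of colimits of presentations\<close>

lemma presented_colimit_cong:
  assumes "\<And>i. i \<in> I \<Longrightarrow> ob i = ob' i"
  shows "presented_colimit C I ob R c k \<longleftrightarrow> presented_colimit C I ob' R c k"
proof -
  have "presented_cocone C I ob R c k \<longleftrightarrow> presented_cocone C I ob' R c k" for c k
    using assms by (auto simp: presented_cocone_def)
  then show ?thesis by (simp add: presented_colimit_def)
qed

text \<open>The presentation becomes a diagram over a category with one object per generator, one
  per relation, and two arrows from each relation to the generators it equates. Non-identity arrows
  start at relations and end at generators, hence are never composable, and a cocone amounts to a
  family \<open>k\<close> that satisfies the equations.\<close>

lemma presented_colimit_exists:
  fixes \<kappa> :: "'u rel" and C :: "('o, 'a, 'z) cat_scheme" and I :: "'i set"
  assumes \<kappa>: "Card_order \<kappa>" "infinite (Field \<kappa>)" and C: "cocomplete \<kappa> C"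
    and P: "presentation C I ob R" and small: "|I| <o \<kappa>" "|R| <o \<kappa>"
  shows "\<exists>c k. presented_colimit C I ob R c k"
proof -
  interpret C: category C using C by (simp add: cocomplete_def)
  \<comment> \<open>\<open>Inl r\<close> and \<open>Inr r\<close> in \<open>R <+> R\<close> are the
    left and the right leg of the relation \<open>r\<close>: \<open>cd\<close> is the generator
    where a leg ends, \<open>ma\<close> its arrow, \<open>dm\<close> the relation where it
    starts.\<close>
  define cd :: "('i \<times> 'a \<times> 'i \<times> 'a) + ('i \<times> 'a \<times> 'i \<times> 'a) \<Rightarrow> 'i"
    where "cd y = (case y of Inl r \<Rightarrow> fst r | Inr r \<Rightarrow> fst (snd (snd r)))" for y
  define ma :: "('i \<times> 'a \<times> 'i \<times> 'a) + ('i \<times> 'a \<times> 'i \<times> 'a) \<Rightarrow> 'a"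
    where "ma y = (case y of Inl r \<Rightarrow> fst (snd r) | Inr r \<Rightarrow> snd (snd (snd r)))" for y
  define dm :: "('i \<times> 'a \<times> 'i \<times> 'a) + ('i \<times> 'a \<times> 'i \<times> 'a) \<Rightarrow> ('i \<times> 'a \<times> 'i \<times> 'a)"
    where "dm y = (case y of Inl r \<Rightarrow> r | Inr r \<Rightarrow> r)" for y
  \<comment> \<open>\<open>Inl x\<close> is the identity of \<open>x\<close>. Of two composable
    arrows at least one is an identity, so a case distinction on \<open>f\<close> determines the
    composite: \<open>g\<close> if \<open>f\<close> is an identity, otherwise
    \<open>f\<close>.\<close>
  define J :: "('i + ('i \<times> 'a \<times> 'i \<times> 'a),
      ('i + ('i \<times> 'a \<times> 'i \<times> 'a)) + (('i \<times> 'a \<times> 'i \<times> 'a) + ('i \<times> 'a \<times> 'i \<times> 'a))) cat"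
    where "J = \<lparr>Ob = I <+> R, Ar = (I <+> R) <+> (R <+> R),
      Dom = (\<lambda>f. case f of Inl x \<Rightarrow> x | Inr y \<Rightarrow> Inr (dm y)),
      Cod = (\<lambda>f. case f of Inl x \<Rightarrow> x | Inr y \<Rightarrow> Inl (cd y)),
      Idn = Inl, Cmp = (\<lambda>g f. case f of Inl x \<Rightarrow> g | Inr y \<Rightarrow> f)\<rparr>"
  \<comment> \<open>A relation goes to the domain of its left arrow \<open>p\<close>, which by
    \<open>presentation\<close> is the domain of \<open>q\<close> too.\<close>
  define D :: "('i + ('i \<times> 'a \<times> 'i \<times> 'a), ('i + ('i \<times> 'a \<times> 'i \<times> 'a)) + (('i \<times> 'a \<times> 'i \<times> 'a) + ('i \<times> 'a \<times> 'i \<times> 'a)), 'o, 'a) fnctr"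
    where "D = \<lparr>fob = (\<lambda>x :: 'i + ('i \<times> 'a \<times> 'i \<times> 'a). case x of Inl i \<Rightarrow> ob i | Inr r \<Rightarrow> Dom C (fst (snd r))),
      far = (\<lambda>f. case f of Inl (Inl i) \<Rightarrow> Idn C (ob i) | Inl (Inr r) \<Rightarrow> Idn C (Dom C (fst (snd r)))
                  | Inr y \<Rightarrow> ma y)\<rparr>"
  have cdI: "y \<in> R <+> R \<Longrightarrow> cd y \<in> I" and dmR: "y \<in> R <+> R \<Longrightarrow> dm y \<in> R" for y
    using P by (auto simp: presentation_def cd_def dm_def)
  have ma: "y \<in> R <+> R \<Longrightarrow> ma y \<in> hom C (Dom C (fst (snd (dm y)))) (ob (cd y))" for y
    using P by (fastforce simp: presentation_def cd_def dm_def ma_def hom_def)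
  have obI: "i \<in> I \<Longrightarrow> ob i \<in> Ob C" for i using P by (auto simp: presentation_def)
  have obR: "r \<in> R \<Longrightarrow> Dom C (fst (snd r)) \<in> Ob C" for r
    using P C.Dom_Ob by (fastforce simp: presentation_def hom_def)
  have J_simps: "Ob J = I <+> R" "Ar J = (I <+> R) <+> (R <+> R)" "Dom J (Inl x) = x" "Dom J (Inr y) = Inr (dm y)"
    "Cod J (Inl x) = x" "Cod J (Inr y) = Inl (cd y)" "Idn J x = Inl x"
    "Cmp J g (Inl x) = g" "Cmp J g (Inr y) = Inr y" for x y g
    by (simp_all add: J_def)
  have homJ: "(f = Inl a \<and> b = a \<and> a \<in> Ob J) \<or>
      (\<exists>y. f = Inr y \<and> y \<in> R <+> R \<and> a = Inr (dm y) \<and> b = Inl (cd y))" if "f \<in> hom J a b" for f a b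
    using that by (cases f) (auto simp only: in_hom_iff J_simps Inl_Inr_in_Plus)
  have homJI: "a \<in> Ob J \<Longrightarrow> Inl a \<in> hom J a a" for a
    by (simp only: in_hom_iff J_simps Inl_Inr_in_Plus)
  interpret J: category J
  proof (standard, goal_cases)
    case (1 f) then show ?case using dmR by (cases f) (auto simp only: J_simps Inl_Inr_in_Plus)
  next
    case (2 f) then show ?case using cdI by (cases f) (auto simp only: J_simps Inl_Inr_in_Plus)
  next
    case (3 a) then show ?case using homJI by (simp only: J_simps)
  next
    case (4 f a b g c)
    from homJ[OF 4(1)] show ?case
    proof (elim disjE exE conjE)
      fix y assume y: "f = Inr y" "b = Inl (cd y)"
      then have "c = b" using homJ[OF 4(2)] by auto
      then show ?thesis using 4(1) y by (simp only: J_simps)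
    qed (use 4 in \<open>simp only: J_simps\<close>)
  next
    case (5 f a b) 
    from homJ[OF 5] show ?case by (elim disjE exE conjE) (simp_all only: J_simps)
  next
    case (6 f a b) then show ?case by (simp only: J_simps)
  next
    case (7 f a b g c h d)
    from homJ[OF 7(1)] show ?case by (elim disjE exE conjE) (simp_all only: J_simps)
  qed
  have obD: "x \<in> Ob J \<Longrightarrow> fob D x \<in> Ob C" for x
    using obI obR by (auto simp: J_def D_def)
  have idD: "far D (Inl x) = Idn C (fob D x)" for x
    by (auto simp: D_def split: sum.splits)
  have arD: "far D f \<in> hom C (fob D a) (fob D b)" if "f \<in> hom J a b" for f a b
    using homJ[OF that]
  proof (elim disjE exE conjE)
    fix y assume "f = Inr y" "y \<in> R <+> R" "a = Inr (dm y)" "b = Inl (cd y)"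
    then show ?thesis using ma[of y] by (simp add: D_def)
  qed (use obD C.Idn_hom in \<open>simp add: idD\<close>)
  interpret D: cat_functor J C D
  proof (standard, goal_cases)
    case (1 a) then show ?case by (rule obD)
  next
    case (2 f a b) then show ?case by (rule arD)
  next
    case (3 a) then show ?case by (simp add: J_def idD)
  next
    case (4 f a b g c)
    show ?case
      using homJ[OF 4(1)]
    proof (elim disjE exE conjE)
      assume "f = Inl a" "b = a"
      then show ?thesis using C.Cmp_Idn_right[OF arD[OF 4(2)]] by (simp add: J_def idD)
    next
      fix y assume y: "f = Inr y" "b = Inl (cd y)"
      then have "g = Inl b" "c = b" using homJ[OF 4(2)] by auto
      then show ?thesis using C.Cmp_Idn_left[OF arD[OF 4(1)]] y by (simp add: J_def idD)
    qed
  qed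
  have "|I <+> R| <o \<kappa>" "|R <+> R| <o \<kappa>"
    using \<kappa> small card_of_Plus_ordLess_infinite_Field by blast+
  then have "|(I <+> R) <+> (R <+> R)| <o \<kappa>"
    using \<kappa> card_of_Plus_ordLess_infinite_Field by blast
  with \<open>|I <+> R| <o \<kappa>\<close> have "small_cat \<kappa> J"
    by (simp add: small_cat_def J.category_axioms J_simps)
  then obtain c \<iota> where c: "is_colimit J C D c \<iota>"
    using cocomplete_colimit[OF \<kappa>(1) C _ D.cat_functor_axioms] by blast
  have ObJ: "Ob J = I <+> R" by (simp add: J_def)
  have fobD: "fob D (Inl i) = ob i" for i by (simp add: D_def)
  \<comment> \<open>At a relation the component of a cocone is forced to be the common composite, so
    the components at generators carry all the information.\<close>
  have to_pc: "presented_cocone C I ob R x (\<lambda>i. \<tau> (Inl i))"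
    and toR: "(i, p, i', q) \<in> R \<Longrightarrow> \<tau> (Inr (i, p, i', q)) = Cmp C (\<tau> (Inl i)) p"
    if "cocone J C D x \<tau>" for x \<tau> i p i' q
  proof -
    have *: "Cmp C (\<tau> (Inl (cd y))) (ma y) = \<tau> (Inr (dm y))" if "y \<in> R <+> R" for y
    proof -
      have "Inr y \<in> Ar J" using that by (simp only: J_simps Inl_Inr_in_Plus)
      then have "Cmp C (\<tau> (Cod J (Inr y))) (far D (Inr y)) = \<tau> (Dom J (Inr y))"
        using \<open>cocone J C D x \<tau>\<close> unfolding cocone_def by blast
      then show ?thesis by (simp add: J_def D_def)
    qed
    have **: "Cmp C (\<tau> (Inl i)) p = \<tau> (Inr (i, p, i', q))" "Cmp C (\<tau> (Inl i')) q = \<tau> (Inr (i, p, i', q))"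
      if "(i, p, i', q) \<in> R" for i p i' q
      using *[of "Inl (i, p, i', q)"] *[of "Inr (i, p, i', q)"] that by (auto simp: cd_def ma_def dm_def)
    then show "(i, p, i', q) \<in> R \<Longrightarrow> \<tau> (Inr (i, p, i', q)) = Cmp C (\<tau> (Inl i)) p" by simp
    show "presented_cocone C I ob R x (\<lambda>i. \<tau> (Inl i))"
      using \<open>cocone J C D x \<tau>\<close> ** by (auto simp: presented_cocone_def cocone_def ObJ fobD[symmetric])
  qed
  have "presented_colimit C I ob R c (\<lambda>i. \<iota> (Inl i))"
    unfolding presented_colimit_def
  proof (intro conjI allI impI)
    have coc: "cocone J C D c \<iota>" using c by (simp add: is_colimit_def)
    then show "presented_cocone C I ob R c (\<lambda>i. \<iota> (Inl i))" by (rule to_pc)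
    fix c' k' assume k': "presented_cocone C I ob R c' k'"
    \<comment> \<open>Conversely, the common composite extends \<open>k'\<close> to the objects that
      stand for relations.\<close>
    define \<tau> where "\<tau> (x :: 'i + ('i \<times> 'a \<times> 'i \<times> 'a)) = (case x of Inl i \<Rightarrow> k' i | Inr r \<Rightarrow> Cmp C (k' (fst r)) (fst (snd r)))" for x
    have hk': "k' (cd y) \<in> hom C (ob (cd y)) c'" if "y \<in> R <+> R" for y
      using k' cdI[OF that] by (auto simp: presented_cocone_def)
    have eq: "Cmp C (k' (cd y)) (ma y) = Cmp C (k' (fst (dm y))) (fst (snd (dm y)))" if "y \<in> R <+> R" for y
      using k' that by (auto simp: presented_cocone_def cd_def ma_def dm_def)
    have coc': "cocone J C D c' \<tau>"
      unfolding cocone_def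
    proof (intro conjI ballI)
      show "c' \<in> Ob C" using k' by (simp add: presented_cocone_def)
    next
      fix x assume x: "x \<in> Ob J"
      show "\<tau> x \<in> hom C (fob D x) c'"
      proof (cases x)
        case (Inl i)
        then show ?thesis using x k' by (auto simp: ObJ \<tau>_def presented_cocone_def fobD)
      next
        case (Inr r)
        then have "Inl r \<in> R <+> R" using x by (auto simp: ObJ)
        from C.Cmp_hom[OF ma[OF this] hk'[OF this]] show ?thesis
          by (simp add: Inr \<tau>_def D_def dm_def cd_def ma_def)
      qed
    next
      fix u assume u: "u \<in> Ar J"
      show "Cmp C (\<tau> (Cod J u)) (far D u) = \<tau> (Dom J u)"
      proof (cases u)
        case (Inl x)
        have "\<tau> x \<in> hom C (fob D x) c'" if "x \<in> Ob J"
        proof (cases x)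
          case (Inl i)
          then show ?thesis using that k' by (auto simp: ObJ \<tau>_def presented_cocone_def fobD)
        next
          case (Inr r)
          then have "Inl r \<in> R <+> R" using that by (auto simp: ObJ)
          from C.Cmp_hom[OF ma[OF this] hk'[OF this]] show ?thesis
            by (simp add: Inr \<tau>_def D_def dm_def cd_def ma_def)
        qed
        then show ?thesis using Inl u C.Cmp_Idn_right by (auto simp: J_def idD)
      next
        case (Inr y)
        then show ?thesis using u eq[of y] by (auto simp: J_def D_def \<tau>_def)
      qed
    qed
    \<comment> \<open>Compatibility at relations follows from that at generators by associativity,
      so both universal properties single out the same \<open>h\<close>.\<close>
    have "(h \<in> hom C c c' \<and> (\<forall>i \<in> I. Cmp C h (\<iota> (Inl i)) = k' i)) \<longleftrightarrow>
      (h \<in> hom C c c' \<and> (\<forall>j \<in> Ob J. Cmp C h (\<iota> j) = \<tau> j))" for h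
    proof (intro conj_cong refl iffI ballI)
      fix x assume h: "h \<in> hom C c c'" "\<forall>i \<in> I. Cmp C h (\<iota> (Inl i)) = k' i" and x: "x \<in> Ob J"
      show "Cmp C h (\<iota> x) = \<tau> x"
      proof (cases x)
        case (Inl i)
        then show ?thesis using x h by (auto simp: ObJ \<tau>_def)
      next
        case (Inr r)
        obtain i p i' q where r: "r = (i, p, i', q)" by (cases r)
        have rR: "(i, p, i', q) \<in> R" using x Inr r by (auto simp: ObJ)
        then have i: "i \<in> I" and p: "p \<in> hom C (Dom C p) (ob i)" using P by (auto simp: presentation_def hom_def)
        have "\<iota> (Inl i) \<in> hom C (ob i) c" using coc i by (auto simp: cocone_def ObJ fobD[symmetric])
        from C.Cmp_assoc[OF p this h(1)] show ?thesis
          using h(2) i by (simp add: Inr r toR[OF coc rR] \<tau>_def)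
      qed
    next
      fix i assume "\<forall>j \<in> Ob J. Cmp C h (\<iota> j) = \<tau> j" "i \<in> I"
      then show "Cmp C h (\<iota> (Inl i)) = k' i" by (force simp: ObJ \<tau>_def)
    qed
    moreover have "\<exists>!h. h \<in> hom C c c' \<and> (\<forall>j \<in> Ob J. Cmp C h (\<iota> j) = \<tau> j)"
      using c coc' unfolding is_colimit_def by blast
    ultimately show "\<exists>!h. h \<in> hom C c c' \<and> (\<forall>i \<in> I. Cmp C h (\<iota> (Inl i)) = k' i)" by simp
  qed
  then show ?thesis by blast
qed

section \<open>Lax algebras over a graded category with concatenation\<close>

text \<open>This axiomatises what the recursion over paths uses. By \<open>deg_hom\<close> and
  \<open>deg_eq_Idn\<close> a non-identity arrow lowers the degree; by \<open>deg_pos\<close> and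
  \<open>deg_cob\<close> so does passing to a factor of a splitting; the two finiteness assumptions
  keep the presentations small. \<open>comp\<close> records which pairs can be concatenated, as
  concatenation is partial.\<close>

locale graded_concat_category = category S for S :: "('s, 'f, 'w) cat_scheme" +
  fixes deg :: "'s \<Rightarrow> nat"
    and comp :: "'s \<Rightarrow> 's \<Rightarrow> bool"
    and cob :: "'s \<Rightarrow> 's \<Rightarrow> 's"
    and car :: "'f \<Rightarrow> 'f \<Rightarrow> 'f"
  assumes comp_Ob: "comp s u \<Longrightarrow> s \<in> Ob S" "comp s u \<Longrightarrow> u \<in> Ob S"
    and cob_Ob: "comp s u \<Longrightarrow> cob s u \<in> Ob S"
    and deg_pos: "s \<in> Ob S \<Longrightarrow> 0 < deg s"
    and deg_cob: "comp s u \<Longrightarrow> deg (cob s u) = deg s + deg u"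
    and deg_hom: "f \<in> hom S s s' \<Longrightarrow> deg s' \<le> deg s"
    and deg_eq_Idn: "f \<in> hom S s s' \<Longrightarrow> deg s' = deg s \<Longrightarrow> f = Idn S s"
    and finite_out: "t \<in> Ob S \<Longrightarrow> finite {f \<in> Ar S. Dom S f = t}"
    and finite_splittings: "finite {(s, u). comp s u \<and> cob s u = t}"
    and comp_cob: "comp s t \<Longrightarrow> comp t u \<Longrightarrow> comp (cob s t) u" "comp s t \<Longrightarrow> comp t u \<Longrightarrow> comp s (cob t u)"
    and cob_assoc: "comp s t \<Longrightarrow> comp t u \<Longrightarrow> cob (cob s t) u = cob s (cob t u)"
    and comp_hom: "comp s u \<Longrightarrow> f \<in> hom S s s' \<Longrightarrow> g \<in> hom S u u' \<Longrightarrow> comp s' u'"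
    and car_hom: "comp s u \<Longrightarrow> f \<in> hom S s s' \<Longrightarrow> g \<in> hom S u u' \<Longrightarrow>
                    car f g \<in> hom S (cob s u) (cob s' u')"
    and car_Idn: "comp s u \<Longrightarrow> car (Idn S s) (Idn S u) = Idn S (cob s u)"
begin

lemma deg_less:
  assumes "f \<in> hom S s s'" "f \<noteq> Idn S s"
  shows "deg s' < deg s"
  using deg_hom deg_eq_Idn assms by (meson le_neq_implies_less)

lemma deg_cob_less: 
  assumes "comp s u"
  shows "deg s < deg (cob s u)" "deg u < deg (cob s u)"
  using deg_cob[OF assms] deg_pos[OF comp_Ob(1)[OF assms]] deg_pos[OF comp_Ob(2)[OF assms]] by auto

text \<open>These are the five objects whose stages occur in the associativity relation for
  \<open>s\<close>, \<open>w\<close>, \<open>u\<close>.\<close>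

lemma deg_cob_cob_less: 
  assumes "comp s w" "comp w u"
  shows "deg s < deg (cob (cob s w) u)" "deg w < deg (cob (cob s w) u)" "deg u < deg (cob (cob s w) u)"
    "deg (cob s w) < deg (cob (cob s w) u)" "deg (cob w u) < deg (cob (cob s w) u)"
  using deg_cob[OF assms(1)] deg_cob[OF assms(2)] deg_cob[OF comp_cob(1)[OF assms]]
    deg_pos[OF comp_Ob(1)[OF assms(1)]] deg_pos[OF comp_Ob(1)[OF assms(2)]] deg_pos[OF comp_Ob(2)[OF assms(2)]]
  by auto

end

record ('s, 'f, 'o, 'a) lax_alg =
  aob :: "'s \<Rightarrow> 'o"
  aar :: "'f \<Rightarrow> 'a"
  alax :: "'s \<Rightarrow> 's \<Rightarrow> 'a"

locale lax_algebras = monoidal_category M + S: graded_concat_category S deg comp cob car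
  for M :: "('o, 'a, 'z) mon_cat_scheme" (structure)
    and S :: "('s, 'f, 'w) cat_scheme" and deg comp cob car
begin

text \<open>The lax functor axioms with one index category in place of a family; \<open>aar\<close>
  is contravariant. Values outside the objects, arrows and composable pairs are left free, so that a
  structure may be assembled from a choice function.\<close>

definition lax_algebra :: "('s, 'f, 'o, 'a) lax_alg \<Rightarrow> bool" where
  "lax_algebra G \<longleftrightarrow>
     (\<forall>s \<in> Ob S. aob G s \<in> Ob M) \<and>
     (\<forall>s s' f. f \<in> hom S s s' \<longrightarrow> aar G f \<in> hom M (aob G s') (aob G s)) \<and>
     (\<forall>s \<in> Ob S. aar G (Idn S s) = Idn M (aob G s)) \<and>
     (\<forall>s s' s'' f g. f \<in> hom S s s' \<longrightarrow> g \<in> hom S s' s'' \<longrightarrow> aar G (Cmp S g f) = aar G f \<cdot> aar G g) \<and>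
     (\<forall>s u. comp s u \<longrightarrow> alax G s u \<in> hom M (aob G s \<odot> aob G u) (aob G (cob s u))) \<and>
     (\<forall>s u s' u' f g. comp s u \<longrightarrow> f \<in> hom S s s' \<longrightarrow> g \<in> hom S u u' \<longrightarrow>
        alax G s u \<cdot> (aar G f \<otimes> aar G g) = aar G (car f g) \<cdot> alax G s' u') \<and>
     (\<forall>s t u. comp s t \<longrightarrow> comp t u \<longrightarrow>
        alax G (cob s t) u \<cdot> (alax G s t \<otimes> Idn M (aob G u)) =
        alax G s (cob t u) \<cdot> (Idn M (aob G s) \<otimes> alax G t u) \<cdot> Assoc M (aob G s) (aob G t) (aob G u))"

lemma lax_algebraD:
  assumes "lax_algebra G"
  shows "s \<in> Ob S \<Longrightarrow> aob G s \<in> Ob M"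
    and "f \<in> hom S s s' \<Longrightarrow> aar G f \<in> hom M (aob G s') (aob G s)"
    and "s \<in> Ob S \<Longrightarrow> aar G (Idn S s) = Idn M (aob G s)"
    and "f \<in> hom S s s' \<Longrightarrow> g \<in> hom S s' s'' \<Longrightarrow> aar G (Cmp S g f) = aar G f \<cdot> aar G g"
    and "comp s u \<Longrightarrow> alax G s u \<in> hom M (aob G s \<odot> aob G u) (aob G (cob s u))"
    and "comp s u \<Longrightarrow> f \<in> hom S s s' \<Longrightarrow> g \<in> hom S u u' \<Longrightarrow>
        alax G s u \<cdot> (aar G f \<otimes> aar G g) = aar G (car f g) \<cdot> alax G s' u'"
    and "comp s t \<Longrightarrow> comp t u \<Longrightarrow>
        alax G (cob s t) u \<cdot> (alax G s t \<otimes> Idn M (aob G u)) =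
        alax G s (cob t u) \<cdot> (Idn M (aob G s) \<otimes> alax G t u) \<cdot> Assoc M (aob G s) (aob G t) (aob G u)"
proof -
  note * = assms[unfolded lax_algebra_def]
  show "s \<in> Ob S \<Longrightarrow> aob G s \<in> Ob M"
    by (rule *[THEN conjunct1, rule_format])
  show "f \<in> hom S s s' \<Longrightarrow> aar G f \<in> hom M (aob G s') (aob G s)"
    by (rule *[THEN conjunct2, THEN conjunct1, rule_format])
  show "s \<in> Ob S \<Longrightarrow> aar G (Idn S s) = Idn M (aob G s)"
    by (rule *[THEN conjunct2, THEN conjunct2, THEN conjunct1, rule_format])
  show "f \<in> hom S s s' \<Longrightarrow> g \<in> hom S s' s'' \<Longrightarrow> aar G (Cmp S g f) = aar G f \<cdot> aar G g"
    by (rule *[THEN conjunct2, THEN conjunct2, THEN conjunct2, THEN conjunct1, rule_format])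
  show "comp s u \<Longrightarrow> alax G s u \<in> hom M (aob G s \<odot> aob G u) (aob G (cob s u))"
    by (rule *[THEN conjunct2, THEN conjunct2, THEN conjunct2, THEN conjunct2, THEN conjunct1, rule_format])
  show "comp s u \<Longrightarrow> f \<in> hom S s s' \<Longrightarrow> g \<in> hom S u u' \<Longrightarrow>
        alax G s u \<cdot> (aar G f \<otimes> aar G g) = aar G (car f g) \<cdot> alax G s' u'"
    by (rule *[THEN conjunct2, THEN conjunct2, THEN conjunct2, THEN conjunct2, THEN conjunct2, THEN conjunct1, rule_format])
  show "comp s t \<Longrightarrow> comp t u \<Longrightarrow>
        alax G (cob s t) u \<cdot> (alax G s t \<otimes> Idn M (aob G u)) =
        alax G s (cob t u) \<cdot> (Idn M (aob G s) \<otimes> alax G t u) \<cdot> Assoc M (aob G s) (aob G t) (aob G u)"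
    by (rule *[THEN conjunct2, THEN conjunct2, THEN conjunct2, THEN conjunct2, THEN conjunct2, THEN conjunct2, rule_format])
qed

definition lax_map :: "('s, 'f, 'o, 'a) lax_alg \<Rightarrow> ('s, 'f, 'o, 'a) lax_alg \<Rightarrow> ('s \<Rightarrow> 'a) \<Rightarrow> bool" where
  "lax_map F G \<sigma> \<longleftrightarrow>
     (\<forall>s \<in> Ob S. \<sigma> s \<in> hom M (aob F s) (aob G s)) \<and>
     (\<forall>s s' f. f \<in> hom S s s' \<longrightarrow> \<sigma> s \<cdot> aar F f = aar G f \<cdot> \<sigma> s') \<and>
     (\<forall>s u. comp s u \<longrightarrow> \<sigma> (cob s u) \<cdot> alax F s u = alax G s u \<cdot> (\<sigma> s \<otimes> \<sigma> u))"

lemma lax_mapD: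
  assumes "lax_map F G \<sigma>"
  shows "s \<in> Ob S \<Longrightarrow> \<sigma> s \<in> hom M (aob F s) (aob G s)"
    and "f \<in> hom S s s' \<Longrightarrow> \<sigma> s \<cdot> aar F f = aar G f \<cdot> \<sigma> s'"
    and "comp s u \<Longrightarrow> \<sigma> (cob s u) \<cdot> alax F s u = alax G s u \<cdot> (\<sigma> s \<otimes> \<sigma> u)"
proof -
  note * = assms[unfolded lax_map_def]
  show "s \<in> Ob S \<Longrightarrow> \<sigma> s \<in> hom M (aob F s) (aob G s)"
    by (rule *[THEN conjunct1, rule_format])
  show "f \<in> hom S s s' \<Longrightarrow> \<sigma> s \<cdot> aar F f = aar G f \<cdot> \<sigma> s'"
    by (rule *[THEN conjunct2, THEN conjunct1, rule_format])
  show "comp s u \<Longrightarrow> \<sigma> (cob s u) \<cdot> alax F s u = alax G s u \<cdot> (\<sigma> s \<otimes> \<sigma> u)"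
    by (rule *[THEN conjunct2, THEN conjunct2, rule_format])
qed

lemma Assoc_hom:
  "a \<in> Ob M \<Longrightarrow> b \<in> Ob M \<Longrightarrow> c \<in> Ob M \<Longrightarrow> Assoc M a b c \<in> hom M (a \<odot> b \<odot> c) (a \<odot> (b \<odot> c))"
  using Assoc_isom by (simp add: isom_def)

end

section \<open>The generators and relations of the colimit\<close>

datatype ('j, 's, 'f) generator = Inj 'j | Act 'f | Mul 's 's

text \<open>Object and coprojections are bundled into one value at each object of \<open>S\<close>,
  so that a single well-founded choice produces both.\<close>

type_synonym ('j, 's, 'f, 'o, 'a) stage = "'s \<Rightarrow> 'o \<times> (('j, 's, 'f) generator \<Rightarrow> 'a)"

text \<open>The index category enters through its vertices \<open>JO\<close>, its edges
  \<open>JA\<close> and their ends, because a cocone is a condition on single edges.\<close>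

locale lax_diagram = lax_algebras M S deg comp cob car
  for M :: "('o, 'a, 'z) mon_cat_scheme" (structure)
    and S :: "('s, 'f, 'w) cat_scheme" and deg comp cob car +
  fixes JO :: "'j set" and JA :: "'e set" and jd jc :: "'e \<Rightarrow> 'j"
    and D :: "'j \<Rightarrow> ('s, 'f, 'o, 'a) lax_alg" and T :: "'e \<Rightarrow> 's \<Rightarrow> 'a"
  assumes jd: "u \<in> JA \<Longrightarrow> jd u \<in> JO" and jc: "u \<in> JA \<Longrightarrow> jc u \<in> JO"
    and D: "j \<in> JO \<Longrightarrow> lax_algebra (D j)"
    and T: "u \<in> JA \<Longrightarrow> lax_map (D (jd u)) (D (jc u)) (T u)"
begin

text \<open>A stage assigns to each \<open>t\<close> an object and arrows into it, one for each generator at \<open>t\<close>.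
  Identity arrows are not generators, so \<open>vact\<close> treats them separately.\<close>

definition vob :: "('j, 's, 'f, 'o, 'a) stage \<Rightarrow> 's \<Rightarrow> 'o" where
  "vob v t = fst (v t)"

definition vinj :: "('j, 's, 'f, 'o, 'a) stage \<Rightarrow> 'j \<Rightarrow> 's \<Rightarrow> 'a" where
  "vinj v j t = snd (v t) (Inj j)"

definition vact :: "('j, 's, 'f, 'o, 'a) stage \<Rightarrow> 'f \<Rightarrow> 'a" where
  "vact v f = (if f = Idn S (Dom S f) then Idn M (vob v (Dom S f)) else snd (v (Dom S f)) (Act f))"

definition vmul :: "('j, 's, 'f, 'o, 'a) stage \<Rightarrow> 's \<Rightarrow> 's \<Rightarrow> 'a" where
  "vmul v s u = snd (v (cob s u)) (Mul s u)"

definition gens :: "'s \<Rightarrow> ('j, 's, 'f) generator set" where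
  "gens t = Inj ` JO \<union> Act ` {f \<in> Ar S. Dom S f = t \<and> f \<noteq> Idn S t}
     \<union> (\<lambda>(s, u). Mul s u) ` {(s, u). comp s u \<and> cob s u = t}"

lemma gens_simps:
  "Inj j \<in> gens t \<longleftrightarrow> j \<in> JO"
  "Act f \<in> gens t \<longleftrightarrow> f \<in> Ar S \<and> Dom S f = t \<and> f \<noteq> Idn S t"
  "Mul s u \<in> gens t \<longleftrightarrow> comp s u \<and> cob s u = t"
  by (auto simp: gens_def)

definition gob :: "('j, 's, 'f, 'o, 'a) stage \<Rightarrow> 's \<Rightarrow> ('j, 's, 'f) generator \<Rightarrow> 'o" where
  "gob v t i = (case i of Inj j \<Rightarrow> aob (D j) t | Act f \<Rightarrow> vob v (Cod S f) | Mul s u \<Rightarrow> vob v s \<odot> vob v u)"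

lemma gob_simps [simp]:
  "gob v t (Inj j) = aob (D j) t" "gob v t (Act f) = vob v (Cod S f)" "gob v t (Mul s u) = vob v s \<odot> vob v u"
  by (simp_all add: gob_def)

text \<open>\<open>cocone\<close>, \<open>act_inj\<close> and \<open>mul_inj\<close> make the
  coprojections a compatible family of lax maps; \<open>act_act\<close>, \<open>mul_act\<close> and
  \<open>mul_mul\<close> are functoriality, naturality of laxity and associativity. An arrow under
  \<open>Act\<close> must be a non-identity to be a generator. In \<open>mul_act\<close> one of the
  factors \<open>f\<close> and \<open>g\<close> may be an identity, but not both, which is why
  \<open>vact\<close> stands there.\<close>

inductive_set rels :: "('j, 's, 'f, 'o, 'a) stage \<Rightarrow> 's \<Rightarrow>
    (('j, 's, 'f) generator \<times> 'a \<times> ('j, 's, 'f) generator \<times> 'a) set"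
  for v t where
    cocone: "u \<in> JA \<Longrightarrow> (Inj (jc u), T u t, Inj (jd u), Idn M (aob (D (jd u)) t)) \<in> rels v t"
  | act_inj: "f \<in> hom S t s' \<Longrightarrow> f \<noteq> Idn S t \<Longrightarrow> j \<in> JO \<Longrightarrow>
      (Act f, vinj v j s', Inj j, aar (D j) f) \<in> rels v t"
  | mul_inj: "comp s u \<Longrightarrow> cob s u = t \<Longrightarrow> j \<in> JO \<Longrightarrow>
      (Mul s u, vinj v j s \<otimes> vinj v j u, Inj j, alax (D j) s u) \<in> rels v t"
  | act_act: "f \<in> hom S t s' \<Longrightarrow> f \<noteq> Idn S t \<Longrightarrow> g \<in> hom S s' s'' \<Longrightarrow> g \<noteq> Idn S s' \<Longrightarrow>
      (Act f, vact v g, Act (Cmp S g f), Idn M (vob v s'')) \<in> rels v t"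
  | mul_act: "comp s u \<Longrightarrow> cob s u = t \<Longrightarrow> f \<in> hom S s s' \<Longrightarrow> g \<in> hom S u u' \<Longrightarrow> car f g \<noteq> Idn S t \<Longrightarrow>
      (Mul s u, vact v f \<otimes> vact v g, Act (car f g), vmul v s' u') \<in> rels v t"
  | mul_mul: "comp s w \<Longrightarrow> comp w u \<Longrightarrow> cob (cob s w) u = t \<Longrightarrow>
      (Mul (cob s w) u, vmul v s w \<otimes> Idn M (vob v u),
       Mul s (cob w u), (Idn M (vob v s) \<otimes> vmul v w u) \<cdot> Assoc M (vob v s) (vob v w) (vob v u)) \<in> rels v t"

text \<open>Off \<open>Ob S\<close> nothing is required, so that a choice exists at every value of
  the type.\<close>

definition good :: "('j, 's, 'f, 'o, 'a) stage \<Rightarrow> 's \<Rightarrow> 'o \<times> (('j, 's, 'f) generator \<Rightarrow> 'a) \<Rightarrow> bool" where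
  "good v t r \<longleftrightarrow> (t \<in> Ob S \<longrightarrow> presented_colimit M (gens t) (gob v t) (rels v t) (fst r) (snd r))"

section \<open>Locality, typing and smallness of the stages\<close>

lemma vact_Idn: 
  assumes "s \<in> Ob S"
  shows "vact v (Idn S s) = Idn M (vob v s)"
  using S.Idn_hom[OF assms] by (simp add: vact_def in_hom_iff)

lemma vact_cong:
  assumes "f \<in> hom S s s'" "v s = v' s"
  shows "vact v f = vact v' f"
  by (simp only: vact_def vob_def homD(2)[OF assms(1)] assms(2))

text \<open>A relation at \<open>t\<close> only mentions stages of smaller degree. One inclusion is
  enough, since the hypothesis is symmetric in \<open>v\<close> and \<open>v'\<close>.\<close>

lemma rels_mono:
  assumes eq: "\<And>z. deg z < deg t \<Longrightarrow> v z = v' z"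
  shows "rels v t \<subseteq> rels v' t"
proof -
  have "(i, p, i', q) \<in> rels v' t" if "(i, p, i', q) \<in> rels v t" for i p i' q
    using that
  proof cases
    case (cocone u)
    then show ?thesis using rels.cocone[of u t v'] by simp
  next
    case (act_inj f s' j)
    have "vinj v j s' = vinj v' j s'"
      unfolding vinj_def eq[OF S.deg_less[OF act_inj(5,6)]] ..
    then show ?thesis using rels.act_inj[OF act_inj(5-7), where v = v'] act_inj(1-4) by simp
  next
    case (mul_inj s u j)
    note d = S.deg_cob_less[OF mul_inj(5), unfolded mul_inj(6)]
    have "vinj v j s = vinj v' j s" "vinj v j u = vinj v' j u"
      unfolding vinj_def d[THEN eq] by (rule refl)+
    then show ?thesis using rels.mul_inj[OF mul_inj(5-7), where v = v'] mul_inj(1-4) by simp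
  next
    case (act_act f s' g s'')
    note d = S.deg_less[OF act_act(5,6)] S.deg_less[OF act_act(7,8)]
    have "vact v g = vact v' g" by (rule vact_cong[where v = v and v' = v', OF act_act(7) eq[OF d(1)]])
    moreover have "vob v s'' = vob v' s''"
      unfolding vob_def eq[OF less_trans[OF d(2,1)]] ..
    ultimately show ?thesis using rels.act_act[OF act_act(5-8), where v = v'] act_act(1-4) by simp
  next
    case (mul_act s u f s' g u')
    note d = S.deg_cob_less[OF mul_act(5), unfolded mul_act(6)]
    \<comment> \<open>\<open>vmul v s' u'\<close> belongs to the stage of \<open>cob s' u'\<close>,
      which is smaller because \<open>car f g\<close> is not an identity.\<close>
    have d3: "deg (cob s' u') < deg t"
      using S.deg_less[OF S.car_hom[OF mul_act(5,7,8)]] mul_act(6,9) by simp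
    have "vact v f = vact v' f" by (rule vact_cong[where v = v and v' = v', OF mul_act(7) eq[OF d(1)]])
    moreover have "vact v g = vact v' g" by (rule vact_cong[where v = v and v' = v', OF mul_act(8) eq[OF d(2)]])
    moreover have "vmul v s' u' = vmul v' s' u'" unfolding vmul_def eq[OF d3] ..
    ultimately show ?thesis using rels.mul_act[OF mul_act(5-9), where v = v'] mul_act(1-4) by simp
  next
    case (mul_mul s w u)
    note d = S.deg_cob_cob_less[OF mul_mul(5,6), unfolded mul_mul(7), THEN eq]
    have "vob v s = vob v' s" "vob v w = vob v' w" "vob v u = vob v' u"
      "vmul v s w = vmul v' s w" "vmul v w u = vmul v' w u"
      unfolding vmul_def vob_def d by (rule refl)+
    then show ?thesis using rels.mul_mul[OF mul_mul(5-7), where v = v'] mul_mul(1-4) by simp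
  qed
  then show ?thesis by (auto simp: subset_iff)
qed

lemma gob_cong:
  assumes eq: "\<And>z. deg z < deg t \<Longrightarrow> v z = v' z" and i: "i \<in> gens t"
  shows "gob v t i = gob v' t i"
proof (cases i)
  case (Act f)
  then have "f \<in> hom S t (Cod S f)" "f \<noteq> Idn S t" using i by (simp_all add: gens_simps in_hom_iff)
  from eq[OF S.deg_less[OF this]] show ?thesis by (simp add: Act vob_def)
next
  case (Mul s u)
  then have "comp s u" "cob s u = t" using i by (simp_all add: gens_simps)
  with S.deg_cob_less[of s u] show ?thesis using eq[of s] eq[of u] by (simp add: Mul vob_def)
qed simp

text \<open>The locality condition under which \<open>dependent_wf_choice\<close> defines the stages
  by recursion on the degree.\<close>

lemma good_cong:
  assumes eq: "\<And>z. deg z < deg t \<Longrightarrow> v z = v' z"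
  shows "good v t r = good v' t r"
proof -
  have "rels v t = rels v' t"
    by (intro equalityI rels_mono) (simp_all add: eq)
  moreover have "presented_colimit M (gens t) (gob v t) R c k \<longleftrightarrow> presented_colimit M (gens t) (gob v' t) R c k" for R c k
    by (intro presented_colimit_cong gob_cong eq)
  ultimately show ?thesis by (simp add: good_def)
qed

lemma good_typing:
  assumes good: "good v t (v t)" and t: "t \<in> Ob S"
  shows "vob v t \<in> Ob M"
    and "j \<in> JO \<Longrightarrow> vinj v j t \<in> hom M (aob (D j) t) (vob v t)"
    and "f \<in> hom S t s' \<Longrightarrow> vact v f \<in> hom M (vob v s') (vob v t)"
    and "comp s u \<Longrightarrow> cob s u = t \<Longrightarrow> vmul v s u \<in> hom M (vob v s \<odot> vob v u) (vob v t)"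
proof -
  have *: "presented_cocone M (gens t) (gob v t) (rels v t) (vob v t) (snd (v t))"
    using good t by (auto simp: good_def presented_colimit_def vob_def)
  then show ob: "vob v t \<in> Ob M" by (simp add: presented_cocone_def)
  have k: "i \<in> gens t \<Longrightarrow> snd (v t) i \<in> hom M (gob v t i) (vob v t)" for i
    using * by (simp add: presented_cocone_def)
  show "j \<in> JO \<Longrightarrow> vinj v j t \<in> hom M (aob (D j) t) (vob v t)"
    using k[of "Inj j"] by (simp add: gens_simps vinj_def)
  show "vmul v s u \<in> hom M (vob v s \<odot> vob v u) (vob v t)" if "comp s u" "cob s u = t"
    using k[of "Mul s u"] that by (simp add: gens_simps vmul_def)
  show "vact v f \<in> hom M (vob v s') (vob v t)" if f: "f \<in> hom S t s'"
  proof (cases "f = Idn S t")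
    case True
    then have "s' = t" using f S.Idn_hom[OF t] by (simp add: in_hom_iff)
    then show ?thesis using True t vact_Idn Idn_hom ob by simp
  next
    case False
    then show ?thesis using k[of "Act f"] f by (simp add: gens_simps vact_def in_hom_iff)
  qed
qed

text \<open>The legs of the relations at \<open>t\<close> are built from the given diagram and from
  coprojections of stages below \<open>t\<close>, so goodness below \<open>t\<close> types them.
  This makes the colimit at \<open>t\<close> available.\<close>

lemma presentation_stage:
  assumes good: "\<And>z. z \<in> Ob S \<Longrightarrow> deg z < deg t \<Longrightarrow> good v z (v z)" and t: "t \<in> Ob S"
  shows "presentation M (gens t) (gob v t) (rels v t)"
proof -
  note ty = good_typing[OF good]
  have ob: "z \<in> Ob S \<Longrightarrow> deg z < deg t \<Longrightarrow> vob v z \<in> Ob M" for z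
    using ty(1) by simp
  have inj: "j \<in> JO \<Longrightarrow> z \<in> Ob S \<Longrightarrow> deg z < deg t \<Longrightarrow> vinj v j z \<in> hom M (aob (D j) z) (vob v z)" for j z
    using ty(2) by simp
  have act: "f \<in> hom S z z' \<Longrightarrow> deg z < deg t \<Longrightarrow> vact v f \<in> hom M (vob v z') (vob v z)" for f z z'
    using ty(3)[OF S.hom_Ob(1) _ S.hom_Ob(1)] by simp
  have mul: "comp s u \<Longrightarrow> deg (cob s u) < deg t \<Longrightarrow> vmul v s u \<in> hom M (vob v s \<odot> vob v u) (vob v (cob s u))" for s u
    using ty(4)[OF S.cob_Ob _ S.cob_Ob] by simp
  have gens_ob: "gob v t i \<in> Ob M" if i: "i \<in> gens t" for i
  proof (cases i)
    case (Inj j)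
    then show ?thesis using i lax_algebraD(1)[OF D t] by (simp add: gens_simps)
  next
    case (Act f)
    then have f: "f \<in> hom S t (Cod S f)" "f \<noteq> Idn S t" using i by (simp_all add: gens_simps in_hom_iff)
    show ?thesis using ob[OF S.hom_Ob(2)[OF f(1)] S.deg_less[OF f]] by (simp add: Act)
  next
    case (Mul s u)
    then have su: "comp s u" "cob s u = t" using i by (simp_all add: gens_simps)
    note d = S.deg_cob_less[OF su(1), unfolded su(2)]
    show ?thesis using ob[OF S.comp_Ob(1)[OF su(1)] d(1)] ob[OF S.comp_Ob(2)[OF su(1)] d(2)] TOb_Ob
      by (simp add: Mul)
  qed
  have "i \<in> gens t \<and> i' \<in> gens t \<and> (\<exists>x. p \<in> hom M x (gob v t i) \<and> q \<in> hom M x (gob v t i'))"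
    if "(i, p, i', q) \<in> rels v t" for i p i' q
    using that
  proof cases
    case (cocone u)
    show ?thesis unfolding cocone(1-4) gens_simps gob_simps
      using jd[OF cocone(5)] jc[OF cocone(5)] lax_mapD(1)[OF T[OF cocone(5)] t]
        Idn_hom[OF lax_algebraD(1)[OF D[OF jd[OF cocone(5)]] t]] by blast
  next
    case (act_inj f s' j)
    have "vinj v j s' \<in> hom M (aob (D j) s') (gob v t i)" "q \<in> hom M (aob (D j) s') (gob v t i')"
      using inj[OF act_inj(7) S.hom_Ob(2)[OF act_inj(5)] S.deg_less[OF act_inj(5,6)]]
        lax_algebraD(2)[OF D[OF act_inj(7)] act_inj(5)]
      unfolding act_inj(1-4) by (simp_all add: homD[OF act_inj(5)])
    moreover have "i \<in> gens t" "i' \<in> gens t"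
      using act_inj(6,7) unfolding act_inj(1,3) by (simp_all add: gens_simps homD[OF act_inj(5)])
    ultimately show ?thesis using act_inj(2) by blast
  next
    case (mul_inj s u j)
    note d = S.deg_cob_less[OF mul_inj(5), unfolded mul_inj(6)]
    note o = S.comp_Ob[OF mul_inj(5)]
    have "p \<in> hom M (aob (D j) s \<odot> aob (D j) u) (gob v t i)" "q \<in> hom M (aob (D j) s \<odot> aob (D j) u) (gob v t i')"
      using TAr_hom[OF inj[OF mul_inj(7) o(1) d(1)] inj[OF mul_inj(7) o(2) d(2)]]
        lax_algebraD(5)[OF D[OF mul_inj(7)] mul_inj(5)] mul_inj(6)
      unfolding mul_inj(1-4) by simp_all
    moreover have "i \<in> gens t" "i' \<in> gens t"
      using mul_inj(5-7) unfolding mul_inj(1,3) by (simp_all add: gens_simps)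
    ultimately show ?thesis by blast
  next
    case (act_act f s' g s'')
    note d1 = S.deg_less[OF act_act(5,6)] and d2 = S.deg_less[OF act_act(7,8)]
    note gf = S.Cmp_hom[OF act_act(5,7)]
    \<comment> \<open>The degree drops twice, so the composite cannot end where it starts.\<close>
    have "Cmp S g f \<noteq> Idn S t"
    proof
      assume "Cmp S g f = Idn S t"
      then have "s'' = t" using homD(3)[OF gf] homD(3)[OF S.Idn_hom[OF t]] by simp
      then show False using d1 d2 by simp
    qed
    then have "i \<in> gens t" "i' \<in> gens t"
      using act_act(6) unfolding act_act(1,3) by (simp_all add: gens_simps homD[OF act_act(5)] homD[OF gf])
    moreover have "p \<in> hom M (vob v s'') (gob v t i)" "q \<in> hom M (vob v s'') (gob v t i')"
      using act[OF act_act(7) d1] Idn_hom[OF ob[OF S.hom_Ob(2)[OF act_act(7)] less_trans[OF d2 d1]]]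
      unfolding act_act(1-4) by (simp_all add: homD[OF act_act(5)] homD[OF gf])
    ultimately show ?thesis by blast
  next
    case (mul_act s u f s' g u')
    note d = S.deg_cob_less[OF mul_act(5), unfolded mul_act(6)]
    note c = S.comp_hom[OF mul_act(5,7,8)]
    note fg = S.car_hom[OF mul_act(5,7,8), unfolded mul_act(6)]
    have "i \<in> gens t" "i' \<in> gens t"
      using mul_act(5,6,9) unfolding mul_act(1,3) by (simp_all add: gens_simps homD[OF fg])
    moreover have "p \<in> hom M (vob v s' \<odot> vob v u') (gob v t i)" "q \<in> hom M (vob v s' \<odot> vob v u') (gob v t i')"
      using TAr_hom[OF act[OF mul_act(7) d(1)] act[OF mul_act(8) d(2)]] mul[OF c S.deg_less[OF fg mul_act(9)]]
      unfolding mul_act(1-4) by (simp_all add: homD[OF fg])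
    ultimately show ?thesis by blast
  next
    case (mul_mul s w u)
    note d = S.deg_cob_cob_less[OF mul_mul(5,6), unfolded mul_mul(7)]
    have vo: "vob v s \<in> Ob M" "vob v w \<in> Ob M" "vob v u \<in> Ob M"
      using ob d S.comp_Ob[OF mul_mul(5)] S.comp_Ob[OF mul_mul(6)] by auto
    have "i \<in> gens t" "i' \<in> gens t"
      using mul_mul(7) S.comp_cob[OF mul_mul(5,6)] S.cob_assoc[OF mul_mul(5,6)]
      unfolding mul_mul(1,3) by (simp_all add: gens_simps)
    moreover have "p \<in> hom M (vob v s \<odot> vob v w \<odot> vob v u) (gob v t i)"
      using TAr_hom[OF mul[OF mul_mul(5) d(4)] Idn_hom[OF vo(3)]] unfolding mul_mul(1-4) by simp
    moreover have "q \<in> hom M (vob v s \<odot> vob v w \<odot> vob v u) (gob v t i')"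
      using Cmp_hom[OF Assoc_hom[OF vo] TAr_hom[OF Idn_hom[OF vo(1)] mul[OF mul_mul(6) d(5)]]]
      unfolding mul_mul(1-4) by simp
    ultimately show ?thesis by blast
  qed
  with gens_ob show ?thesis unfolding presentation_def by blast
qed

text \<open>Relations that mention the given diagram are indexed by \<open>JA\<close>, or by a
  finite set times \<open>JO\<close>; the remaining ones come from finitely many arrows and
  splittings.\<close>

lemma small_stage:
  fixes \<kappa> :: "'u rel"
  assumes \<kappa>: "Card_order \<kappa>" "infinite (Field \<kappa>)" and small: "|JO| <o \<kappa>" "|JA| <o \<kappa>" and t: "t \<in> Ob S"
  shows "|gens t| <o \<kappa>" "|rels v t| <o \<kappa>"
proof -
  note fin = finite_card_of_less[OF \<kappa>]
  note im = ordLeq_ordLess_trans[OF card_of_image]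
  note un = card_of_Un_ordLess_infinite_Field[OF \<kappa>(2,1)]
  have f1: "finite {f \<in> Ar S. Dom S f = t \<and> f \<noteq> Idn S t}"
    using S.finite_out[OF t] by (rule finite_subset[rotated]) auto
  show "|gens t| <o \<kappa>"
    unfolding gens_def
    by (rule un[OF un[OF im[OF small(1)] fin[OF finite_imageI[OF f1]]] fin[OF finite_imageI[OF S.finite_splittings]]])
  let ?O = "\<lambda>t. {f \<in> Ar S. Dom S f = t}" and ?P = "\<lambda>t. {(s, u). comp s u \<and> cob s u = t}"
  \<comment> \<open>\<open>?R1\<close> to \<open>?R6\<close> parametrise the six rules with some
    side conditions dropped, such as that an arrow be a non-identity. Only the inclusion of
    \<open>rels v t\<close> in their union is used.\<close>
  let ?R1 = "(\<lambda>u. (Inj (jc u), T u t, Inj (jd u), Idn M (aob (D (jd u)) t))) ` JA"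
  let ?R2 = "(\<lambda>(f, j). (Act f, vinj v j (Cod S f), Inj j, aar (D j) f)) ` (?O t \<times> JO)"
  let ?R3 = "(\<lambda>((s, u), j). (Mul s u, vinj v j s \<otimes> vinj v j u, Inj j, alax (D j) s u)) ` (?P t \<times> JO)"
  let ?R4 = "(\<lambda>(f, g). (Act f, vact v g, Act (Cmp S g f), Idn M (vob v (Cod S g)))) ` (SIGMA f : ?O t. ?O (Cod S f))"
  let ?R5 = "(\<lambda>((s, u), f, g). (Mul s u, vact v f \<otimes> vact v g, Act (car f g), vmul v (Cod S f) (Cod S g))) ` (SIGMA (s, u) : ?P t. ?O s \<times> ?O u)"
  \<comment> \<open>A triple concatenation is recorded as a splitting \<open>(x, u)\<close> of
    \<open>t\<close> together with a splitting \<open>(s, w)\<close> of \<open>x\<close>.\<close>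
  let ?R6 = "(\<lambda>((x, u), s, w). (Mul x u, vmul v s w \<otimes> Idn M (vob v u),
       Mul s (cob w u), (Idn M (vob v s) \<otimes> vmul v w u) \<cdot> Assoc M (vob v s) (vob v w) (vob v u))) ` (SIGMA (x, u) : ?P t. ?P x)"
  have "|?R1 \<union> (?R2 \<union> (?R3 \<union> (?R4 \<union> (?R5 \<union> ?R6))))| <o \<kappa>"
  proof (intro un)
    show "|?R1| <o \<kappa>" by (rule im[OF small(2)])
    show "|?R2| <o \<kappa>"
      by (rule im[OF card_of_finite_Times_less[OF \<kappa> S.finite_out[OF t] small(1)]])
    show "|?R3| <o \<kappa>"
      by (rule im[OF card_of_finite_Times_less[OF \<kappa> S.finite_splittings small(1)]])
    show "|?R4| <o \<kappa>"
      by (rule fin, intro finite_imageI finite_SigmaI S.finite_out t S.Cod_Ob) simp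
    show "|?R5| <o \<kappa>"
      by (rule fin, intro finite_imageI finite_SigmaI S.finite_splittings)
        (auto intro!: finite_cartesian_product S.finite_out intro: S.comp_Ob)
    show "|?R6| <o \<kappa>"
      by (rule fin, intro finite_imageI finite_SigmaI S.finite_splittings) (simp add: case_prod_beta S.finite_splittings)
  qed
  moreover have "(i, p, i', q) \<in> ?R1 \<union> (?R2 \<union> (?R3 \<union> (?R4 \<union> (?R5 \<union> ?R6))))"
    if "(i, p, i', q) \<in> rels v t" for i p i' q
    using that
  proof cases
      case (cocone u)
      then have "(i, p, i', q) \<in> ?R1" by blast
      then show ?thesis by blast
    next
      case (act_inj f s' j)
      then have "(i, p, i', q) \<in> ?R2" by (auto intro!: image_eqI[of _ _ "(f, j)"] simp: in_hom_iff)
      then show ?thesis by blast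
    next
      case (mul_inj s u j)
      then have "(i, p, i', q) \<in> ?R3" by (auto intro!: image_eqI[of _ _ "((s, u), j)"])
      then show ?thesis by blast
    next
      case (act_act f s' g s'')
      then have "(i, p, i', q) \<in> ?R4" by (auto intro!: image_eqI[of _ _ "(f, g)"] simp: in_hom_iff)
      then show ?thesis by blast
    next
      case (mul_act s u f s' g u')
      then have "(i, p, i', q) \<in> ?R5" by (auto intro!: image_eqI[of _ _ "((s, u), f, g)"] simp: in_hom_iff)
      then show ?thesis by blast
    next
      case (mul_mul s w u)
      then have "(i, p, i', q) \<in> ?R6" using S.comp_cob by (auto intro!: image_eqI[of _ _ "((cob s w, u), s, w)"])
      then show ?thesis by blast
  qed
  then have "rels v t \<subseteq> ?R1 \<union> (?R2 \<union> (?R3 \<union> (?R4 \<union> (?R5 \<union> ?R6))))"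
    by (simp only: subset_iff split_paired_All) blast
  ultimately show "|rels v t| <o \<kappa>" by (rule ordLeq_ordLess_trans[OF card_of_mono1, rotated])
qed

text \<open>Colimits are unique only up to isomorphism, so the stages are picked by dependent choice
  along the degree, each relative to the stages already picked.\<close>

lemma good_stage_exists:
  fixes \<kappa> :: "'u rel"
  assumes "Card_order \<kappa>" "infinite (Field \<kappa>)" "cocomplete \<kappa> M" "|JO| <o \<kappa>" "|JA| <o \<kappa>"
  obtains v where "\<And>t. good v t (v t)"
proof -
  have "\<exists>v. \<forall>t. good v t (v t)"
  proof (rule dependent_wf_choice[of "measure deg"])
    fix t and v :: "('j, 's, 'f, 'o, 'a) stage"
    assume *: "\<And>y. (y, t) \<in> measure deg \<Longrightarrow> good v y (v y)"
    show "\<exists>r. good v t r"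
    proof (cases "t \<in> Ob S")
      case True
      then have "presentation M (gens t) (gob v t) (rels v t)" using presentation_stage * by simp
      then obtain c k where "presented_colimit M (gens t) (gob v t) (rels v t) c k"
        using presented_colimit_exists[OF assms(1-3) _ small_stage[OF assms(1,2,4,5) True]] by blast
      then show ?thesis by (auto simp: good_def)
    qed (simp add: good_def)
  qed (auto intro!: good_cong)
  then show ?thesis using that by blast
qed

section \<open>The chosen colimits form a lax algebra under the diagram\<close>

definition colim_alg :: "('j, 's, 'f, 'o, 'a) stage \<Rightarrow> ('s, 'f, 'o, 'a) lax_alg" where
  "colim_alg v = \<lparr>aob = vob v, aar = vact v, alax = vmul v\<rparr>"

lemma colim_alg_simps [simp]:
  "aob (colim_alg v) = vob v" "aar (colim_alg v) = vact v" "alax (colim_alg v) = vmul v"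
  by (simp_all add: colim_alg_def)

context
  fixes v :: "('j, 's, 'f, 'o, 'a) stage"
  assumes good: "\<And>t. good v t (v t)"
begin

lemmas stage_typing = good_typing[OF good]

lemma stage_rel:
  assumes "t \<in> Ob S" "(i, p, i', q) \<in> rels v t"
  shows "snd (v t) i \<cdot> p = snd (v t) i' \<cdot> q"
  using good[of t] assms by (auto simp: good_def presented_colimit_def presented_cocone_def)

lemma vact_proper:
  assumes "f \<in> hom S s s'" "f \<noteq> Idn S s"
  shows "vact v f = snd (v s) (Act f)"
  using assms(2) by (simp add: vact_def homD(2)[OF assms(1)])

lemma Idn_cod:
  assumes "Idn S s \<in> hom S s s'"
  shows "s' = s"
  using homD(3)[OF assms] homD(3)[OF S.Idn_hom[OF S.hom_Ob(1)[OF assms]]] by simp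

lemma vact_Cmp:
  assumes f: "f \<in> hom S s s'" and g: "g \<in> hom S s' s''"
  shows "vact v (Cmp S g f) = vact v f \<cdot> vact v g"
proof -
  note o = S.hom_Ob[OF f] S.hom_Ob(2)[OF g]
  note gf = S.Cmp_hom[OF f g]
  \<comment> \<open>\<open>act_act\<close> covers only non-identities. For identities the equation
    is a unit law, since \<open>vact\<close> sends them to identities by definition.\<close>
  consider "f = Idn S s" | "g = Idn S s'" | "f \<noteq> Idn S s" "g \<noteq> Idn S s'" by blast
  then show ?thesis
  proof cases
    case 1
    then have "s' = s" using f Idn_cod by simp
    then show ?thesis
      using S.Cmp_Idn_right[of g s s''] g Cmp_Idn_left[OF stage_typing(3)[OF o(1), of g s'']] 1 vact_Idn[OF o(1)] by simp
  next
    case 2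
    then have "s'' = s'" using g Idn_cod by simp
    then show ?thesis
      using S.Cmp_Idn_left[OF f] Cmp_Idn_right[OF stage_typing(3)[OF o(1) f]] 2 vact_Idn[OF o(2)] by simp
  next
    case 3
    have "Cmp S g f \<noteq> Idn S s"
      using gf Idn_cod[of s s''] S.deg_less[OF f 3(1)] S.deg_less[OF g 3(2)] by auto
    note eq = vact_proper[OF gf this]
    show ?thesis
      using stage_rel[OF o(1) rels.act_act[OF f 3(1) g 3(2)]] Cmp_Idn_right[OF stage_typing(3)[OF o(1) gf]]
      unfolding vact_proper[OF f 3(1)] eq by simp
  qed
qed

lemma vmul_natural:
  assumes su: "comp s u" and f: "f \<in> hom S s s'" and g: "g \<in> hom S u u'"
  shows "vmul v s u \<cdot> (vact v f \<otimes> vact v g) = vact v (car f g) \<cdot> vmul v s' u'"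
proof -
  note o = S.comp_Ob[OF su] S.cob_Ob[OF su]
  note fg = S.car_hom[OF su f g]
  note mul = stage_typing(4)[OF o(3) su refl]
  show ?thesis
  proof (cases "car f g = Idn S (cob s u)")
    case True
    \<comment> \<open>If \<open>car f g\<close> is an identity, the total degree is kept. As neither
      \<open>f\<close> nor \<open>g\<close> can raise its degree, both keep it and are identities,
      and the equation reduces to unit laws.\<close>
    then have "cob s' u' = cob s u" using fg Idn_cod by simp
    then have "deg s' + deg u' = deg s + deg u" using S.deg_cob[OF su] S.deg_cob[OF S.comp_hom[OF su f g]] by simp
    then have "deg s' = deg s" "deg u' = deg u" using S.deg_hom[OF f] S.deg_hom[OF g] by simp_all
    then have id: "f = Idn S s" "g = Idn S u" using S.deg_eq_Idn[OF f] S.deg_eq_Idn[OF g] by simp_all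
    then have "s' = s" "u' = u" using f g Idn_cod by simp_all
    then show ?thesis
      using id True Cmp_Idn_left[OF mul] Cmp_Idn_right[OF mul] TAr_Idn[OF stage_typing(1)[OF o(1)] stage_typing(1)[OF o(2)]]
      by (simp add: vact_Idn o)
  next
    case False
    show ?thesis
      using stage_rel[OF o(3) rels.mul_act[OF su refl f g False]]
      unfolding vact_proper[OF fg False] vmul_def[of v s u] .
  qed
qed

lemma vmul_assoc:
  assumes sw: "comp s w" and wu: "comp w u"
  shows "vmul v (cob s w) u \<cdot> (vmul v s w \<otimes> Idn M (vob v u)) =
    vmul v s (cob w u) \<cdot> (Idn M (vob v s) \<otimes> vmul v w u) \<cdot> Assoc M (vob v s) (vob v w) (vob v u)"
proof -
  note o = S.comp_Ob(1)[OF sw] S.comp_Ob[OF wu]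
  note c = S.comp_cob[OF sw wu]
  note vo = stage_typing(1)[OF o(1)] stage_typing(1)[OF o(2)] stage_typing(1)[OF o(3)]
  have "vmul v (cob s w) u \<cdot> (vmul v s w \<otimes> Idn M (vob v u)) =
    vmul v s (cob w u) \<cdot> ((Idn M (vob v s) \<otimes> vmul v w u) \<cdot> Assoc M (vob v s) (vob v w) (vob v u))"
    using stage_rel[OF S.cob_Ob[OF c(1)] rels.mul_mul[OF sw wu refl]]
    unfolding vmul_def[of v "cob s w" u] vmul_def[of v s "cob w u"] S.cob_assoc[OF sw wu] .
  also have "\<dots> = vmul v s (cob w u) \<cdot> (Idn M (vob v s) \<otimes> vmul v w u) \<cdot> Assoc M (vob v s) (vob v w) (vob v u)"
    by (rule Cmp_assoc[OF Assoc_hom[OF vo] TAr_hom[OF Idn_hom[OF vo(1)] stage_typing(4)[OF S.cob_Ob[OF wu] wu refl]]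
          stage_typing(4)[OF S.cob_Ob[OF c(2)] c(2) refl], symmetric])
  finally show ?thesis .
qed

lemma lax_algebra_colim: "lax_algebra (colim_alg v)"
  unfolding lax_algebra_def colim_alg_simps
proof (intro conjI ballI allI impI)
  show "vob v s \<in> Ob M" if "s \<in> Ob S" for s by (rule stage_typing(1)[OF that])
  show "vact v f \<in> hom M (vob v s') (vob v s)" if "f \<in> hom S s s'" for s s' f 
    by (rule stage_typing(3)[OF S.hom_Ob(1)[OF that] that])
  show "vact v (Idn S s) = Idn M (vob v s)" if "s \<in> Ob S" for s by (rule vact_Idn[OF that])
  show "vmul v s u \<in> hom M (vob v s \<odot> vob v u) (vob v (cob s u))" if "comp s u" for s u
    by (rule stage_typing(4)[OF S.cob_Ob[OF that] that refl])
qed (rule vact_Cmp vmul_natural vmul_assoc; assumption)+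

lemma lax_map_vinj:
  assumes j: "j \<in> JO"
  shows "lax_map (D j) (colim_alg v) (vinj v j)"
  unfolding lax_map_def colim_alg_simps
proof (intro conjI ballI allI impI)
  fix s assume s: "s \<in> Ob S"
  show "vinj v j s \<in> hom M (aob (D j) s) (vob v s)" by (rule stage_typing(2)[OF s j])
next
  fix s s' f assume f: "f \<in> hom S s s'"
  note o = S.hom_Ob[OF f]
  show "vinj v j s \<cdot> aar (D j) f = vact v f \<cdot> vinj v j s'"
  proof (cases "f = Idn S s")
    case True
    then have "s' = s" using f Idn_cod by simp
    then show ?thesis
      using True Cmp_Idn_left[OF stage_typing(2)[OF o(1) j]] Cmp_Idn_right[OF stage_typing(2)[OF o(1) j]]
      by (simp add: vact_Idn[OF o(1)] lax_algebraD(3)[OF D[OF j] o(1)])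
  next
    case False
    show ?thesis
      using stage_rel[OF o(1) rels.act_inj[OF f False j]]
      unfolding vact_proper[OF f False] vinj_def[of v j s] by simp
  qed
next
  fix s u assume su: "comp s u"
  show "vinj v j (cob s u) \<cdot> alax (D j) s u = vmul v s u \<cdot> (vinj v j s \<otimes> vinj v j u)"
    using stage_rel[OF S.cob_Ob[OF su] rels.mul_inj[OF su refl j]]
    unfolding vmul_def[of v s u] vinj_def[of v j "cob s u"] by simp
qed

lemma vinj_compatible:
  assumes u: "u \<in> JA" and t: "t \<in> Ob S"
  shows "vinj v (jc u) t \<cdot> T u t = vinj v (jd u) t"
  using stage_rel[OF t rels.cocone[OF u]] Cmp_Idn_right[OF stage_typing(2)[OF t jd[OF u]]]
  by (simp add: vinj_def)

section \<open>The universal property\<close>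

context
  fixes H :: "('s, 'f, 'o, 'a) lax_alg" and \<tau> :: "'j \<Rightarrow> 's \<Rightarrow> 'a"
  assumes H: "lax_algebra H"
    and \<tau>: "j \<in> JO \<Longrightarrow> lax_map (D j) H (\<tau> j)"
    and \<tau>_compatible: "u \<in> JA \<Longrightarrow> t \<in> Ob S \<Longrightarrow> \<tau> (jc u) t \<cdot> T u t = \<tau> (jd u) t"
begin

text \<open>\<open>kmap \<sigma> t i\<close> is the value that a lax map to \<open>H\<close>
  extending \<open>\<tau>\<close> is forced to take on the generator \<open>i\<close>. For
  generators at \<open>t\<close> it reads \<open>\<sigma>\<close> only below \<open>t\<close>, which
  turns the lax map equations into a recursion.\<close>

definition kmap :: "('s \<Rightarrow> 'a) \<Rightarrow> 's \<Rightarrow> ('j, 's, 'f) generator \<Rightarrow> 'a" where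
  "kmap \<sigma> t i = (case i of Inj j \<Rightarrow> \<tau> j t | Act f \<Rightarrow> aar H f \<cdot> \<sigma> (Cod S f) | Mul s u \<Rightarrow> alax H s u \<cdot> (\<sigma> s \<otimes> \<sigma> u))"

lemma kmap_simps [simp]:
  "kmap \<sigma> t (Inj j) = \<tau> j t" "kmap \<sigma> t (Act f) = aar H f \<cdot> \<sigma> (Cod S f)"
  "kmap \<sigma> t (Mul s u) = alax H s u \<cdot> (\<sigma> s \<otimes> \<sigma> u)"
  by (simp_all add: kmap_def)

text \<open>The candidate \<open>r\<close> for the value at \<open>t\<close> is kept apart from
  \<open>\<sigma>\<close>, so that this is a relation between the lower values and the next one, as
  well-founded choice requires.\<close>

definition mediates :: "('s \<Rightarrow> 'a) \<Rightarrow> 's \<Rightarrow> 'a \<Rightarrow> bool" where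
  "mediates \<sigma> t r \<longleftrightarrow> (t \<in> Ob S \<longrightarrow>
     r \<in> hom M (vob v t) (aob H t) \<and> (\<forall>i \<in> gens t. r \<cdot> snd (v t) i = kmap \<sigma> t i))"

lemma mediatesD:
  assumes m: "mediates \<sigma> t (\<sigma> t)" and t: "t \<in> Ob S"
  shows "\<sigma> t \<in> hom M (vob v t) (aob H t)"
    and "j \<in> JO \<Longrightarrow> \<sigma> t \<cdot> vinj v j t = \<tau> j t"
    and "f \<in> hom S t s' \<Longrightarrow> \<sigma> t \<cdot> vact v f = aar H f \<cdot> \<sigma> s'"
    and "comp s u \<Longrightarrow> cob s u = t \<Longrightarrow> \<sigma> t \<cdot> vmul v s u = alax H s u \<cdot> (\<sigma> s \<otimes> \<sigma> u)"
proof -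
  show h: "\<sigma> t \<in> hom M (vob v t) (aob H t)" using m t by (simp add: mediates_def)
  have k: "\<sigma> t \<cdot> snd (v t) i = kmap \<sigma> t i" if "i \<in> gens t" for i
    using m t that by (simp add: mediates_def)
  show "j \<in> JO \<Longrightarrow> \<sigma> t \<cdot> vinj v j t = \<tau> j t"
    using k[of "Inj j"] by (simp add: gens_simps vinj_def)
  show "comp s u \<Longrightarrow> cob s u = t \<Longrightarrow> \<sigma> t \<cdot> vmul v s u = alax H s u \<cdot> (\<sigma> s \<otimes> \<sigma> u)"
    using k[of "Mul s u"] by (simp add: gens_simps vmul_def)
  show "\<sigma> t \<cdot> vact v f = aar H f \<cdot> \<sigma> s'" if f: "f \<in> hom S t s'"
  proof (cases "f = Idn S t")
    case True
    then have "s' = t" using f Idn_cod by simp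
    then show ?thesis using True Cmp_Idn_left[OF h] Cmp_Idn_right[OF h]
      by (simp add: vact_Idn[OF t] lax_algebraD(3)[OF H t])
  next
    case False
    then show ?thesis using k[of "Act f"] by (simp add: gens_simps vact_proper[OF f] homD[OF f])
  qed
qed

text \<open>The equations for \<open>\<sigma>\<close> below \<open>t\<close> move
  \<open>\<sigma>\<close> across the structure maps of the stages. Each relation at \<open>t\<close>
  then becomes a known law: compatibility of \<open>\<tau>\<close>, a lax map law of
  \<open>\<tau> j\<close>, or functoriality, naturality or associativity of
  \<open>H\<close>.\<close>

lemma kmap_presented_cocone:
  assumes m: "\<And>z. z \<in> Ob S \<Longrightarrow> deg z < deg t \<Longrightarrow> mediates \<sigma> z (\<sigma> z)" and t: "t \<in> Ob S"
  shows "presented_cocone M (gens t) (gob v t) (rels v t) (aob H t) (kmap \<sigma> t)"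
proof -
  note \<sigma> = mediatesD[OF m]
  have hom: "\<sigma> z \<in> hom M (vob v z) (aob H z)" if "z \<in> Ob S" "deg z < deg t" for z
    using \<sigma>(1) that by simp
  have inj: "\<sigma> z \<cdot> vinj v j z = \<tau> j z" if "j \<in> JO" "z \<in> Ob S" "deg z < deg t" for j z
    using \<sigma>(2) that by simp
  have act: "\<sigma> z \<cdot> vact v f = aar H f \<cdot> \<sigma> z'" if "f \<in> hom S z z'" "deg z < deg t" for f z z'
    using \<sigma>(3)[OF S.hom_Ob(1)[OF that(1)] that(2) S.hom_Ob(1)[OF that(1)] that(1)] .
  have mul: "\<sigma> (cob s u) \<cdot> vmul v s u = alax H s u \<cdot> (\<sigma> s \<otimes> \<sigma> u)" if "comp s u" "deg (cob s u) < deg t" for s u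
    using \<sigma>(4)[OF S.cob_Ob[OF that(1)] that(2) S.cob_Ob[OF that(1)] that(1) refl] .
  have kmap_hom: "kmap \<sigma> t i \<in> hom M (gob v t i) (aob H t)" if i: "i \<in> gens t" for i
  proof (cases i)
    case (Inj j)
    then show ?thesis using i lax_mapD(1)[OF \<tau> t] by (simp add: gens_simps)
  next
    case (Act f)
    then have f: "f \<in> hom S t (Cod S f)" "f \<noteq> Idn S t" using i by (simp_all add: gens_simps in_hom_iff)
    show ?thesis
      using Cmp_hom[OF hom[OF S.hom_Ob(2)[OF f(1)] S.deg_less[OF f]] lax_algebraD(2)[OF H f(1)]] by (simp add: Act)
  next
    case (Mul s u)
    then have su: "comp s u" "cob s u = t" using i by (simp_all add: gens_simps)
    note d = S.deg_cob_less[OF su(1), unfolded su(2)]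
    show ?thesis
      using Cmp_hom[OF TAr_hom[OF hom[OF S.comp_Ob(1)[OF su(1)] d(1)] hom[OF S.comp_Ob(2)[OF su(1)] d(2)]]
          lax_algebraD(5)[OF H su(1)]] su(2)
      by (simp add: Mul)
  qed
  have "kmap \<sigma> t i \<cdot> p = kmap \<sigma> t i' \<cdot> q" if "(i, p, i', q) \<in> rels v t" for i p i' q
    using that
  proof cases
    case (cocone u)
    show ?thesis unfolding cocone(1-4) kmap_simps
      using \<tau>_compatible[OF cocone(5) t] Cmp_Idn_right[OF lax_mapD(1)[OF \<tau>[OF jd[OF cocone(5)]] t]] by simp
  next
    case (act_inj f s' j)
    note o = S.hom_Ob(2)[OF act_inj(5)] and d = S.deg_less[OF act_inj(5,6)]
    have "aar H f \<cdot> \<sigma> s' \<cdot> vinj v j s' = aar H f \<cdot> (\<sigma> s' \<cdot> vinj v j s')"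
      by (rule Cmp_assoc[OF stage_typing(2)[OF o act_inj(7)] hom[OF o d] lax_algebraD(2)[OF H act_inj(5)]])
    also have "\<dots> = \<tau> j t \<cdot> aar (D j) f"
      using inj[OF act_inj(7) o d] lax_mapD(2)[OF \<tau>[OF act_inj(7)] act_inj(5)] by simp
    finally show ?thesis unfolding act_inj(1-4) kmap_simps homD[OF act_inj(5)] .
  next
    case (mul_inj s u j)
    note d = S.deg_cob_less[OF mul_inj(5), unfolded mul_inj(6)]
    note o = S.comp_Ob[OF mul_inj(5)]
    note i = stage_typing(2)[OF o(1) mul_inj(7)] stage_typing(2)[OF o(2) mul_inj(7)]
    note h = hom[OF o(1) d(1)] hom[OF o(2) d(2)]
    have "alax H s u \<cdot> (\<sigma> s \<otimes> \<sigma> u) \<cdot> (vinj v j s \<otimes> vinj v j u) =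
        alax H s u \<cdot> ((\<sigma> s \<otimes> \<sigma> u) \<cdot> (vinj v j s \<otimes> vinj v j u))"
      by (rule Cmp_assoc[OF TAr_hom[OF i] TAr_hom[OF h] lax_algebraD(5)[OF H mul_inj(5)]])
    also have "(\<sigma> s \<otimes> \<sigma> u) \<cdot> (vinj v j s \<otimes> vinj v j u) = \<tau> j s \<otimes> \<tau> j u"
      unfolding TAr_Cmp[OF i(1) h(1) i(2) h(2), symmetric]
        inj[OF mul_inj(7) o(1) d(1)] inj[OF mul_inj(7) o(2) d(2)] ..
    also have "alax H s u \<cdot> (\<tau> j s \<otimes> \<tau> j u) = \<tau> j t \<cdot> alax (D j) s u"
      using lax_mapD(3)[OF \<tau>[OF mul_inj(7)] mul_inj(5)] mul_inj(6) by simp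
    finally show ?thesis unfolding mul_inj(1-4) kmap_simps .
  next
    case (act_act f s' g s'')
    note o = S.hom_Ob[OF act_act(7)]
    note d1 = S.deg_less[OF act_act(5,6)]
    note d2 = less_trans[OF S.deg_less[OF act_act(7,8)] d1]
    note gf = S.Cmp_hom[OF act_act(5,7)]
    note Hf = lax_algebraD(2)[OF H act_act(5)] and Hg = lax_algebraD(2)[OF H act_act(7)]
    have "aar H f \<cdot> \<sigma> s' \<cdot> vact v g = aar H f \<cdot> (\<sigma> s' \<cdot> vact v g)"
      by (rule Cmp_assoc[OF stage_typing(3)[OF o(1) act_act(7)] hom[OF o(1) d1] Hf])
    also have "\<dots> = aar H f \<cdot> (aar H g \<cdot> \<sigma> s'')" unfolding act[OF act_act(7) d1] ..
    also have "\<dots> = (aar H f \<cdot> aar H g) \<cdot> \<sigma> s''"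
      by (rule Cmp_assoc[OF hom[OF o(2) d2] Hg Hf, symmetric])
    also have "\<dots> = aar H (Cmp S g f) \<cdot> \<sigma> s''" unfolding lax_algebraD(4)[OF H act_act(5,7)] ..
    also have "\<dots> = aar H (Cmp S g f) \<cdot> \<sigma> s'' \<cdot> Idn M (vob v s'')"
      by (rule Cmp_Idn_right[OF Cmp_hom[OF hom[OF o(2) d2] lax_algebraD(2)[OF H gf]], symmetric])
    finally show ?thesis unfolding act_act(1-4) kmap_simps homD[OF act_act(5)] homD[OF gf] .
  next
    case (mul_act s u f s' g u')
    note d = S.deg_cob_less[OF mul_act(5), unfolded mul_act(6)]
    note o = S.comp_Ob[OF mul_act(5)]
    note o' = S.hom_Ob(2)[OF mul_act(7)] S.hom_Ob(2)[OF mul_act(8)]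
    \<comment> \<open>One of the arrows may be an identity here, so the degrees of \<open>s'\<close>
      and \<open>u'\<close> are bounded through \<open>s\<close> and \<open>u\<close>, which are
      proper factors of \<open>t\<close>.\<close>
    have d': "deg s' < deg t" "deg u' < deg t"
      using d S.deg_hom[OF mul_act(7)] S.deg_hom[OF mul_act(8)] by simp_all
    note c = S.comp_hom[OF mul_act(5,7,8)]
    note fg = S.car_hom[OF mul_act(5,7,8), unfolded mul_act(6)]
    note h = hom[OF o(1) d(1)] hom[OF o(2) d(2)] and h' = hom[OF o'(1) d'(1)] hom[OF o'(2) d'(2)]
    note vf = stage_typing(3)[OF o(1) mul_act(7)] and vg = stage_typing(3)[OF o(2) mul_act(8)]
    note Hf = lax_algebraD(2)[OF H mul_act(7)] and Hg = lax_algebraD(2)[OF H mul_act(8)]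
    note L = lax_algebraD(5)[OF H mul_act(5)] and L' = lax_algebraD(5)[OF H c]
    \<comment> \<open>As \<open>car f g\<close> is not an identity, \<open>cob s' u'\<close> lies
      below \<open>t\<close>, where the laxity equation for \<open>\<sigma>\<close> is
      available.\<close>
    note d3 = S.deg_less[OF fg mul_act(9)]
    have "alax H s u \<cdot> (\<sigma> s \<otimes> \<sigma> u) \<cdot> (vact v f \<otimes> vact v g) = alax H s u \<cdot> ((\<sigma> s \<otimes> \<sigma> u) \<cdot> (vact v f \<otimes> vact v g))"
      by (rule Cmp_assoc[OF TAr_hom[OF vf vg] TAr_hom[OF h] L])
    also have "(\<sigma> s \<otimes> \<sigma> u) \<cdot> (vact v f \<otimes> vact v g) = (aar H f \<otimes> aar H g) \<cdot> (\<sigma> s' \<otimes> \<sigma> u')"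
      unfolding TAr_Cmp[OF vf h(1) vg h(2), symmetric] act[OF mul_act(7) d(1)] act[OF mul_act(8) d(2)]
      by (rule TAr_Cmp[OF h'(1) Hf h'(2) Hg])
    also have "alax H s u \<cdot> \<dots> = alax H s u \<cdot> (aar H f \<otimes> aar H g) \<cdot> (\<sigma> s' \<otimes> \<sigma> u')"
      by (rule Cmp_assoc[OF TAr_hom[OF h'] TAr_hom[OF Hf Hg] L, symmetric])
    also have "\<dots> = aar H (car f g) \<cdot> alax H s' u' \<cdot> (\<sigma> s' \<otimes> \<sigma> u')"
      unfolding lax_algebraD(6)[OF H mul_act(5,7,8)] ..
    also have "\<dots> = aar H (car f g) \<cdot> (alax H s' u' \<cdot> (\<sigma> s' \<otimes> \<sigma> u'))"
      by (rule Cmp_assoc[OF TAr_hom[OF h'] L' lax_algebraD(2)[OF H fg]])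
    also have "\<dots> = aar H (car f g) \<cdot> (\<sigma> (cob s' u') \<cdot> vmul v s' u')" unfolding mul[OF c d3] ..
    also have "\<dots> = aar H (car f g) \<cdot> \<sigma> (cob s' u') \<cdot> vmul v s' u'"
      by (rule Cmp_assoc[OF stage_typing(4)[OF S.cob_Ob[OF c] c refl] hom[OF S.cob_Ob[OF c] d3] lax_algebraD(2)[OF H fg], symmetric])
    finally show ?thesis unfolding mul_act(1-4) kmap_simps homD[OF fg] .
  next
    case (mul_mul s w u)
    note sw = mul_mul(5) and wu = mul_mul(6)
    note d = S.deg_cob_cob_less[OF sw wu, unfolded mul_mul(7)]
    note o = S.comp_Ob(1)[OF sw] S.comp_Ob[OF wu]
    note c = S.comp_cob[OF sw wu]
    note vo = stage_typing(1)[OF o(1)] stage_typing(1)[OF o(2)] stage_typing(1)[OF o(3)]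
    note Ho = lax_algebraD(1)[OF H o(1)] lax_algebraD(1)[OF H o(2)] lax_algebraD(1)[OF H o(3)]
    note h = hom[OF o(1) d(1)] hom[OF o(2) d(2)] hom[OF o(3) d(3)]
    note hsw = hom[OF S.cob_Ob[OF sw] d(4)] and hwu = hom[OF S.cob_Ob[OF wu] d(5)]
    note vsw = stage_typing(4)[OF S.cob_Ob[OF sw] sw refl] and vwu = stage_typing(4)[OF S.cob_Ob[OF wu] wu refl]
    note Lsw = lax_algebraD(5)[OF H sw] and Lwu = lax_algebraD(5)[OF H wu]
    note L1 = lax_algebraD(5)[OF H c(1)] and L2 = lax_algebraD(5)[OF H c(2)]
    note iu = Idn_hom[OF vo(3)] and js = Idn_hom[OF vo(1)]
    note Hiu = Idn_hom[OF Ho(3)] and His = Idn_hom[OF Ho(1)]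
    let ?vA = "Assoc M (vob v s) (vob v w) (vob v u)" and ?HA = "Assoc M (aob H s) (aob H w) (aob H u)"
    let ?\<sigma>3 = "\<sigma> s \<otimes> \<sigma> w \<otimes> \<sigma> u" and ?\<sigma>3' = "\<sigma> s \<otimes> (\<sigma> w \<otimes> \<sigma> u)"
    have "alax H (cob s w) u \<cdot> (\<sigma> (cob s w) \<otimes> \<sigma> u) \<cdot> (vmul v s w \<otimes> Idn M (vob v u))
        = alax H (cob s w) u \<cdot> ((\<sigma> (cob s w) \<otimes> \<sigma> u) \<cdot> (vmul v s w \<otimes> Idn M (vob v u)))"
      by (rule Cmp_assoc[OF TAr_hom[OF vsw iu] TAr_hom[OF hsw h(3)] L1])
    \<comment> \<open>\<open>\<sigma> u\<close> absorbs the identity on \<open>vob v u\<close> and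
      is then composed with the one on \<open>aob H u\<close>, so that the laxity map of
      \<open>H\<close> can be split off the tensor product.\<close>
    also have "(\<sigma> (cob s w) \<otimes> \<sigma> u) \<cdot> (vmul v s w \<otimes> Idn M (vob v u))
        = (alax H s w \<cdot> (\<sigma> s \<otimes> \<sigma> w)) \<otimes> (Idn M (aob H u) \<cdot> \<sigma> u)"
      unfolding TAr_Cmp[OF vsw hsw iu h(3), symmetric] mul[OF sw d(4)] Cmp_Idn_right[OF h(3)] Cmp_Idn_left[OF h(3)] ..
    also have "\<dots> = (alax H s w \<otimes> Idn M (aob H u)) \<cdot> ?\<sigma>3"
      by (rule TAr_Cmp[OF TAr_hom[OF h(1,2)] Lsw h(3) Hiu])
    also have "alax H (cob s w) u \<cdot> \<dots> = alax H (cob s w) u \<cdot> (alax H s w \<otimes> Idn M (aob H u)) \<cdot> ?\<sigma>3"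
      by (rule Cmp_assoc[OF TAr_hom[OF TAr_hom[OF h(1,2)] h(3)] TAr_hom[OF Lsw Hiu] L1, symmetric])
    also have "\<dots> = alax H s (cob w u) \<cdot> (Idn M (aob H s) \<otimes> alax H w u) \<cdot> ?HA \<cdot> ?\<sigma>3"
      unfolding lax_algebraD(7)[OF H sw wu] ..
    also have "\<dots> = alax H s (cob w u) \<cdot> (Idn M (aob H s) \<otimes> alax H w u) \<cdot> (?HA \<cdot> ?\<sigma>3)"
      by (rule Cmp_assoc[OF TAr_hom[OF TAr_hom[OF h(1,2)] h(3)] Assoc_hom[OF Ho]
            Cmp_hom[OF TAr_hom[OF His Lwu] L2]])
    \<comment> \<open>Naturality of the associator carries the three components of
      \<open>\<sigma>\<close> past it. What remains undoes the first half, now with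
      \<open>cob w u\<close> as the right factor.\<close>
    also have "?HA \<cdot> ?\<sigma>3 = ?\<sigma>3' \<cdot> ?vA" by (rule Assoc_natural[OF h])
    also have "alax H s (cob w u) \<cdot> (Idn M (aob H s) \<otimes> alax H w u) \<cdot> (?\<sigma>3' \<cdot> ?vA)
        = alax H s (cob w u) \<cdot> (Idn M (aob H s) \<otimes> alax H w u) \<cdot> ?\<sigma>3' \<cdot> ?vA"
      by (rule Cmp_assoc[OF Assoc_hom[OF vo] TAr_hom[OF h(1) TAr_hom[OF h(2,3)]]
            Cmp_hom[OF TAr_hom[OF His Lwu] L2], symmetric])
    also have "alax H s (cob w u) \<cdot> (Idn M (aob H s) \<otimes> alax H w u) \<cdot> ?\<sigma>3'
        = alax H s (cob w u) \<cdot> ((Idn M (aob H s) \<otimes> alax H w u) \<cdot> ?\<sigma>3')"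
      by (rule Cmp_assoc[OF TAr_hom[OF h(1) TAr_hom[OF h(2,3)]] TAr_hom[OF His Lwu] L2])
    also have "(Idn M (aob H s) \<otimes> alax H w u) \<cdot> ?\<sigma>3' = (\<sigma> s \<cdot> Idn M (vob v s)) \<otimes> (\<sigma> (cob w u) \<cdot> vmul v w u)"
      unfolding TAr_Cmp[OF h(1) His TAr_hom[OF h(2,3)] Lwu, symmetric] mul[OF wu d(5)]
        Cmp_Idn_right[OF h(1)] Cmp_Idn_left[OF h(1)] ..
    also have "\<dots> = (\<sigma> s \<otimes> \<sigma> (cob w u)) \<cdot> (Idn M (vob v s) \<otimes> vmul v w u)"
      by (rule TAr_Cmp[OF js h(1) vwu hwu])
    also have "alax H s (cob w u) \<cdot> \<dots> \<cdot> ?vA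
        = alax H s (cob w u) \<cdot> (\<sigma> s \<otimes> \<sigma> (cob w u)) \<cdot> (Idn M (vob v s) \<otimes> vmul v w u) \<cdot> ?vA"
      unfolding Cmp_assoc[OF TAr_hom[OF js vwu] TAr_hom[OF h(1) hwu] L2] ..
    also have "\<dots> = alax H s (cob w u) \<cdot> (\<sigma> s \<otimes> \<sigma> (cob w u)) \<cdot> ((Idn M (vob v s) \<otimes> vmul v w u) \<cdot> ?vA)"
      by (rule Cmp_assoc[OF Assoc_hom[OF vo] TAr_hom[OF js vwu] Cmp_hom[OF TAr_hom[OF h(1) hwu] L2]])
    finally show ?thesis unfolding mul_mul(1-4) kmap_simps .
  qed
  with kmap_hom show ?thesis
    unfolding presented_cocone_def using lax_algebraD(1)[OF H t] by blast
qed

lemma kmap_cong: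
  assumes eq: "\<And>z. z \<in> Ob S \<Longrightarrow> deg z < deg t \<Longrightarrow> \<sigma> z = \<sigma>' z" and i: "i \<in> gens t"
  shows "kmap \<sigma> t i = kmap \<sigma>' t i"
proof (cases i)
  case (Act f)
  then have f: "f \<in> hom S t (Cod S f)" "f \<noteq> Idn S t" using i by (simp_all add: gens_simps in_hom_iff)
  show ?thesis using eq[OF S.hom_Ob(2)[OF f(1)] S.deg_less[OF f]] by (simp add: Act)
next
  case (Mul s u)
  then have su: "comp s u" "cob s u = t" using i by (simp_all add: gens_simps)
  note d = S.deg_cob_less[OF su(1), unfolded su(2)] and o = S.comp_Ob[OF su(1)]
  show ?thesis using eq[OF o(1) d(1)] eq[OF o(2) d(2)] by (simp add: Mul)
qed simp

text \<open>The universal property of the stage at \<open>t\<close>, applied to the cocone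
  \<open>kmap \<sigma> t\<close>.\<close>

lemma mediates_ex1:
  assumes m: "\<And>z. z \<in> Ob S \<Longrightarrow> deg z < deg t \<Longrightarrow> mediates \<sigma> z (\<sigma> z)" and t: "t \<in> Ob S"
  shows "\<exists>!r. mediates \<sigma> t r"
  using good[of t] kmap_presented_cocone[OF m t] t
  unfolding good_def presented_colimit_def mediates_def vob_def by blast

text \<open>The forced values are chosen along the degree. Taking them on all three kinds of
  generators amounts to being a lax map compatible with \<open>\<tau>\<close>.\<close>

lemma mediating_map_exists: "\<exists>\<sigma>. lax_map (colim_alg v) H \<sigma> \<and> (\<forall>j \<in> JO. \<forall>t \<in> Ob S. \<sigma> t \<cdot> vinj v j t = \<tau> j t)"
proof -
  have "\<exists>\<sigma>. \<forall>t. mediates \<sigma> t (\<sigma> t)"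
  proof (rule dependent_wf_choice[of "measure deg"])
    fix \<sigma> \<sigma>' :: "'s \<Rightarrow> 'a" and t r
    assume "\<And>z. (z, t) \<in> measure deg \<Longrightarrow> \<sigma> z = \<sigma>' z"
    then have "\<forall>i \<in> gens t. kmap \<sigma> t i = kmap \<sigma>' t i" by (intro ballI kmap_cong) simp_all
    then show "mediates \<sigma> t r = mediates \<sigma>' t r" by (simp add: mediates_def)
  next
    fix t and \<sigma> :: "'s \<Rightarrow> 'a"
    assume *: "\<And>y. (y, t) \<in> measure deg \<Longrightarrow> mediates \<sigma> y (\<sigma> y)"
    show "\<exists>r. mediates \<sigma> t r"
    proof (cases "t \<in> Ob S")
      case True
      from mediates_ex1[OF _ True, of \<sigma>] * show ?thesis by auto
    qed (simp add: mediates_def)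
  qed simp
  then obtain \<sigma> where "\<And>t. mediates \<sigma> t (\<sigma> t)" by blast
  note \<sigma> = mediatesD[OF this]
  have "lax_map (colim_alg v) H \<sigma>"
    unfolding lax_map_def colim_alg_simps
    using \<sigma>(1) \<sigma>(3)[OF S.hom_Ob(1)] \<sigma>(4)[OF S.cob_Ob] by simp
  then show ?thesis using \<sigma>(2) by blast
qed

text \<open>Agreement below \<open>t\<close> gives both maps the same forced values at
  \<open>t\<close>, so both mediate one cocone and coincide there.\<close>

lemma mediating_map_unique:
  assumes \<sigma>: "lax_map (colim_alg v) H \<sigma>" "\<And>j t. j \<in> JO \<Longrightarrow> t \<in> Ob S \<Longrightarrow> \<sigma> t \<cdot> vinj v j t = \<tau> j t"
    and \<sigma>': "lax_map (colim_alg v) H \<sigma>'" "\<And>j t. j \<in> JO \<Longrightarrow> t \<in> Ob S \<Longrightarrow> \<sigma>' t \<cdot> vinj v j t = \<tau> j t"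
  shows "t \<in> Ob S \<Longrightarrow> \<sigma> t = \<sigma>' t"
proof (induction "deg t" arbitrary: t rule: less_induct)
  case less
  \<comment> \<open>A compatible lax map takes the forced values at every \<open>t\<close>, in
    particular below the current degree, where \<open>mediates_ex1\<close> asks for them.\<close>
  have med: "mediates \<rho> t (\<rho> t)"
    if \<rho>: "lax_map (colim_alg v) H \<rho>" "\<And>j t. j \<in> JO \<Longrightarrow> t \<in> Ob S \<Longrightarrow> \<rho> t \<cdot> vinj v j t = \<tau> j t" for \<rho> t
    unfolding mediates_def
  proof (intro impI conjI ballI)
    assume t: "t \<in> Ob S"
    show "\<rho> t \<in> hom M (vob v t) (aob H t)" using lax_mapD(1)[OF \<rho>(1) t] by simp
    fix i assume i: "i \<in> gens t"
    show "\<rho> t \<cdot> snd (v t) i = kmap \<rho> t i"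
    proof (cases i)
      case (Inj j)
      then show ?thesis using i \<rho>(2)[of j t] t by (simp add: gens_simps vinj_def)
    next
      case (Act f)
      then have f: "f \<in> hom S t (Cod S f)" "f \<noteq> Idn S t" using i by (simp_all add: gens_simps in_hom_iff)
      show ?thesis using lax_mapD(2)[OF \<rho>(1) f(1)] by (simp add: Act vact_proper[OF f])
    next
      case (Mul s u)
      then have su: "comp s u" "cob s u = t" using i by (simp_all add: gens_simps)
      show ?thesis using lax_mapD(3)[OF \<rho>(1) su(1)] by (simp add: Mul vmul_def su(2))
    qed
  qed
  have "mediates \<sigma> t (\<sigma>' t)"
    using med[OF \<sigma>', of t] kmap_cong[of t \<sigma> \<sigma>'] less.hyps by (simp add: mediates_def)
  with mediates_ex1[OF med[OF \<sigma>] less.prems] med[OF \<sigma>, of t] show ?case by blast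
qed

end

end

text \<open>Uniqueness is stated pointwise on \<open>Ob S\<close>, since lax maps are unconstrained
  elsewhere. The stages are hidden behind the obtained \<open>G\<close> and
  \<open>\<iota>\<close>.\<close>

theorem lax_algebra_colimit:
  fixes \<kappa> :: "'u rel"
  assumes "Card_order \<kappa>" "infinite (Field \<kappa>)" "cocomplete \<kappa> M" "|JO| <o \<kappa>" "|JA| <o \<kappa>"
  obtains G \<iota> where "lax_algebra G" "\<And>j. j \<in> JO \<Longrightarrow> lax_map (D j) G (\<iota> j)"
    "\<And>u t. u \<in> JA \<Longrightarrow> t \<in> Ob S \<Longrightarrow> \<iota> (jc u) t \<cdot> T u t = \<iota> (jd u) t"
    "\<And>H \<tau>. lax_algebra H \<Longrightarrow> (\<And>j. j \<in> JO \<Longrightarrow> lax_map (D j) H (\<tau> j)) \<Longrightarrow>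
       (\<And>u t. u \<in> JA \<Longrightarrow> t \<in> Ob S \<Longrightarrow> \<tau> (jc u) t \<cdot> T u t = \<tau> (jd u) t) \<Longrightarrow>
       (\<exists>\<sigma>. lax_map G H \<sigma> \<and> (\<forall>j \<in> JO. \<forall>t \<in> Ob S. \<sigma> t \<cdot> \<iota> j t = \<tau> j t)) \<and>
       (\<forall>\<sigma> \<sigma>'. lax_map G H \<sigma> \<longrightarrow> (\<forall>j \<in> JO. \<forall>t \<in> Ob S. \<sigma> t \<cdot> \<iota> j t = \<tau> j t) \<longrightarrow>
          lax_map G H \<sigma>' \<longrightarrow> (\<forall>j \<in> JO. \<forall>t \<in> Ob S. \<sigma>' t \<cdot> \<iota> j t = \<tau> j t) \<longrightarrow>
          (\<forall>t \<in> Ob S. \<sigma> t = \<sigma>' t))"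
proof -
  obtain v where v: "\<And>t. good v t (v t)" using good_stage_exists[OF assms] by blast
  show thesis
  proof (rule that[of "colim_alg v" "vinj v"])
    show "lax_algebra (colim_alg v)" by (rule lax_algebra_colim[OF v])
    show "lax_map (D j) (colim_alg v) (vinj v j)" if "j \<in> JO" for j by (rule lax_map_vinj[OF v that])
    show "vinj v (jc u) t \<cdot> T u t = vinj v (jd u) t" if "u \<in> JA" "t \<in> Ob S" for u t
      by (rule vinj_compatible[OF v that])
  next
    fix H \<tau>
    assume H: "lax_algebra H" "\<And>j. j \<in> JO \<Longrightarrow> lax_map (D j) H (\<tau> j)"
      "\<And>u t. u \<in> JA \<Longrightarrow> t \<in> Ob S \<Longrightarrow> \<tau> (jc u) t \<cdot> T u t = \<tau> (jd u) t"
    show "(\<exists>\<sigma>. lax_map (colim_alg v) H \<sigma> \<and> (\<forall>j \<in> JO. \<forall>t \<in> Ob S. \<sigma> t \<cdot> vinj v j t = \<tau> j t)) \<and>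
       (\<forall>\<sigma> \<sigma>'. lax_map (colim_alg v) H \<sigma> \<longrightarrow> (\<forall>j \<in> JO. \<forall>t \<in> Ob S. \<sigma> t \<cdot> vinj v j t = \<tau> j t) \<longrightarrow>
          lax_map (colim_alg v) H \<sigma>' \<longrightarrow> (\<forall>j \<in> JO. \<forall>t \<in> Ob S. \<sigma>' t \<cdot> vinj v j t = \<tau> j t) \<longrightarrow>
          (\<forall>t \<in> Ob S. \<sigma> t = \<sigma>' t))"
    proof (intro conjI allI impI ballI)
      show "\<exists>\<sigma>. lax_map (colim_alg v) H \<sigma> \<and> (\<forall>j \<in> JO. \<forall>t \<in> Ob S. \<sigma> t \<cdot> vinj v j t = \<tau> j t)"
        by (rule mediating_map_exists[OF v H])
    next
      fix \<sigma> \<sigma>' t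
      assume s: "lax_map (colim_alg v) H \<sigma>" "\<forall>j \<in> JO. \<forall>t \<in> Ob S. \<sigma> t \<cdot> vinj v j t = \<tau> j t"
        "lax_map (colim_alg v) H \<sigma>'" "\<forall>j \<in> JO. \<forall>t \<in> Ob S. \<sigma>' t \<cdot> vinj v j t = \<tau> j t" "t \<in> Ob S"
      show "\<sigma> t = \<sigma>' t"
        by (rule mediating_map_unique[OF v H s(1) s(2)[rule_format] s(3) s(4)[rule_format] s(5)])
    qed
  qed
qed

end

section \<open>The graded category of paths\<close>

text \<open>The disjoint union of the categories \<open>seq_cat X A B\<close> over all pairs of end
  points: every arrow keeps the end points, so none joins two of them.\<close>

definition path_cat :: "'x set \<Rightarrow> ('x list, 'x seq_arrow) cat" where
  "path_cat X = \<lparr>Ob = {t. set t \<subseteq> X \<and> 2 \<le> length t}, Ar = (\<Union>A. \<Union>B. seq_ar X A B),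
     Dom = (\<lambda>(s, f, t). s), Cod = (\<lambda>(s, f, t). t),
     Idn = (\<lambda>t. (t, restrict id {..<deg t}, t)),
     Cmp = (\<lambda>(t, g, u) (s, f, t'). (s, compose {..<deg s} g f, u))\<rparr>"

definition path_comp :: "'x set \<Rightarrow> 'x list \<Rightarrow> 'x list \<Rightarrow> bool" where
  "path_comp X s u \<longleftrightarrow> s \<in> Ob (path_cat X) \<and> u \<in> Ob (path_cat X) \<and> last s = hd u"

text \<open>Surjectivity and the condition \<open>E'\<^sub>j = E\<^bsub>min f\<^sup>-\<^sup>1(j)\<^esub>\<close>, without \<open>Min\<close>: \<open>j\<close> has a first preimage \<open>i\<close>.\<close>

definition seq_map :: "'x list \<Rightarrow> (nat \<Rightarrow> nat) \<Rightarrow> 'x list \<Rightarrow> bool" where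
  "seq_map s f t \<longleftrightarrow> f \<in> {..<deg s} \<rightarrow>\<^sub>E {..<deg t} \<and> mono_on {..<deg s} f \<and>
     (\<forall>j < deg t. \<exists>i < deg s. f i = j \<and> (\<forall>i' < i. f i' \<noteq> j) \<and> t ! j = s ! i)"

lemma Min_first:
  fixes i n :: nat
  assumes "i < n" "f i = j" "\<forall>i' < i. f i' \<noteq> j"
  shows "Min {i \<in> {..<n}. f i = j} = i"
proof (rule Min_eqI)
  show "finite {i \<in> {..<n}. f i = j}" by simp
  show "i \<le> y" if "y \<in> {i \<in> {..<n}. f i = j}" for y
  proof (rule ccontr)
    assume "\<not> i \<le> y"
    then have "y < i" by simp
    then show False using assms(3) that by simp
  qed
  show "i \<in> {i \<in> {..<n}. f i = j}" using assms by simp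
qed

lemma seq_ar_iff:
  "(s, f, t) \<in> seq_ar X A B \<longleftrightarrow> s \<in> seq_ob X A B \<and> t \<in> seq_ob X A B \<and> seq_map s f t"
proof (intro iffI conjI)
  assume *: "(s, f, t) \<in> seq_ar X A B"
  then show "s \<in> seq_ob X A B" "t \<in> seq_ob X A B" by (simp_all add: seq_ar_def)
  have f: "f \<in> {..<deg s} \<rightarrow>\<^sub>E {..<deg t}" "mono_on {..<deg s} f" and im: "f ` {..<deg s} = {..<deg t}"
    and eq: "\<forall>j < deg t. t ! j = s ! Min {i \<in> {..<deg s}. f i = j}"
    using * by (simp_all add: seq_ar_def)
  have "\<exists>i < deg s. f i = j \<and> (\<forall>i' < i. f i' \<noteq> j) \<and> t ! j = s ! i" if j: "j < deg t" for j
  proof -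
    have "j \<in> f ` {..<deg s}" unfolding im using j by simp
    then obtain k where k: "j = f k" "k \<in> {..<deg s}" by (rule imageE)
    \<comment> \<open>The least number is sought in all of \<open>nat\<close>; the preimage
      \<open>k\<close> from surjectivity keeps it below \<open>deg s\<close>, where \<open>f\<close>
      is meaningful.\<close>
    define i where "i = (LEAST i. f i = j)"
    have fi: "f i = j" unfolding i_def by (rule LeastI[of _ k]) (simp add: k(1))
    have "i \<le> k" unfolding i_def by (rule Least_le) (simp add: k(1))
    then have i: "i < deg s" using k(2) by simp
    have first: "\<forall>i' < i. f i' \<noteq> j" unfolding i_def using not_less_Least by blast
    have "t ! j = s ! i" using eq j unfolding Min_first[OF i fi first, symmetric] by blast
    then show ?thesis using i fi first by blast
  qed
  with f show "seq_map s f t" by (simp add: seq_map_def)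
next
  assume *: "s \<in> seq_ob X A B \<and> t \<in> seq_ob X A B \<and> seq_map s f t"
  then have f: "f \<in> {..<deg s} \<rightarrow>\<^sub>E {..<deg t}" "mono_on {..<deg s} f"
    and first: "\<And>j. j < deg t \<Longrightarrow> \<exists>i < deg s. f i = j \<and> (\<forall>i' < i. f i' \<noteq> j) \<and> t ! j = s ! i"
    by (simp_all add: seq_map_def)
  have "f ` {..<deg s} = {..<deg t}"
  proof
    show "f ` {..<deg s} \<subseteq> {..<deg t}" using f(1) by (auto simp: PiE_iff)
    show "{..<deg t} \<subseteq> f ` {..<deg s}" using first by force
  qed
  moreover have "t ! j = s ! Min {i \<in> {..<deg s}. f i = j}" if "j < deg t" for j
    using first[OF that] Min_first[of _ "deg s" f j] by auto
  ultimately show "(s, f, t) \<in> seq_ar X A B" using * f by (simp add: seq_ar_def)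
qed

lemma seq_ob_iff: "t \<in> seq_ob X A B \<longleftrightarrow> t \<in> Ob (path_cat X) \<and> hd t = A \<and> last t = B"
  by (auto simp: seq_ob_def path_cat_def)

lemma path_hom_iff:
  "\<phi> \<in> hom (path_cat X) s t \<longleftrightarrow> s \<in> Ob (path_cat X) \<and> t \<in> Ob (path_cat X) \<and> hd s = hd t \<and> last s = last t \<and>
     (\<exists>f. \<phi> = (s, f, t) \<and> seq_map s f t)"
proof -
  obtain s' f t' where \<phi>: "\<phi> = (s', f, t')" by (cases \<phi>)
  have "\<phi> \<in> hom (path_cat X) s t \<longleftrightarrow> (\<exists>A B. \<phi> \<in> seq_ar X A B) \<and> s' = s \<and> t' = t"
    by (simp add: hom_def path_cat_def \<phi>)
  also have "\<dots> \<longleftrightarrow> s \<in> Ob (path_cat X) \<and> t \<in> Ob (path_cat X) \<and> hd s = hd t \<and> last s = last t \<and> s' = s \<and> t' = t \<and> seq_map s f t"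
    unfolding \<phi> seq_ar_iff seq_ob_iff by auto
  finally show ?thesis using \<phi> by auto
qed

text \<open>\<open>seq_cat X A B\<close> is a full subcategory of \<open>path_cat X\<close>: arrows
  keep end points, so those of the source fix those of the target. Facts on paths thereby transfer
  to each pair \<open>A\<close>, \<open>B\<close>.\<close>

lemma seq_hom_eq_path_hom:
  assumes "s \<in> seq_ob X A B"
  shows "hom (seq_cat X A B) s t = hom (path_cat X) s t"
proof -
  have "\<phi> \<in> hom (seq_cat X A B) s t \<longleftrightarrow> \<phi> \<in> hom (path_cat X) s t" for \<phi>
  proof -
    obtain s' f t' where \<phi>: "\<phi> = (s', f, t')" by (cases \<phi>)
    have "\<phi> \<in> hom (seq_cat X A B) s t \<longleftrightarrow> (s', f, t') \<in> seq_ar X A B \<and> s' = s \<and> t' = t"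
      by (auto simp add: hom_def seq_cat_def \<phi>)
    then show ?thesis using assms unfolding path_hom_iff seq_ar_iff seq_ob_iff \<phi> by auto
  qed
  then show ?thesis by blast
qed

lemma seq_map_id: "seq_map s (restrict id {..<deg s}) s"
  by (auto simp: seq_map_def mono_on_def)

text \<open>The first preimage of \<open>k\<close> under the composite is the first
  \<open>f\<close>-preimage of the first \<open>g\<close>-preimage; monotonicity of \<open>f\<close>
  excludes anything earlier.\<close>

lemma seq_map_compose:
  assumes f: "seq_map s f t" and g: "seq_map t g u"
  shows "seq_map s (compose {..<deg s} g f) u"
  unfolding seq_map_def
proof (intro conjI allI impI)
  have fin: "f i < deg t" if "i < deg s" for i using f that by (auto simp: seq_map_def PiE_iff)
  have gin: "g i < deg u" if "i < deg t" for i using g that by (auto simp: seq_map_def PiE_iff)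
  have fm: "f i \<le> f i'" if "i \<le> i'" "i' < deg s" for i i' using f that by (auto simp: seq_map_def mono_on_def)
  have gm: "g i \<le> g i'" if "i \<le> i'" "i' < deg t" for i i' using g that by (auto simp: seq_map_def mono_on_def)
  show "compose {..<deg s} g f \<in> {..<deg s} \<rightarrow>\<^sub>E {..<deg u}"
    using fin gin by (auto simp: compose_def)
  show "mono_on {..<deg s} (compose {..<deg s} g f)"
    using fin fm gm by (auto simp: mono_on_def compose_def)
  fix k assume "k < deg u"
  then obtain j where j: "j < deg t" "g j = k" "\<forall>j' < j. g j' \<noteq> k" "u ! k = t ! j"
    using g by (auto simp: seq_map_def)
  then obtain i where i: "i < deg s" "f i = j" "\<forall>i' < i. f i' \<noteq> j" "t ! j = s ! i"
    using f by (auto simp: seq_map_def)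
  have "g (f i') \<noteq> k" if "i' < i" for i'
  proof -
    have "f i' \<noteq> j" "f i' \<le> j" using that i fm[of i' i] by auto
    then show ?thesis using j(3) by simp
  qed
  then show "\<exists>i < deg s. compose {..<deg s} g f i = k \<and> (\<forall>i' < i. compose {..<deg s} g f i' \<noteq> k) \<and> u ! k = s ! i"
    using i j by (intro exI[of _ i]) (auto simp: compose_def)
qed

lemma path_cat_simps:
  "Idn (path_cat X) t = (t, restrict id {..<deg t}, t)"
  "Cmp (path_cat X) (t', g, u) (s, f, t) = (s, compose {..<deg s} g f, u)"
  by (simp_all add: path_cat_def)

lemma category_path_cat: "category (path_cat X)"
proof
  fix \<phi> assume "\<phi> \<in> Ar (path_cat X)"
  then have "\<phi> \<in> hom (path_cat X) (Dom (path_cat X) \<phi>) (Cod (path_cat X) \<phi>)" by (simp add: hom_def)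
  then show "Dom (path_cat X) \<phi> \<in> Ob (path_cat X)" "Cod (path_cat X) \<phi> \<in> Ob (path_cat X)"
    unfolding path_hom_iff by auto
next
  fix t assume "t \<in> Ob (path_cat X)"
  then show "Idn (path_cat X) t \<in> hom (path_cat X) t t"
    using seq_map_id by (simp add: path_hom_iff path_cat_simps)
next
  fix \<phi> \<psi> s t u assume "\<phi> \<in> hom (path_cat X) s t" "\<psi> \<in> hom (path_cat X) t u"
  then show "Cmp (path_cat X) \<psi> \<phi> \<in> hom (path_cat X) s u"
    unfolding path_hom_iff using seq_map_compose by (auto simp: path_cat_simps)
next
  fix \<phi> s t assume "\<phi> \<in> hom (path_cat X) s t"
  then obtain f where \<phi>: "\<phi> = (s, f, t)" "seq_map s f t" by (auto simp: path_hom_iff)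
  then have f: "f \<in> {..<deg s} \<rightarrow>\<^sub>E {..<deg t}" by (simp add: seq_map_def)
  \<comment> \<open>Both maps are \<open>undefined\<close> off \<open>{..<deg s}\<close>,
    \<open>f\<close> by extensionality, so the equality holds at every number.\<close>
  have "compose {..<deg s} (restrict id {..<deg t}) f = f"
  proof
    fix i show "compose {..<deg s} (restrict id {..<deg t}) f i = f i"
      using f by (cases "i < deg s") (auto simp: compose_def PiE_iff extensional_def)
  qed
  then show "Cmp (path_cat X) (Idn (path_cat X) t) \<phi> = \<phi>" by (simp add: \<phi> path_cat_simps)
  have "compose {..<deg s} f (restrict id {..<deg s}) = f"
  proof
    fix i show "compose {..<deg s} f (restrict id {..<deg s}) i = f i"
      using f by (cases "i < deg s") (auto simp: compose_def PiE_iff extensional_def)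
  qed
  then show "Cmp (path_cat X) \<phi> (Idn (path_cat X) s) = \<phi>" by (simp add: \<phi> path_cat_simps)
next
  fix \<phi> \<psi> \<chi> s t u w
  assume "\<phi> \<in> hom (path_cat X) s t" "\<psi> \<in> hom (path_cat X) t u" "\<chi> \<in> hom (path_cat X) u w"
  then obtain f g h where fgh: "\<phi> = (s, f, t)" "seq_map s f t" "\<psi> = (t, g, u)" "\<chi> = (u, h, w)"
    by (auto simp: path_hom_iff)
  then have "f \<in> {..<deg s} \<rightarrow> {..<deg t}" by (auto simp: seq_map_def PiE_iff)
  note assoc = compose_assoc[OF this]
  show "Cmp (path_cat X) (Cmp (path_cat X) \<chi> \<psi>) \<phi> = Cmp (path_cat X) \<chi> (Cmp (path_cat X) \<psi> \<phi>)"
    by (simp only: fgh path_cat_simps assoc)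
qed

lemma deg_path: "t \<in> Ob (path_cat X) \<Longrightarrow> length t = Suc (deg t) \<and> 0 < deg t"
  by (auto simp: path_cat_def deg_def)

lemma last_path: "t \<in> Ob (path_cat X) \<Longrightarrow> last t = t ! deg t"
  by (cases "t = []") (auto simp: path_cat_def deg_def last_conv_nth)

lemma seq_map_deg_le:
  assumes "seq_map s f t"
  shows "deg t \<le> deg s"
proof -
  have "{..<deg t} \<subseteq> f ` {..<deg s}" using assms by (force simp: seq_map_def)
  then show ?thesis using surj_card_le[of "{..<deg s}" "{..<deg t}" f] by simp
qed

text \<open>A monotone surjection of a finite interval onto itself is injective, hence strictly
  increasing, hence satisfies \<open>i \<le> f i\<close>. As it permutes the interval, the sums of
  both sides agree and no inequality is strict.\<close>

lemma seq_map_deg_eq: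
  assumes f: "seq_map s f t" and eq: "deg t = deg s" and i: "i < deg s"
  shows "f i = i"
proof -
  let ?N = "{..<deg s}"
  have im: "f ` ?N = ?N"
  proof
    show "f ` ?N \<subseteq> ?N" using f eq by (auto simp: seq_map_def PiE_iff)
    show "?N \<subseteq> f ` ?N" using f eq by (force simp: seq_map_def)
  qed
  then have inj: "inj_on f ?N" by (intro eq_card_imp_inj_on) simp_all
  have less: "f i < f k" if "i < k" "k < deg s" for i k
  proof -
    have "f i \<le> f k" using f that by (auto simp: seq_map_def mono_on_def)
    moreover have "f i \<noteq> f k" using inj_on_eq_iff[OF inj, of i k] that by simp
    ultimately show ?thesis by simp
  qed
  have ge: "i \<le> f i" if "i < deg s" for i
    using that
  proof (induction i)
    case (Suc i)
    then show ?case using less[of i "Suc i"] by simp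
  qed simp
  have "(\<Sum>i \<in> ?N. f i) = (\<Sum>i \<in> f ` ?N. i)" by (simp add: sum.reindex[OF inj])
  then have "(\<Sum>i \<in> ?N. i) = (\<Sum>i \<in> ?N. f i)" using im by simp
  from sum_mono_inv[OF this] show ?thesis using ge i by simp
qed

section \<open>Concatenation of paths\<close>

text \<open>Both formulas apply at the junction \<open>deg s\<close>, where
  \<open>last s = hd u\<close> makes them agree; \<open>concat_ob\<close> keeps the entry of
  \<open>s\<close> there.\<close>

lemma concat_nth:
  assumes "path_comp X s u"
  shows "i \<le> deg s \<Longrightarrow> concat_ob s u ! i = s ! i" "i \<le> deg u \<Longrightarrow> concat_ob s u ! (deg s + i) = u ! i"
proof -
  have s: "s \<in> Ob (path_cat X)" and u: "u \<in> Ob (path_cat X)" and eq: "last s = hd u"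
    using assms by (auto simp: path_comp_def)
  note ls = deg_path[OF s] and lu = deg_path[OF u]
  show 1: "concat_ob s u ! i = s ! i" if "i \<le> deg s" for i
    using that ls by (simp add: concat_ob_def nth_append)
  show "concat_ob s u ! (deg s + i) = u ! i" if "i \<le> deg u"
  proof (cases i)
    case 0
    have "u \<noteq> []" using lu by auto
    then show ?thesis using 1[of "deg s"] last_path[OF s] eq 0 by (simp add: hd_conv_nth)
  next
    case (Suc k)
    then show ?thesis using that ls lu by (simp add: concat_ob_def nth_append nth_tl)
  qed
qed

lemma concat_path:
  assumes "path_comp X s u"
  shows "concat_ob s u \<in> Ob (path_cat X)" "hd (concat_ob s u) = hd s" "last (concat_ob s u) = last u"
    "deg (concat_ob s u) = deg s + deg u"
  using assms
  by (cases s; cases u; auto simp: path_comp_def path_cat_def concat_ob_def deg_def dest!: list.set_sel(2))+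

text \<open>The ordinal sum has two blocks. First preimages in the second block are shifted by
  \<open>deg s\<close>; the first block cannot interfere, because its values stay below
  \<open>deg s'\<close>.\<close>

lemma seq_map_concat:
  assumes f: "seq_map s f s'" and g: "seq_map u g u'" and c: "path_comp X s u" and c': "path_comp X s' u'"
  shows "seq_map (concat_ob s u)
    (restrict (\<lambda>i. if i < deg s then f i else deg s' + g (i - deg s)) {..<deg s + deg u}) (concat_ob s' u')"
proof -
  let ?h = "restrict (\<lambda>i. if i < deg s then f i else deg s' + g (i - deg s)) {..<deg s + deg u}"
  have fin: "f i < deg s'" if "i < deg s" for i using f that by (auto simp: seq_map_def PiE_iff)
  have gin: "g i < deg u'" if "i < deg u" for i using g that by (auto simp: seq_map_def PiE_iff)
  have fm: "f i \<le> f i'" if "i \<le> i'" "i' < deg s" for i i' using f that by (auto simp: seq_map_def mono_on_def)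
  have gm: "g i \<le> g i'" if "i \<le> i'" "i' < deg u" for i i' using g that by (auto simp: seq_map_def mono_on_def)
  have h1: "?h i = f i" if "i < deg s" for i using that by simp
  have h2: "?h (deg s + i) = deg s' + g i" if "i < deg u" for i using that by simp
  have h_in: "?h i < deg s' + deg u'" if "i < deg s + deg u" for i
    using fin[of i] gin[of "i - deg s"] that by auto
  have "?h i \<le> ?h i'" if "i \<le> i'" "i' < deg s + deg u" for i i'
  proof (cases "i' < deg s")
    case True
    then show ?thesis using that fm[of i i'] by simp
  next
    case False
    then show ?thesis using that fin[of i] gm[of "i - deg s" "i' - deg s"] by auto
  qed
  then have mono: "mono_on {..<deg s + deg u} ?h" by (auto simp: mono_on_def)
  have "\<exists>i < deg s + deg u. ?h i = j \<and> (\<forall>i' < i. ?h i' \<noteq> j) \<and> concat_ob s' u' ! j = concat_ob s u ! i"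
    if j: "j < deg s' + deg u'" for j
  proof (cases "j < deg s'")
    case True
    then obtain i where i: "i < deg s" "f i = j" "\<forall>i' < i. f i' \<noteq> j" "s' ! j = s ! i"
      using f by (auto simp: seq_map_def)
    then show ?thesis
      using concat_nth(1)[OF c, of i] concat_nth(1)[OF c', of j] True by (intro exI[of _ i]) auto
  next
    case False
    define k where "k = j - deg s'"
    have k: "k < deg u'" "j = deg s' + k" using False j by (auto simp: k_def)
    then obtain i where i: "i < deg u" "g i = k" "\<forall>i' < i. g i' \<noteq> k" "u' ! k = u ! i"
      using g by (auto simp: seq_map_def)
    have "?h i' \<noteq> j" if "i' < deg s + i" for i'
    proof (cases "i' < deg s")
      case True
      then show ?thesis using fin[of i'] k by simp
    next
      case False
      then show ?thesis using i(1,3) k that by auto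
    qed
    then show ?thesis
      using i k concat_nth(2)[OF c, of i] concat_nth(2)[OF c', of k] h2[of i] by (intro exI[of _ "deg s + i"]) auto
  qed
  then show ?thesis
    unfolding seq_map_def concat_path(4)[OF c] concat_path(4)[OF c']
    using mono h_in by auto
qed

section \<open>Finiteness of outgoing arrows and of splittings\<close>

text \<open>An arrow out of \<open>t\<close> cannot increase the degree and copies entries of
  \<open>t\<close>, so its target is one of finitely many lists, and its map is an extensional
  function between finite intervals.\<close>

lemma path_finite_out:
  assumes t: "t \<in> Ob (path_cat X)"
  shows "finite {\<phi> \<in> Ar (path_cat X). Dom (path_cat X) \<phi> = t}"
proof (rule finite_subset)
  let ?F = "\<Union>n \<le> deg t. {..<deg t} \<rightarrow>\<^sub>E {..<n}" and ?L = "{l. set l \<subseteq> set t \<and> length l \<le> length t}"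
  show "finite ({t} \<times> ?F \<times> ?L)"
    by (intro finite_cartesian_product finite_UN_I finite_PiE finite_lists_length_le) simp_all
  show "{\<phi> \<in> Ar (path_cat X). Dom (path_cat X) \<phi> = t} \<subseteq> {t} \<times> ?F \<times> ?L"
  proof
    fix \<phi> assume "\<phi> \<in> {\<phi> \<in> Ar (path_cat X). Dom (path_cat X) \<phi> = t}"
    then have "\<phi> \<in> hom (path_cat X) t (Cod (path_cat X) \<phi>)" by (simp add: hom_def)
    then obtain u f where \<phi>: "\<phi> = (t, f, u)" and f: "seq_map t f u" and u: "u \<in> Ob (path_cat X)" "last t = last u"
      unfolding path_hom_iff by blast
    have le: "deg u \<le> deg t" by (rule seq_map_deg_le[OF f])
    have "f \<in> {..<deg t} \<rightarrow>\<^sub>E {..<deg u}" using f by (simp add: seq_map_def)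
    then have "f \<in> ?F" using le by blast
    moreover have "u ! j \<in> set t" if "j < length u" for j
    proof (cases "j < deg u")
      case True
      then obtain i where "i < deg t" "u ! j = t ! i" using f unfolding seq_map_def by blast
      then show ?thesis using deg_path[OF t] by simp
    next
      case False
      \<comment> \<open>The map governs only the entries of \<open>u\<close> before the last one;
        the last one is fixed by the common end point.\<close>
      then have "j = deg u" using that deg_path[OF u(1)] by simp
      then have "u ! j = last t" using last_path[OF u(1)] u(2) by simp
      moreover have "t \<noteq> []" using deg_path[OF t] by auto
      ultimately show ?thesis by simp
    qed
    then have "set u \<subseteq> set t" by (auto simp: in_set_conv_nth)
    moreover have "length u \<le> length t" using le deg_path[OF t] deg_path[OF u(1)] by simp
    ultimately show "\<phi> \<in> {t} \<times> ?F \<times> ?L" by (simp add: \<phi>)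
  qed
qed

lemma finite_path_splittings: "finite {(s, u). path_comp X s u \<and> concat_ob s u = t}"
proof (rule finite_subset)
  let ?L = "{l. set l \<subseteq> set t \<and> length l \<le> length t}"
  show "finite (?L \<times> ?L)" by (intro finite_cartesian_product finite_lists_length_le) simp_all
  have "s \<in> ?L \<and> u \<in> ?L" if c: "path_comp X s u" and t: "concat_ob s u = t" for s u
  proof -
    have s: "s \<in> Ob (path_cat X)" and u: "u \<in> Ob (path_cat X)" and eq: "last s = hd u"
      using c by (auto simp: path_comp_def)
    have ne: "s \<noteq> []" "u \<noteq> []" using deg_path[OF s] deg_path[OF u] by auto
    have "set u = insert (hd u) (set (tl u))" using ne(2) by (cases u) simp_all
    \<comment> \<open>\<open>concat_ob\<close> drops the head of \<open>u\<close>, which is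
      recovered as the last entry of \<open>s\<close>.\<close>
    moreover have "hd u \<in> set s" using last_in_set[OF ne(1)] eq by simp
    moreover have "set t = set s \<union> set (tl u)" unfolding t[symmetric] concat_ob_def by simp
    moreover have "length t = length s + length u - 1" using deg_path[OF u] unfolding t[symmetric] concat_ob_def by simp
    ultimately show ?thesis using deg_path[OF s] deg_path[OF u] by auto
  qed
  then show "{(s, u). path_comp X s u \<and> concat_ob s u = t} \<subseteq> ?L \<times> ?L" by blast
qed

lemma graded_concat_path_cat:
  "graded_concat_category (path_cat X) deg (path_comp X) concat_ob concat_ar"
proof (rule graded_concat_category.intro[OF category_path_cat], unfold_locales)
  fix s u assume c: "path_comp X s u"
  then show "s \<in> Ob (path_cat X)" "u \<in> Ob (path_cat X)" by (simp_all add: path_comp_def)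
  show "concat_ob s u \<in> Ob (path_cat X)" "deg (concat_ob s u) = deg s + deg u"
    by (rule concat_path[OF c])+
  show "concat_ar (Idn (path_cat X) s) (Idn (path_cat X) u) = Idn (path_cat X) (concat_ob s u)"
    by (auto simp: path_cat_simps concat_ar_def concat_path(4)[OF c] restrict_def fun_eq_iff)
next
  fix s :: "'a list" assume "s \<in> Ob (path_cat X)"
  then show "0 < deg s" using deg_path by blast
next
  fix \<phi> and s s' :: "'a list" assume \<phi>: "\<phi> \<in> hom (path_cat X) s s'"
  then obtain f where f: "\<phi> = (s, f, s')" "seq_map s f s'" and o: "s \<in> Ob (path_cat X)" "s' \<in> Ob (path_cat X)"
    and last: "last s = last s'"
    unfolding path_hom_iff by blast
  show "deg s' \<le> deg s" by (rule seq_map_deg_le[OF f(2)])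
  assume eq: "deg s' = deg s"
  have id: "f i = i" if "i < deg s" for i by (rule seq_map_deg_eq[OF f(2) eq that])
  have "f = restrict id {..<deg s}"
  proof
    fix i show "f i = restrict id {..<deg s} i"
      using f(2) id by (cases "i < deg s") (auto simp: seq_map_def PiE_iff extensional_def)
  qed
  \<comment> \<open>With \<open>f\<close> the identity, the first-preimage condition copies all
    entries but the last, and equality of end points supplies that one.\<close>
  moreover have "s' = s"
  proof (rule nth_equalityI)
    show "length s' = length s" using eq deg_path[OF o(1)] deg_path[OF o(2)] by simp
    fix j assume "j < length s'"
    then consider "j < deg s'" | "j = deg s'" using deg_path[OF o(2)] by linarith
    then show "s' ! j = s ! j"
    proof cases
      case 1
      then obtain i where "i < deg s" "f i = j" "s' ! j = s ! i" using f(2) unfolding seq_map_def by blast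
      then show ?thesis using id by simp
    next
      case 2
      then show ?thesis using last last_path[OF o(1)] last_path[OF o(2)] eq by simp
    qed
  qed
  ultimately show "\<phi> = Idn (path_cat X) s" by (simp add: f(1) path_cat_simps)
next
  fix t :: "'a list" assume "t \<in> Ob (path_cat X)"
  then show "finite {f \<in> Ar (path_cat X). Dom (path_cat X) f = t}" by (rule path_finite_out)
next
  fix t :: "'a list" 
  show "finite {(s, u). path_comp X s u \<and> concat_ob s u = t}" by (rule finite_path_splittings)
next
  fix s t u assume st: "path_comp X s t" and tu: "path_comp X t u"
  show "path_comp X (concat_ob s t) u" "path_comp X s (concat_ob t u)"
    using st tu concat_path[OF st] concat_path[OF tu] by (simp_all add: path_comp_def)
  \<comment> \<open>A nonempty \<open>t\<close> is what makes \<open>tl (t @ tl u)\<close> equal to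
    \<open>tl t @ tl u\<close>.\<close>
  have "t \<noteq> []" "tl t \<noteq> []" using st by (cases t; cases "tl t"; auto simp: path_comp_def path_cat_def)+
  then show "concat_ob (concat_ob s t) u = concat_ob s (concat_ob t u)"
    by (simp add: concat_ob_def)
next
  fix \<phi> \<psi> s u s' u' assume c: "path_comp X s u" and \<phi>: "\<phi> \<in> hom (path_cat X) s s'" and \<psi>: "\<psi> \<in> hom (path_cat X) u u'"
  then show c': "path_comp X s' u'" by (simp add: path_comp_def path_hom_iff)
  obtain f g where f: "\<phi> = (s, f, s')" "seq_map s f s'" and g: "\<psi> = (u, g, u')" "seq_map u g u'"
    using \<phi> \<psi> by (auto simp: path_hom_iff)
  have e: "hd s = hd s'" "last u = last u'" using \<phi> \<psi> by (simp_all add: path_hom_iff)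
  show "concat_ar \<phi> \<psi> \<in> hom (path_cat X) (concat_ob s u) (concat_ob s' u')"
    unfolding path_hom_iff f(1) g(1) concat_ar_def prod.case
    using concat_path[OF c] concat_path[OF c'] e seq_map_concat[OF f(2) g(2) c c'] by simp
qed

text \<open>Fullness in \<open>path_cat X\<close> reduces every law to the category of all
  paths.\<close>

lemma category_seq_cat: "category (seq_cat X A B)"
proof -
  interpret P: category "path_cat X" by (rule category_path_cat)
  have ob: "s \<in> seq_ob X A B \<Longrightarrow> s \<in> Ob (path_cat X)" for s by (simp add: seq_ob_iff)
  have hom: "\<phi> \<in> hom (seq_cat X A B) s t \<Longrightarrow> s \<in> seq_ob X A B \<and> t \<in> seq_ob X A B \<and> \<phi> \<in> hom (path_cat X) s t" for \<phi> s t
  proof -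
    assume \<phi>: "\<phi> \<in> hom (seq_cat X A B) s t"
    then have "s \<in> seq_ob X A B \<and> t \<in> seq_ob X A B" by (auto simp: hom_def seq_cat_def seq_ar_def)
    with \<phi> show ?thesis using seq_hom_eq_path_hom[of s X A B t] by simp
  qed
  have simps: "Idn (seq_cat X A B) = Idn (path_cat X)" "Cmp (seq_cat X A B) = Cmp (path_cat X)" "Ob (seq_cat X A B) = seq_ob X A B"
    by (simp_all add: seq_cat_def path_cat_def)
  show ?thesis
  proof
    fix \<phi> assume "\<phi> \<in> Ar (seq_cat X A B)"
    then have "\<phi> \<in> hom (seq_cat X A B) (Dom (seq_cat X A B) \<phi>) (Cod (seq_cat X A B) \<phi>)" by (simp add: hom_def)
    from hom[OF this] show "Dom (seq_cat X A B) \<phi> \<in> Ob (seq_cat X A B)" "Cod (seq_cat X A B) \<phi> \<in> Ob (seq_cat X A B)"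
      by (simp_all add: simps)
  next
    fix s assume "s \<in> Ob (seq_cat X A B)"
    then have s: "s \<in> seq_ob X A B" by (simp add: simps)
    show "Idn (seq_cat X A B) s \<in> hom (seq_cat X A B) s s"
      unfolding simps seq_hom_eq_path_hom[OF s] by (rule P.Idn_hom[OF ob[OF s]])
  next
    fix \<phi> \<psi> s t u assume "\<phi> \<in> hom (seq_cat X A B) s t" "\<psi> \<in> hom (seq_cat X A B) t u"
    note h = hom[OF this(1)] hom[OF this(2)]
    have s: "s \<in> seq_ob X A B" using h by simp
    show "Cmp (seq_cat X A B) \<psi> \<phi> \<in> hom (seq_cat X A B) s u"
      unfolding simps seq_hom_eq_path_hom[OF s] using h P.Cmp_hom by blast
  next
    fix \<phi> s t assume "\<phi> \<in> hom (seq_cat X A B) s t"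
    note h = hom[OF this, THEN conjunct2, THEN conjunct2]
    show "Cmp (seq_cat X A B) (Idn (seq_cat X A B) t) \<phi> = \<phi>" "Cmp (seq_cat X A B) \<phi> (Idn (seq_cat X A B) s) = \<phi>"
      unfolding simps by (rule P.Cmp_Idn_left[OF h] P.Cmp_Idn_right[OF h])+
  next
    fix \<phi> \<psi> \<chi> s t u w
    assume "\<phi> \<in> hom (seq_cat X A B) s t" "\<psi> \<in> hom (seq_cat X A B) t u" "\<chi> \<in> hom (seq_cat X A B) u w"
    note h = this[THEN hom, THEN conjunct2, THEN conjunct2]
    show "Cmp (seq_cat X A B) (Cmp (seq_cat X A B) \<chi> \<psi>) \<phi> = Cmp (seq_cat X A B) \<chi> (Cmp (seq_cat X A B) \<psi> \<phi>)"
      unfolding simps by (rule P.Cmp_assoc[OF h])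
  qed
qed

lemma op_cat_simps:
  "Ob (op_cat C) = Ob C" "Ar (op_cat C) = Ar C" "Dom (op_cat C) = Cod C" "Cod (op_cat C) = Dom C"
  "Idn (op_cat C) = Idn C" "Cmp (op_cat C) g f = Cmp C f g"
  by (simp_all add: op_cat_def)

lemma hom_op_cat: "hom (op_cat C) a b = hom C b a"
  by (auto simp: hom_def op_cat_simps)

lemma category_op_cat:
  assumes "category C"
  shows "category (op_cat C)"
proof -
  interpret category C by fact
  show ?thesis
    by standard (simp_all add: op_cat_simps hom_op_cat Dom_Ob Cod_Ob Idn_hom Cmp_hom Cmp_Idn_left Cmp_Idn_right Cmp_assoc)
qed

section \<open>Lax functors as lax algebras\<close>

text \<open>The end points of a path are its first and last entries, so the indices \<open>A\<close>, \<open>B\<close> of a lax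
  functor carry no information.\<close>

definition flat :: "('x, 'o, 'a) lax_fun \<Rightarrow> ('x list, 'x seq_arrow, 'o, 'a) lax_alg" where
  "flat F = \<lparr>aob = (\<lambda>t. lob F (hd t) (last t) t),
     aar = (\<lambda>\<phi>. lar F (hd (fst \<phi>)) (last (fst \<phi>)) \<phi>), alax = laxity F\<rparr>"

text \<open>The restrictions and \<open>undefined\<close> values are those that
  \<open>lax_extensional\<close> prescribes, so \<open>G\<close> is recovered from
  \<open>unflat X G\<close> only on paths, their arrows and composable pairs.\<close>

definition unflat :: "'x set \<Rightarrow> ('x list, 'x seq_arrow, 'o, 'a) lax_alg \<Rightarrow> ('x, 'o, 'a) lax_fun" where
  "unflat X G = \<lparr>lfun = (\<lambda>A B. if A \<in> X \<and> B \<in> X then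
       \<lparr>fob = restrict (aob G) (seq_ob X A B), far = restrict (aar G) (seq_ar X A B)\<rparr> else undefined),
     laxity = (\<lambda>s u. if path_comp X s u then alax G s u else undefined)\<rparr>"

definition flat_mor :: "('x, 'o, 'a) lax_mor \<Rightarrow> 'x list \<Rightarrow> 'a" where
  "flat_mor \<sigma> t = mcmp \<sigma> (hd t) (last t) t"

definition unflat_mor ::
  "'x set \<Rightarrow> ('x, 'o, 'a) lax_fun \<Rightarrow> ('x, 'o, 'a) lax_fun \<Rightarrow> ('x list \<Rightarrow> 'a) \<Rightarrow> ('x, 'o, 'a) lax_mor" where
  "unflat_mor X F G s = \<lparr>msrc = F, mtgt = G, mcmp = family_restrict X (\<lambda>A B. s)\<rparr>"

lemma path_ends:
  assumes "s \<in> Ob (path_cat X)"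
  shows "hd s \<in> X" "last s \<in> X" "s \<in> seq_ob X (hd s) (last s)"
proof -
  have "s \<noteq> []" using deg_path[OF assms] by auto
  then show "hd s \<in> X" "last s \<in> X" using assms by (auto simp: path_cat_def)
  show "s \<in> seq_ob X (hd s) (last s)" using assms by (simp add: seq_ob_iff)
qed

lemma seq_ob_path: "s \<in> seq_ob X A B \<Longrightarrow> s \<in> Ob (path_cat X)" "s \<in> seq_ob X A B \<Longrightarrow> hd s = A" "s \<in> seq_ob X A B \<Longrightarrow> last s = B"
  by (simp_all add: seq_ob_iff)

lemma path_hom_ends:
  assumes "\<phi> \<in> hom (path_cat X) s t"
  shows "s \<in> Ob (path_cat X)" "t \<in> Ob (path_cat X)" "hd t = hd s" "last t = last s" "fst \<phi> = s"
    "\<phi> \<in> hom (seq_cat X (hd s) (last s)) s t" "\<phi> \<in> seq_ar X (hd s) (last s)"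
proof -
  show *: "s \<in> Ob (path_cat X)" "t \<in> Ob (path_cat X)" "hd t = hd s" "last t = last s" "fst \<phi> = s"
    using assms by (auto simp: path_hom_iff)
  show **: "\<phi> \<in> hom (seq_cat X (hd s) (last s)) s t"
    using assms seq_hom_eq_path_hom[OF path_ends(3)[OF *(1)]] by simp
  then show "\<phi> \<in> seq_ar X (hd s) (last s)" by (simp add: hom_def seq_cat_def)
qed

lemma seq_hom_path_hom:
  assumes "\<phi> \<in> hom (seq_cat X A B) s t"
  shows "\<phi> \<in> hom (path_cat X) s t" "s \<in> seq_ob X A B" "t \<in> seq_ob X A B" "\<phi> \<in> seq_ar X A B" "fst \<phi> = s"
proof -
  show *: "s \<in> seq_ob X A B" "t \<in> seq_ob X A B" "\<phi> \<in> seq_ar X A B" "fst \<phi> = s"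
    using assms by (auto simp: hom_def seq_cat_def seq_ar_def)
  show "\<phi> \<in> hom (path_cat X) s t" using assms seq_hom_eq_path_hom[OF *(1)] by simp
qed

lemma seq_cat_simps: "Ob (seq_cat X A B) = seq_ob X A B" "Ar (seq_cat X A B) = seq_ar X A B"
  "Idn (seq_cat X A B) = Idn (path_cat X)" "Cmp (seq_cat X A B) = Cmp (path_cat X)"
  by (simp_all add: seq_cat_def path_cat_def)

text \<open>Brings composability into the form of the last clause of
  \<open>lax_extensional\<close>.\<close>

lemma path_comp_iff:
  "path_comp X s u \<longleftrightarrow> (\<exists>A \<in> X. \<exists>B \<in> X. \<exists>C \<in> X. s \<in> seq_ob X A B \<and> u \<in> seq_ob X B C)"
proof
  assume "path_comp X s u"
  then have s: "s \<in> Ob (path_cat X)" and u: "u \<in> Ob (path_cat X)" and eq: "last s = hd u"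
    by (simp_all add: path_comp_def)
  show "\<exists>A \<in> X. \<exists>B \<in> X. \<exists>C \<in> X. s \<in> seq_ob X A B \<and> u \<in> seq_ob X B C"
    using path_ends[OF s] path_ends[OF u] eq by auto
qed (auto simp: path_comp_def seq_ob_iff)

lemma flat_simps:
  "s \<in> seq_ob X A B \<Longrightarrow> aob (flat F) s = lob F A B s"
  "\<phi> \<in> hom (seq_cat X A B) s t \<Longrightarrow> aar (flat F) \<phi> = lar F A B \<phi>"
  "alax (flat F) = laxity F"
proof -
  show "s \<in> seq_ob X A B \<Longrightarrow> aob (flat F) s = lob F A B s"
    by (simp add: flat_def seq_ob_path(2,3))
  show "aar (flat F) \<phi> = lar F A B \<phi>" if \<phi>: "\<phi> \<in> hom (seq_cat X A B) s t"
    unfolding flat_def lax_alg.simps seq_hom_path_hom(5)[OF \<phi>] seq_ob_path(2,3)[OF seq_hom_path_hom(2)[OF \<phi>]] ..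
  show "alax (flat F) = laxity F" by (simp add: flat_def)
qed

lemma unflat_simps:
  "A \<in> X \<Longrightarrow> B \<in> X \<Longrightarrow> s \<in> seq_ob X A B \<Longrightarrow> lob (unflat X G) A B s = aob G s"
  "A \<in> X \<Longrightarrow> B \<in> X \<Longrightarrow> \<phi> \<in> hom (seq_cat X A B) s t \<Longrightarrow> lar (unflat X G) A B \<phi> = aar G \<phi>"
  "path_comp X s u \<Longrightarrow> laxity (unflat X G) s u = alax G s u"
proof -
  show "A \<in> X \<Longrightarrow> B \<in> X \<Longrightarrow> s \<in> seq_ob X A B \<Longrightarrow> lob (unflat X G) A B s = aob G s"
    by (simp add: unflat_def)
  show "lar (unflat X G) A B \<phi> = aar G \<phi>" if "A \<in> X" "B \<in> X" and \<phi>: "\<phi> \<in> hom (seq_cat X A B) s t"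
    using that(1,2) seq_hom_path_hom(4)[OF \<phi>] by (simp add: unflat_def)
  show "path_comp X s u \<Longrightarrow> laxity (unflat X G) s u = alax G s u"
    by (simp add: unflat_def)
qed

lemma flat_unflat:
  "t \<in> Ob (path_cat X) \<Longrightarrow> aob (flat (unflat X G)) t = aob G t"
  "\<phi> \<in> hom (path_cat X) s t \<Longrightarrow> aar (flat (unflat X G)) \<phi> = aar G \<phi>"
  "path_comp X s u \<Longrightarrow> alax (flat (unflat X G)) s u = alax G s u"
proof -
  show "t \<in> Ob (path_cat X) \<Longrightarrow> aob (flat (unflat X G)) t = aob G t"
    using path_ends[of t X] by (simp add: flat_simps(1)[of t X] unflat_simps)
  show "aar (flat (unflat X G)) \<phi> = aar G \<phi>" if \<phi>: "\<phi> \<in> hom (path_cat X) s t"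
    using path_ends[OF path_hom_ends(1)[OF \<phi>]] unflat_simps(2)[OF _ _ path_hom_ends(6)[OF \<phi>]]
    by (simp add: flat_simps(2)[OF path_hom_ends(6)[OF \<phi>]])
  show "path_comp X s u \<Longrightarrow> alax (flat (unflat X G)) s u = alax G s u"
    by (simp add: flat_simps(3) unflat_simps)
qed

locale lax_functors = monoidal_category M for M :: "('o, 'a, 'z) mon_cat_scheme" (structure) +
  fixes X :: "'x set"
begin

sublocale lax_algebras M "path_cat X" deg "path_comp X" concat_ob concat_ar
  by (intro lax_algebras.intro graded_concat_path_cat) (rule monoidal_category_axioms)

abbreviation P where "P \<equiv> path_cat X"

lemma lax_functor_functor:
  assumes "lax_functor M X F" "A \<in> X" "B \<in> X"
  shows "s \<in> seq_ob X A B \<Longrightarrow> lob F A B s \<in> Ob M"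
    and "\<phi> \<in> hom (seq_cat X A B) s s' \<Longrightarrow> lar F A B \<phi> \<in> hom M (lob F A B s') (lob F A B s)"
    and "s \<in> seq_ob X A B \<Longrightarrow> lar F A B (Idn P s) = Idn M (lob F A B s)"
    and "\<phi> \<in> hom (seq_cat X A B) s s' \<Longrightarrow> \<psi> \<in> hom (seq_cat X A B) s' s'' \<Longrightarrow>
      lar F A B (Cmp P \<psi> \<phi>) = lar F A B \<phi> \<cdot> lar F A B \<psi>"
proof -
  interpret cat_functor "op_cat (seq_cat X A B)" M "lfun F A B"
    by (rule lax_functor.lfun_functor[OF assms])
  show "s \<in> seq_ob X A B \<Longrightarrow> lob F A B s \<in> Ob M"
    using fob_Ob by (simp add: op_cat_simps seq_cat_simps)
  show "\<phi> \<in> hom (seq_cat X A B) s s' \<Longrightarrow> lar F A B \<phi> \<in> hom M (lob F A B s') (lob F A B s)"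
    using far_hom[of \<phi> s' s] by (simp add: hom_op_cat)
  show "s \<in> seq_ob X A B \<Longrightarrow> lar F A B (Idn P s) = Idn M (lob F A B s)"
    using far_Idn[of s] by (simp add: op_cat_simps seq_cat_simps)
  show "\<phi> \<in> hom (seq_cat X A B) s s' \<Longrightarrow> \<psi> \<in> hom (seq_cat X A B) s' s'' \<Longrightarrow>
      lar F A B (Cmp P \<psi> \<phi>) = lar F A B \<phi> \<cdot> lar F A B \<psi>"
    using far_Cmp[of \<psi> s'' s' \<phi> s] by (simp add: hom_op_cat op_cat_simps seq_cat_simps)
qed

lemma path_compD:
  assumes "path_comp X s u"
  shows "hd s \<in> X" "last s \<in> X" "last u \<in> X" "s \<in> seq_ob X (hd s) (last s)" "u \<in> seq_ob X (last s) (last u)"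
    "concat_ob s u \<in> seq_ob X (hd s) (last u)"
proof -
  have s: "s \<in> Ob P" and u: "u \<in> Ob P" and eq: "last s = hd u"
    using assms by (simp_all add: path_comp_def)
  show "hd s \<in> X" "last s \<in> X" "last u \<in> X" "s \<in> seq_ob X (hd s) (last s)" "u \<in> seq_ob X (last s) (last u)"
    using path_ends[OF s] path_ends[OF u] eq by simp_all
  show "concat_ob s u \<in> seq_ob X (hd s) (last u)"
    using concat_path[OF assms] by (simp add: seq_ob_iff)
qed

section \<open>Lax functors correspond to lax algebras on paths\<close>

lemma flat_lax_algebra:
  assumes F: "lax_functor M X F"
  shows "lax_algebra (flat F)"
  unfolding lax_algebra_def
proof (intro conjI ballI allI impI)
  fix s assume "s \<in> Ob P"
  note s = path_ends[OF this]
  note f = lax_functor_functor[OF F s(1,2)]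
  show "aob (flat F) s \<in> Ob M" using f(1)[OF s(3)] by (simp add: flat_simps(1)[OF s(3)])
  have "Idn P s \<in> hom (seq_cat X (hd s) (last s)) s s"
    by (rule path_hom_ends(6)[OF S.Idn_hom[OF \<open>s \<in> Ob P\<close>]])
  note this_ar = flat_simps(2)[OF this]
    show "aar (flat F) (Idn P s) = Idn M (aob (flat F) s)"
    using f(3)[OF s(3)] by (simp add: this_ar flat_simps(1)[OF s(3)])
next
  fix s s' \<phi> assume \<phi>: "\<phi> \<in> hom P s s'"
  note s = path_ends[OF path_hom_ends(1)[OF \<phi>]] and h = path_hom_ends(6)[OF \<phi>]
  note f = lax_functor_functor[OF F s(1,2)]
  show "aar (flat F) \<phi> \<in> hom M (aob (flat F) s') (aob (flat F) s)"
    using f(2)[OF h] by (simp add: flat_simps(2)[OF h] flat_simps(1)[OF seq_hom_path_hom(2)[OF h]] flat_simps(1)[OF seq_hom_path_hom(3)[OF h]])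
  fix s'' \<psi> assume \<psi>: "\<psi> \<in> hom P s' s''"
  \<comment> \<open>\<open>\<psi>\<close> starts at \<open>s'\<close>, which has the end points of
    \<open>s\<close>, so both arrows are seen in the same \<open>seq_cat\<close>.\<close>
  note k = path_hom_ends(6)[OF \<psi>, unfolded path_hom_ends(3,4)[OF \<phi>]]
  have "Cmp P \<psi> \<phi> \<in> hom (seq_cat X (hd s) (last s)) s s''"
    by (rule path_hom_ends(6)[OF S.Cmp_hom[OF \<phi> \<psi>]])
  note this_ar = flat_simps(2)[OF this]
    show "aar (flat F) (Cmp P \<psi> \<phi>) = aar (flat F) \<phi> \<cdot> aar (flat F) \<psi>"
    using f(4)[OF h k] by (simp add: this_ar flat_simps(2)[OF h] flat_simps(2)[OF k])
next
  fix s u assume c: "path_comp X s u"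
  note p = path_compD[OF c]
  note flat = flat_simps(1)[OF p(4)] flat_simps(1)[OF p(5)] flat_simps(1)[OF p(6)] flat_simps(3)
  show "alax (flat F) s u \<in> hom M (aob (flat F) s \<odot> aob (flat F) u) (aob (flat F) (concat_ob s u))"
    unfolding flat by (rule lax_functor.laxity_hom[OF F p(1-5)])
  fix s' u' \<phi> \<psi> assume \<phi>: "\<phi> \<in> hom P s s'" and \<psi>: "\<psi> \<in> hom P u u'"
  note h = path_hom_ends(6)[OF \<phi>]
  have k: "\<psi> \<in> hom (seq_cat X (last s) (last u)) u u'"
    using path_hom_ends(6)[OF \<psi>] seq_ob_path(2)[OF p(5)] by simp
  have hk: "concat_ar \<phi> \<psi> \<in> hom (seq_cat X (hd s) (last u)) (concat_ob s u) (concat_ob s' u')"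
    using path_hom_ends(6)[OF S.car_hom[OF c \<phi> \<psi>]] concat_path[OF c] by simp
  show "alax (flat F) s u \<cdot> (aar (flat F) \<phi> \<otimes> aar (flat F) \<psi>) = aar (flat F) (concat_ar \<phi> \<psi>) \<cdot> alax (flat F) s' u'"
    unfolding flat flat_simps(2)[OF h] flat_simps(2)[OF k] flat_simps(2)[OF hk]
    by (rule lax_functor.laxity_natural[OF F p(1-3) h k])
next
  fix s t u assume st: "path_comp X s t" and tu: "path_comp X t u"
  note p = path_compD[OF st] and q = path_compD[OF tu]
  have t: "hd t = last s" by (rule seq_ob_path(2)[OF p(5)])
  show "alax (flat F) (concat_ob s t) u \<cdot> (alax (flat F) s t \<otimes> Idn M (aob (flat F) u)) =
    alax (flat F) s (concat_ob t u) \<cdot> (Idn M (aob (flat F) s) \<otimes> alax (flat F) t u) \<cdot>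
      Assoc M (aob (flat F) s) (aob (flat F) t) (aob (flat F) u)"
    unfolding flat_simps(3) flat_simps(1)[OF p(4)] flat_simps(1)[OF p(5)] flat_simps(1)[OF q(5)]
    by (rule lax_functor.laxity_assoc[OF F p(1-3) q(3) p(4,5) q(5)])
qed

lemma seq_obs_path_comp:
  assumes "s \<in> seq_ob X A B" "u \<in> seq_ob X B C"
  shows "path_comp X s u"
  using assms by (simp add: path_comp_def seq_ob_iff)

lemma concat_seq_ob:
  assumes "s \<in> seq_ob X A B" "u \<in> seq_ob X B C"
  shows "concat_ob s u \<in> seq_ob X A C"
  using concat_path[OF seq_obs_path_comp[OF assms]] assms by (simp add: seq_ob_iff)

lemma unflat_lax_functor:
  assumes G: "lax_algebra G"
  shows "lax_functor M X (unflat X G)"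
proof (rule lax_functor.intro)
  note g = lax_algebraD[OF G]
  fix A B assume A: "A \<in> X" and B: "B \<in> X"
  note us = unflat_simps(1,2)[OF A B]
  show "cat_functor (op_cat (seq_cat X A B)) M (lfun (unflat X G) A B)"
  proof (intro cat_functor.intro cat_functor_axioms.intro category_op_cat category_seq_cat category_axioms,
      unfold op_cat_simps hom_op_cat seq_cat_simps)
    fix s assume s: "s \<in> seq_ob X A B"
    show "lob (unflat X G) A B s \<in> Ob M" using g(1)[OF seq_ob_path(1)[OF s]] by (simp add: us(1)[OF s])
    have "Idn P s \<in> hom (seq_cat X A B) s s"
      using path_hom_ends(6)[OF S.Idn_hom[OF seq_ob_path(1)[OF s]]] seq_ob_path(2,3)[OF s] by simp
    note this_ar = us(2)[OF this]
    show "lar (unflat X G) A B (Idn P s) = Idn M (lob (unflat X G) A B s)"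
      using g(3)[OF seq_ob_path(1)[OF s]] by (simp add: this_ar us(1)[OF s])
  next
    fix \<phi> s' s assume h: "\<phi> \<in> hom (seq_cat X A B) s s'"
    note h' = seq_hom_path_hom[OF h]
    show "lar (unflat X G) A B \<phi> \<in> hom M (lob (unflat X G) A B s') (lob (unflat X G) A B s)"
      using g(2)[OF h'(1)] by (simp add: us(2)[OF h] us(1)[OF h'(2)] us(1)[OF h'(3)])
  next
    fix \<phi> \<psi> s s' s'' assume h: "\<psi> \<in> hom (seq_cat X A B) s' s''" and k: "\<phi> \<in> hom (seq_cat X A B) s s'"
    note h' = seq_hom_path_hom[OF h] and k' = seq_hom_path_hom[OF k]
    have "Cmp P \<psi> \<phi> \<in> hom (seq_cat X A B) s s''"
      using path_hom_ends(6)[OF S.Cmp_hom[OF k'(1) h'(1)]] seq_ob_path(2,3)[OF k'(2)] by simp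
    note this_ar = us(2)[OF this]
    show "lar (unflat X G) A B (Cmp P \<psi> \<phi>) = lar (unflat X G) A B \<phi> \<cdot> lar (unflat X G) A B \<psi>"
      using g(4)[OF k'(1) h'(1)] by (simp add: this_ar us(2)[OF h] us(2)[OF k])
  qed
  fix C assume C: "C \<in> X"
  note vs = unflat_simps(1,2)[OF B C] and ws = unflat_simps(1,2)[OF A C]
  show "laxity (unflat X G) s u \<in> hom M (lob (unflat X G) A B s \<odot> lob (unflat X G) B C u) (lob (unflat X G) A C (concat_ob s u))"
    if s: "s \<in> seq_ob X A B" and u: "u \<in> seq_ob X B C" for s u
    using g(5)[OF seq_obs_path_comp[OF s u]]
    unfolding us(1)[OF s] vs(1)[OF u] ws(1)[OF concat_seq_ob[OF s u]] unflat_simps(3)[OF seq_obs_path_comp[OF s u]] .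
  show "laxity (unflat X G) s t \<cdot> (lar (unflat X G) A B f \<otimes> lar (unflat X G) B C g) =
      lar (unflat X G) A C (concat_ar f g) \<cdot> laxity (unflat X G) s' t'"
    if f: "f \<in> hom (seq_cat X A B) s s'" and gg: "g \<in> hom (seq_cat X B C) t t'" for f g s s' t t'
  proof -
    note f' = seq_hom_path_hom[OF f] and g' = seq_hom_path_hom[OF gg]
    note c = seq_obs_path_comp[OF f'(2) g'(2)] and c' = seq_obs_path_comp[OF f'(3) g'(3)]
    have fg: "concat_ar f g \<in> hom (seq_cat X A C) (concat_ob s t) (concat_ob s' t')"
      using path_hom_ends(6)[OF S.car_hom[OF c f'(1) g'(1)]] concat_path[OF c] seq_ob_path[OF f'(2)] seq_ob_path[OF g'(2)] by simp
    show ?thesis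
      using g(6)[OF c f'(1) g'(1)]
      unfolding us(2)[OF f] vs(2)[OF gg] ws(2)[OF fg] unflat_simps(3)[OF c] unflat_simps(3)[OF c'] .
  qed
  fix D assume D: "D \<in> X"
  show "laxity (unflat X G) (concat_ob s t) u \<cdot> (laxity (unflat X G) s t \<otimes> Idn M (lob (unflat X G) C D u)) =
      laxity (unflat X G) s (concat_ob t u) \<cdot> (Idn M (lob (unflat X G) A B s) \<otimes> laxity (unflat X G) t u) \<cdot>
        Assoc M (lob (unflat X G) A B s) (lob (unflat X G) B C t) (lob (unflat X G) C D u)"
    if s: "s \<in> seq_ob X A B" and t: "t \<in> seq_ob X B C" and u: "u \<in> seq_ob X C D" for s t u
  proof -
    note c = seq_obs_path_comp[OF s t] and d = seq_obs_path_comp[OF t u]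
    note e = S.comp_cob[OF c d]
    show ?thesis
      using g(7)[OF c d]
      unfolding us(1)[OF s] vs(1)[OF t] unflat_simps(1)[OF C D u] unflat_simps(3)[OF c] unflat_simps(3)[OF d]
        unflat_simps(3)[OF e(1)] unflat_simps(3)[OF e(2)] .
  qed
next
  show "lax_extensional X (unflat X G)"
    unfolding lax_extensional_def path_comp_iff[symmetric] by (simp add: unflat_def)
qed

section \<open>Morphisms of lax functors correspond to lax maps\<close>

lemma flat_mor_lax_map:
  assumes m: "lax_morphism M X \<sigma>"
  shows "lax_map (flat (msrc \<sigma>)) (flat (mtgt \<sigma>)) (flat_mor \<sigma>)"
  unfolding lax_map_def
proof (intro conjI ballI allI impI)
  fix s assume "s \<in> Ob P"
  note s = path_ends[OF this]
  note n = lax_morphism.mcmp_natural[OF m s(1,2), unfolded nat_trans_def op_cat_simps seq_cat_simps]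
  show "flat_mor \<sigma> s \<in> hom M (aob (flat (msrc \<sigma>)) s) (aob (flat (mtgt \<sigma>)) s)"
    unfolding flat_mor_def flat_simps(1)[OF s(3)] using n s(3) by simp
next
  fix s s' \<phi> assume \<phi>: "\<phi> \<in> hom P s s'"
  note s = path_ends[OF path_hom_ends(1)[OF \<phi>]] and h = path_hom_ends(6)[OF \<phi>]
  note n = lax_morphism.mcmp_natural[OF m s(1,2), unfolded nat_trans_def op_cat_simps seq_cat_simps, THEN conjunct2, THEN conjunct2, THEN conjunct2]
  show "flat_mor \<sigma> s \<cdot> aar (flat (msrc \<sigma>)) \<phi> = aar (flat (mtgt \<sigma>)) \<phi> \<cdot> flat_mor \<sigma> s'"
    using n[rule_format, OF path_hom_ends(7)[OF \<phi>]]
    unfolding flat_simps(2)[OF h] homD(2,3)[OF h] flat_mor_def path_hom_ends(3,4)[OF \<phi>] .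
next
  fix s u assume c: "path_comp X s u"
  note p = path_compD[OF c]
  have "hd u = last s" by (rule seq_ob_path(2)[OF p(5)])
  then show "flat_mor \<sigma> (concat_ob s u) \<cdot> alax (flat (msrc \<sigma>)) s u = alax (flat (mtgt \<sigma>)) s u \<cdot> (flat_mor \<sigma> s \<otimes> flat_mor \<sigma> u)"
    using lax_morphism.mcmp_laxity[OF m p(1-5)] seq_ob_path(2,3)[OF p(6)]
    by (simp add: flat_simps(3) flat_mor_def)
qed

lemma family_restrict_simp: "A \<in> X \<Longrightarrow> B \<in> X \<Longrightarrow> t \<in> seq_ob X A B \<Longrightarrow> family_restrict X \<sigma> A B t = \<sigma> A B t"
  by (simp add: family_restrict_def)

lemma family_restrict_cong:
  assumes "\<And>A B t. A \<in> X \<Longrightarrow> B \<in> X \<Longrightarrow> t \<in> seq_ob X A B \<Longrightarrow> \<sigma> A B t = \<tau> A B t"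
  shows "family_restrict X \<sigma> = family_restrict X \<tau>"
  using assms by (simp add: family_restrict_def fun_eq_iff)

lemma flat_unflat_mor:
  assumes "t \<in> Ob P"
  shows "flat_mor (unflat_mor X F G s) t = s t"
  using path_ends[OF assms] by (simp add: flat_mor_def unflat_mor_def family_restrict_simp)

lemma unflat_mor_lax_morphism:
  assumes F: "lax_functor M X F" and G: "lax_functor M X G" and s: "lax_map (flat F) (flat G) s"
  shows "lax_morphism M X (unflat_mor X F G s)"
proof (intro lax_morphism.intro lax_morphism_axioms.intro)
  let ?m = "family_restrict X (\<lambda>A B. s)"
  have simps: "msrc (unflat_mor X F G s) = F" "mtgt (unflat_mor X F G s) = G" "mcmp (unflat_mor X F G s) = ?m"
    by (simp_all add: unflat_mor_def)
  show "lax_functor M X (msrc (unflat_mor X F G s))" "lax_functor M X (mtgt (unflat_mor X F G s))"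
    unfolding simps by (rule F G)+
  show "family_restrict X (mcmp (unflat_mor X F G s)) = mcmp (unflat_mor X F G s)"
    unfolding simps by (simp add: family_restrict_def fun_eq_iff)
  fix A B assume A: "A \<in> X" and B: "B \<in> X"
  show "nat_trans (op_cat (seq_cat X A B)) M (lfun (msrc (unflat_mor X F G s)) A B) (lfun (mtgt (unflat_mor X F G s)) A B)
    (mcmp (unflat_mor X F G s) A B)"
    unfolding simps nat_trans_def op_cat_simps seq_cat_simps
  proof (intro conjI ballI lax_functor.lfun_functor[OF F A B] lax_functor.lfun_functor[OF G A B])
    fix t assume t: "t \<in> seq_ob X A B"
    show "?m A B t \<in> hom M (lob F A B t) (lob G A B t)"
      using lax_mapD(1)[OF s seq_ob_path(1)[OF t]] unfolding flat_simps(1)[OF t] family_restrict_simp[OF A B t] .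
  next
    fix \<phi> assume "\<phi> \<in> seq_ar X A B"
    then have h: "\<phi> \<in> hom (seq_cat X A B) (Dom (seq_cat X A B) \<phi>) (Cod (seq_cat X A B) \<phi>)"
      by (simp add: hom_def seq_cat_simps)
    note h' = seq_hom_path_hom[OF h]
    show "?m A B (Dom (seq_cat X A B) \<phi>) \<cdot> lar F A B \<phi> = lar G A B \<phi> \<cdot> ?m A B (Cod (seq_cat X A B) \<phi>)"
      using lax_mapD(2)[OF s h'(1)]
      unfolding flat_simps(2)[OF h] family_restrict_simp[OF A B h'(2)] family_restrict_simp[OF A B h'(3)] .
  qed
  fix C t u assume C: "C \<in> X" and t: "t \<in> seq_ob X A B" and u: "u \<in> seq_ob X B C"
  show "mcmp (unflat_mor X F G s) A C (concat_ob t u) \<cdot> laxity (msrc (unflat_mor X F G s)) t u =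
     laxity (mtgt (unflat_mor X F G s)) t u \<cdot> (mcmp (unflat_mor X F G s) A B t \<otimes> mcmp (unflat_mor X F G s) B C u)"
    using lax_mapD(3)[OF s seq_obs_path_comp[OF t u]]
    unfolding simps flat_simps(3) family_restrict_simp[OF A B t] family_restrict_simp[OF B C u]
      family_restrict_simp[OF A C concat_seq_ob[OF t u]] .
qed

text \<open>Extensionality of \<open>mcmp\<close> makes a morphism determined by its source, its
  target and its components at paths. The category laws and the colimit equations are checked in
  this way.\<close>

lemma lax_morphism_eqI:
  assumes "lax_morphism M X \<sigma>" "lax_morphism M X \<tau>" "msrc \<sigma> = msrc \<tau>" "mtgt \<sigma> = mtgt \<tau>"
    and eq: "\<And>t. t \<in> Ob P \<Longrightarrow> flat_mor \<sigma> t = flat_mor \<tau> t"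
  shows "\<sigma> = \<tau>"
proof -
  have "family_restrict X (mcmp \<sigma>) = family_restrict X (mcmp \<tau>)"
  proof (rule family_restrict_cong)
    fix A B t assume t: "t \<in> seq_ob X A B"
    show "mcmp \<sigma> A B t = mcmp \<tau> A B t"
      using eq[OF seq_ob_path(1)[OF t]] unfolding flat_mor_def seq_ob_path(2,3)[OF t] .
  qed
  then have "mcmp \<sigma> = mcmp \<tau>"
    unfolding lax_morphism.mcmp_extensional[OF assms(1)] lax_morphism.mcmp_extensional[OF assms(2)] .
  with assms(3,4) show ?thesis by simp
qed

lemma lax_map_Idn:
  assumes F: "lax_algebra F" and eq: "\<And>s. s \<in> Ob P \<Longrightarrow> \<sigma> s = Idn M (aob F s)"
  shows "lax_map F F \<sigma>"
  unfolding lax_map_def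
proof (intro conjI ballI allI impI)
  note f = lax_algebraD[OF F]
  fix s assume s: "s \<in> Ob P"
  show "\<sigma> s \<in> hom M (aob F s) (aob F s)" unfolding eq[OF s] by (rule Idn_hom[OF f(1)[OF s]])
next
  note f = lax_algebraD[OF F]
  fix s s' \<phi> assume \<phi>: "\<phi> \<in> hom P s s'"
  note o = S.hom_Ob[OF \<phi>]
  show "\<sigma> s \<cdot> aar F \<phi> = aar F \<phi> \<cdot> \<sigma> s'"
    unfolding eq[OF o(1)] eq[OF o(2)] Cmp_Idn_left[OF f(2)[OF \<phi>]] Cmp_Idn_right[OF f(2)[OF \<phi>]] ..
next
  note f = lax_algebraD[OF F]
  fix s u assume c: "path_comp X s u"
  note o = S.comp_Ob[OF c]
  show "\<sigma> (concat_ob s u) \<cdot> alax F s u = alax F s u \<cdot> (\<sigma> s \<otimes> \<sigma> u)"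
    unfolding eq[OF o(1)] eq[OF o(2)] eq[OF S.cob_Ob[OF c]] TAr_Idn[OF f(1)[OF o(1)] f(1)[OF o(2)]]
      Cmp_Idn_left[OF f(5)[OF c]] Cmp_Idn_right[OF f(5)[OF c]] ..
qed

text \<open>Pasting of the naturality squares, and of the laxity squares by functoriality of the
  tensor product.\<close>

lemma lax_map_Cmp:
  assumes F: "lax_algebra F" and G: "lax_algebra G" and H: "lax_algebra H"
    and \<sigma>: "lax_map F G \<sigma>" and \<tau>: "lax_map G H \<tau>" and eq: "\<And>s. s \<in> Ob P \<Longrightarrow> \<rho> s = \<tau> s \<cdot> \<sigma> s"
  shows "lax_map F H \<rho>"
  unfolding lax_map_def
proof (intro conjI ballI allI impI)
  fix s assume s: "s \<in> Ob P"
  show "\<rho> s \<in> hom M (aob F s) (aob H s)"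
    unfolding eq[OF s] by (rule Cmp_hom[OF lax_mapD(1)[OF \<sigma> s] lax_mapD(1)[OF \<tau> s]])
next
  fix s s' \<phi> assume \<phi>: "\<phi> \<in> hom P s s'"
  note o = S.hom_Ob[OF \<phi>]
  note s = lax_mapD(1)[OF \<sigma> o(1)] lax_mapD(1)[OF \<sigma> o(2)] and t = lax_mapD(1)[OF \<tau> o(1)] lax_mapD(1)[OF \<tau> o(2)]
  note f = lax_algebraD(2)[OF F \<phi>] and g = lax_algebraD(2)[OF G \<phi>] and h = lax_algebraD(2)[OF H \<phi>]
  have "\<tau> s \<cdot> \<sigma> s \<cdot> aar F \<phi> = \<tau> s \<cdot> (\<sigma> s \<cdot> aar F \<phi>)" by (rule Cmp_assoc[OF f s(1) t(1)])
  also have "\<dots> = \<tau> s \<cdot> (aar G \<phi> \<cdot> \<sigma> s')" unfolding lax_mapD(2)[OF \<sigma> \<phi>] ..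
  also have "\<dots> = \<tau> s \<cdot> aar G \<phi> \<cdot> \<sigma> s'" by (rule Cmp_assoc[OF s(2) g t(1), symmetric])
  also have "\<dots> = aar H \<phi> \<cdot> \<tau> s' \<cdot> \<sigma> s'" unfolding lax_mapD(2)[OF \<tau> \<phi>] ..
  also have "\<dots> = aar H \<phi> \<cdot> (\<tau> s' \<cdot> \<sigma> s')" by (rule Cmp_assoc[OF s(2) t(2) h])
  finally show "\<rho> s \<cdot> aar F \<phi> = aar H \<phi> \<cdot> \<rho> s'" unfolding eq[OF o(1)] eq[OF o(2)] .
next
  fix s u assume c: "path_comp X s u"
  note o = S.comp_Ob[OF c] S.cob_Ob[OF c]
  note s = lax_mapD(1)[OF \<sigma> o(1)] lax_mapD(1)[OF \<sigma> o(2)] lax_mapD(1)[OF \<sigma> o(3)]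
  note t = lax_mapD(1)[OF \<tau> o(1)] lax_mapD(1)[OF \<tau> o(2)] lax_mapD(1)[OF \<tau> o(3)]
  note f = lax_algebraD(5)[OF F c] and g = lax_algebraD(5)[OF G c] and h = lax_algebraD(5)[OF H c]
  have "\<tau> (concat_ob s u) \<cdot> \<sigma> (concat_ob s u) \<cdot> alax F s u = \<tau> (concat_ob s u) \<cdot> (\<sigma> (concat_ob s u) \<cdot> alax F s u)"
    by (rule Cmp_assoc[OF f s(3) t(3)])
  also have "\<dots> = \<tau> (concat_ob s u) \<cdot> (alax G s u \<cdot> (\<sigma> s \<otimes> \<sigma> u))" unfolding lax_mapD(3)[OF \<sigma> c] ..
  also have "\<dots> = \<tau> (concat_ob s u) \<cdot> alax G s u \<cdot> (\<sigma> s \<otimes> \<sigma> u)"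
    by (rule Cmp_assoc[OF TAr_hom[OF s(1,2)] g t(3), symmetric])
  also have "\<dots> = alax H s u \<cdot> (\<tau> s \<otimes> \<tau> u) \<cdot> (\<sigma> s \<otimes> \<sigma> u)" unfolding lax_mapD(3)[OF \<tau> c] ..
  also have "\<dots> = alax H s u \<cdot> ((\<tau> s \<otimes> \<tau> u) \<cdot> (\<sigma> s \<otimes> \<sigma> u))"
    by (rule Cmp_assoc[OF TAr_hom[OF s(1,2)] TAr_hom[OF t(1,2)] h])
  also have "\<dots> = alax H s u \<cdot> ((\<tau> s \<cdot> \<sigma> s) \<otimes> (\<tau> u \<cdot> \<sigma> u))"
    unfolding TAr_Cmp[OF s(1) t(1) s(2) t(2)] ..
  finally show "\<rho> (concat_ob s u) \<cdot> alax F s u = alax H s u \<cdot> (\<rho> s \<otimes> \<rho> u)"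
    unfolding eq[OF o(1)] eq[OF o(2)] eq[OF o(3)] .
qed

text \<open>Being a lax map depends only on the values at paths, so it survives the passage from
  \<open>G\<close> to \<open>flat (unflat X G)\<close> and back.\<close>

lemma lax_map_cong:
  assumes "lax_map F G \<sigma>"
    and "\<And>t. t \<in> Ob P \<Longrightarrow> aob F' t = aob F t \<and> aob G' t = aob G t"
    and "\<And>\<phi> s t. \<phi> \<in> hom P s t \<Longrightarrow> aar F' \<phi> = aar F \<phi> \<and> aar G' \<phi> = aar G \<phi>"
    and "\<And>s u. path_comp X s u \<Longrightarrow> alax F' s u = alax F s u \<and> alax G' s u = alax G s u"
  shows "lax_map F' G' \<sigma>"
  unfolding lax_map_def
  by (intro conjI ballI allI impI; simp only: assms(2-4) lax_mapD[OF assms(1)])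

section \<open>The category of lax functors\<close>

lemma lax_cat_simps: "Ob (lax_cat M X) = {F. lax_functor M X F}" "Ar (lax_cat M X) = {\<sigma>. lax_morphism M X \<sigma>}"
  "Dom (lax_cat M X) = msrc" "Cod (lax_cat M X) = mtgt"
  "msrc (Idn (lax_cat M X) F) = F" "mtgt (Idn (lax_cat M X) F) = F"
  "msrc (Cmp (lax_cat M X) \<tau> \<sigma>) = msrc \<sigma>" "mtgt (Cmp (lax_cat M X) \<tau> \<sigma>) = mtgt \<tau>"
  "mcmp (Idn (lax_cat M X) F) = family_restrict X (\<lambda>A B t. Idn M (lob F A B t))"
  "mcmp (Cmp (lax_cat M X) \<tau> \<sigma>) = family_restrict X (\<lambda>A B t. mcmp \<tau> A B t \<cdot> mcmp \<sigma> A B t)"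
  by (simp_all add: lax_cat_def)

lemma lax_hom_iff: "\<sigma> \<in> hom (lax_cat M X) F G \<longleftrightarrow> lax_morphism M X \<sigma> \<and> msrc \<sigma> = F \<and> mtgt \<sigma> = G"
  by (simp add: in_hom_iff lax_cat_simps)

lemma lax_hom_functors:
  assumes "\<sigma> \<in> hom (lax_cat M X) F G"
  shows "lax_functor M X F" "lax_functor M X G"
  using assms lax_morphism.axioms(1,2)[of M X \<sigma>] by (auto simp: lax_hom_iff)

lemma lax_hom_lax_map:
  assumes "\<sigma> \<in> hom (lax_cat M X) F G"
  shows "lax_map (flat F) (flat G) (flat_mor \<sigma>)"
  using flat_mor_lax_map[of \<sigma>] assms by (simp add: lax_hom_iff)

lemma flat_mor_Idn:
  assumes "t \<in> Ob P"
  shows "flat_mor (Idn (lax_cat M X) F) t = Idn M (aob (flat F) t)"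
  using path_ends[OF assms] by (simp add: flat_mor_def lax_cat_simps family_restrict_simp flat_simps(1)[of t X])

lemma flat_mor_Cmp:
  assumes "t \<in> Ob P"
  shows "flat_mor (Cmp (lax_cat M X) \<tau> \<sigma>) t = flat_mor \<tau> t \<cdot> flat_mor \<sigma> t"
  using path_ends[OF assms] by (simp add: flat_mor_def lax_cat_simps family_restrict_simp)

lemma unflat_mor_hom:
  assumes "lax_functor M X F" "lax_functor M X G" "lax_map (flat F) (flat G) s"
  shows "unflat_mor X F G s \<in> hom (lax_cat M X) F G"
  unfolding lax_hom_iff using unflat_mor_lax_morphism[OF assms] by (simp add: unflat_mor_def)

lemma lax_hom_eqI:
  assumes "\<sigma> \<in> hom (lax_cat M X) F G" "\<tau> \<in> hom (lax_cat M X) F G"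
    and "\<And>t. t \<in> Ob P \<Longrightarrow> flat_mor \<sigma> t = flat_mor \<tau> t"
  shows "\<sigma> = \<tau>"
  by (rule lax_morphism_eqI) (use assms in \<open>simp_all add: lax_hom_iff\<close>)

text \<open>Serves to present the identities and composites of \<open>lax_cat M X\<close> as
  \<open>unflat_mor\<close> of a family indexed by paths alone, which reduces their being morphisms
  to a statement on lax maps.\<close>

lemma unflat_mor_eq:
  assumes "msrc \<sigma> = F" "mtgt \<sigma> = G" "mcmp \<sigma> = family_restrict X \<tau>"
    and "\<And>A B t. A \<in> X \<Longrightarrow> B \<in> X \<Longrightarrow> t \<in> seq_ob X A B \<Longrightarrow> \<tau> A B t = s t"
  shows "\<sigma> = unflat_mor X F G s"
  using assms(1-3) family_restrict_cong[of \<tau> "\<lambda>A B. s"] assms(4) by (simp add: unflat_mor_def)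

lemma category_lax_cat: "category (lax_cat M X)"
proof -
  have id: "Idn (lax_cat M X) F \<in> hom (lax_cat M X) F F" if F: "lax_functor M X F" for F
  proof -
    have "Idn (lax_cat M X) F = unflat_mor X F F (\<lambda>t. Idn M (aob (flat F) t))"
      by (rule unflat_mor_eq[of _ _ _ "\<lambda>A B t. Idn M (lob F A B t)"])
        (simp_all add: lax_cat_simps flat_simps(1)[of _ X])
    then show ?thesis
      using unflat_mor_hom[OF F F lax_map_Idn[OF flat_lax_algebra[OF F] refl]] by simp
  qed
  have cmp: "Cmp (lax_cat M X) \<tau> \<sigma> \<in> hom (lax_cat M X) F H"
    if \<sigma>: "\<sigma> \<in> hom (lax_cat M X) F G" and \<tau>: "\<tau> \<in> hom (lax_cat M X) G H" for \<sigma> \<tau> F G H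
  proof -
    note F = lax_hom_functors(1)[OF \<sigma>] and G = lax_hom_functors(1)[OF \<tau>] and H = lax_hom_functors(2)[OF \<tau>]
    have "Cmp (lax_cat M X) \<tau> \<sigma> = unflat_mor X F H (\<lambda>t. flat_mor \<tau> t \<cdot> flat_mor \<sigma> t)"
      by (rule unflat_mor_eq[of _ _ _ "\<lambda>A B t. Cmp M (mcmp \<tau> A B t) (mcmp \<sigma> A B t)"])
        (use \<sigma> \<tau> in \<open>simp_all add: lax_cat_simps lax_hom_iff flat_mor_def seq_ob_path(2,3)\<close>)
    then show ?thesis
      using unflat_mor_hom[OF F H lax_map_Cmp[OF F[THEN flat_lax_algebra] G[THEN flat_lax_algebra] H[THEN flat_lax_algebra]
            lax_hom_lax_map[OF \<sigma>] lax_hom_lax_map[OF \<tau>] refl]] by simp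
  qed
  show ?thesis
  proof
    fix \<sigma> assume "\<sigma> \<in> Ar (lax_cat M X)"
    then have "\<sigma> \<in> hom (lax_cat M X) (msrc \<sigma>) (mtgt \<sigma>)" by (simp add: lax_hom_iff lax_cat_simps)
    from lax_hom_functors[OF this] show "Dom (lax_cat M X) \<sigma> \<in> Ob (lax_cat M X)" "Cod (lax_cat M X) \<sigma> \<in> Ob (lax_cat M X)"
      by (simp_all add: lax_cat_simps)
  next
    fix F assume "F \<in> Ob (lax_cat M X)"
    then show "Idn (lax_cat M X) F \<in> hom (lax_cat M X) F F" by (simp add: id lax_cat_simps)
  next
    fix \<sigma> \<tau> F G H assume "\<sigma> \<in> hom (lax_cat M X) F G" "\<tau> \<in> hom (lax_cat M X) G H"
    then show "Cmp (lax_cat M X) \<tau> \<sigma> \<in> hom (lax_cat M X) F H" by (rule cmp)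
  next
    fix \<sigma> F G assume \<sigma>: "\<sigma> \<in> hom (lax_cat M X) F G"
    note m = lax_mapD(1)[OF lax_hom_lax_map[OF \<sigma>]]
    show "Cmp (lax_cat M X) (Idn (lax_cat M X) G) \<sigma> = \<sigma>"
      by (rule lax_hom_eqI[OF cmp[OF \<sigma> id[OF lax_hom_functors(2)[OF \<sigma>]]] \<sigma>])
        (simp add: flat_mor_Cmp flat_mor_Idn Cmp_Idn_left[OF m])
    show "Cmp (lax_cat M X) \<sigma> (Idn (lax_cat M X) F) = \<sigma>"
      by (rule lax_hom_eqI[OF cmp[OF id[OF lax_hom_functors(1)[OF \<sigma>]] \<sigma>] \<sigma>])
        (simp add: flat_mor_Cmp flat_mor_Idn Cmp_Idn_right[OF m])
  next
    fix \<rho> \<sigma> \<tau> E F G H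
    assume \<rho>: "\<rho> \<in> hom (lax_cat M X) E F" and \<sigma>: "\<sigma> \<in> hom (lax_cat M X) F G" and \<tau>: "\<tau> \<in> hom (lax_cat M X) G H"
    note m = lax_mapD(1)[OF lax_hom_lax_map[OF \<rho>]] lax_mapD(1)[OF lax_hom_lax_map[OF \<sigma>]] lax_mapD(1)[OF lax_hom_lax_map[OF \<tau>]]
    show "Cmp (lax_cat M X) (Cmp (lax_cat M X) \<tau> \<sigma>) \<rho> = Cmp (lax_cat M X) \<tau> (Cmp (lax_cat M X) \<sigma> \<rho>)"
      by (rule lax_hom_eqI[OF cmp[OF \<rho> cmp[OF \<sigma> \<tau>]] cmp[OF cmp[OF \<rho> \<sigma>] \<tau>]])
        (simp add: flat_mor_Cmp Cmp_assoc[OF m])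
  qed
qed

section \<open>Colimits of lax functors\<close>

text \<open>The colimit is formed among lax algebras and made extensional by \<open>unflat\<close>.
  Morphisms out of it and lax maps out of \<open>G\<close> correspond through their components at
  paths, so the universal property carries over, uniqueness included.\<close>

lemma cocomplete_lax_cat:
  fixes \<kappa> :: "'u rel"
  assumes \<kappa>: "Card_order \<kappa>" "infinite (Field \<kappa>)" and C: "cocomplete \<kappa> M"
  shows "cocomplete \<kappa> (lax_cat M X)"
  unfolding cocomplete_def
proof (intro conjI allI impI category_lax_cat)
  fix J :: "('u, 'u) cat" and D
  assume "small_cat \<kappa> J \<and> cat_functor J (lax_cat M X) D"
  then have J: "|Ob J| <o \<kappa>" "|Ar J| <o \<kappa>" and D: "cat_functor J (lax_cat M X) D"
    by (simp_all add: small_cat_def)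
  interpret D: cat_functor J "lax_cat M X" D by (rule D)
  have Dj: "lax_functor M X (fob D j)" if "j \<in> Ob J" for j
    using D.fob_Ob[OF that] by (simp add: lax_cat_simps)
  have Du: "far D u \<in> hom (lax_cat M X) (fob D (Dom J u)) (fob D (Cod J u))" if "u \<in> Ar J" for u
    by (rule D.far_hom) (simp add: hom_def that)
  interpret L: lax_diagram M P deg "path_comp X" concat_ob concat_ar "Ob J" "Ar J" "Dom J" "Cod J"
    "\<lambda>j. flat (fob D j)" "\<lambda>u. flat_mor (far D u)"
    by unfold_locales (simp_all add: D.C.Dom_Ob D.C.Cod_Ob flat_lax_algebra Dj lax_hom_lax_map Du)
  obtain G \<iota> where G: "lax_algebra G" and \<iota>: "\<And>j. j \<in> Ob J \<Longrightarrow> lax_map (flat (fob D j)) G (\<iota> j)"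
    and compat: "\<And>u t. u \<in> Ar J \<Longrightarrow> t \<in> Ob P \<Longrightarrow> \<iota> (Cod J u) t \<cdot> flat_mor (far D u) t = \<iota> (Dom J u) t"
    and univ: "\<And>H \<tau>. lax_algebra H \<Longrightarrow> (\<And>j. j \<in> Ob J \<Longrightarrow> lax_map (flat (fob D j)) H (\<tau> j)) \<Longrightarrow>
       (\<And>u t. u \<in> Ar J \<Longrightarrow> t \<in> Ob P \<Longrightarrow> \<tau> (Cod J u) t \<cdot> flat_mor (far D u) t = \<tau> (Dom J u) t) \<Longrightarrow>
       (\<exists>\<sigma>. lax_map G H \<sigma> \<and> (\<forall>j \<in> Ob J. \<forall>t \<in> Ob P. \<sigma> t \<cdot> \<iota> j t = \<tau> j t)) \<and>
       (\<forall>\<sigma> \<sigma>'. lax_map G H \<sigma> \<longrightarrow> (\<forall>j \<in> Ob J. \<forall>t \<in> Ob P. \<sigma> t \<cdot> \<iota> j t = \<tau> j t) \<longrightarrow>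
          lax_map G H \<sigma>' \<longrightarrow> (\<forall>j \<in> Ob J. \<forall>t \<in> Ob P. \<sigma>' t \<cdot> \<iota> j t = \<tau> j t) \<longrightarrow>
          (\<forall>t \<in> Ob P. \<sigma> t = \<sigma>' t))"
    using L.lax_algebra_colimit[OF \<kappa> C J] by blast
  let ?G = "unflat X G"
  let ?\<iota> = "\<lambda>j. unflat_mor X (fob D j) ?G (\<iota> j)"
  note c = category.Cmp_hom[OF category_lax_cat]
  have G': "lax_functor M X ?G" by (rule unflat_lax_functor[OF G])
  have \<iota>': "?\<iota> j \<in> hom (lax_cat M X) (fob D j) ?G" if j: "j \<in> Ob J" for j
    by (rule unflat_mor_hom[OF Dj[OF j] G' lax_map_cong[OF \<iota>[OF j]]]) (simp_all add: flat_unflat)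
  have "is_colimit J (lax_cat M X) D ?G ?\<iota>"
    unfolding is_colimit_def
  proof (intro conjI allI impI)
    show "cocone J (lax_cat M X) D ?G ?\<iota>"
      unfolding cocone_def
    proof (intro conjI ballI \<iota>')
      show "?G \<in> Ob (lax_cat M X)" using G' by (simp add: lax_cat_simps)
      fix u assume u: "u \<in> Ar J"
      note o = D.C.Dom_Ob[OF u] D.C.Cod_Ob[OF u]
      show "Cmp (lax_cat M X) (?\<iota> (Cod J u)) (far D u) = ?\<iota> (Dom J u)"
        by (rule lax_hom_eqI[OF c[OF Du[OF u] \<iota>'[OF o(2)]] \<iota>'[OF o(1)]])
          (simp add: flat_mor_Cmp flat_unflat_mor compat u)
    qed
  next
    fix H \<tau> assume coc: "cocone J (lax_cat M X) D H \<tau>"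
    then have H: "lax_functor M X H" and \<tau>: "\<And>j. j \<in> Ob J \<Longrightarrow> \<tau> j \<in> hom (lax_cat M X) (fob D j) H"
      and \<tau>_eq: "\<And>u. u \<in> Ar J \<Longrightarrow> Cmp (lax_cat M X) (\<tau> (Cod J u)) (far D u) = \<tau> (Dom J u)"
      by (simp_all add: cocone_def lax_cat_simps)
    have compat': "flat_mor (\<tau> (Cod J u)) t \<cdot> flat_mor (far D u) t = flat_mor (\<tau> (Dom J u)) t"
      if "u \<in> Ar J" "t \<in> Ob P" for u t
      unfolding flat_mor_Cmp[OF that(2), symmetric] \<tau>_eq[OF that(1)] ..
    note U = univ[of "flat H" "\<lambda>j. flat_mor (\<tau> j)", OF flat_lax_algebra[OF H] lax_hom_lax_map[OF \<tau>] compat']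
    show "\<exists>!h. h \<in> hom (lax_cat M X) ?G H \<and> (\<forall>j \<in> Ob J. Cmp (lax_cat M X) h (?\<iota> j) = \<tau> j)"
    proof (rule ex_ex1I)
      obtain \<sigma> where \<sigma>: "lax_map G (flat H) \<sigma>" and \<sigma>_eq: "\<And>j t. j \<in> Ob J \<Longrightarrow> t \<in> Ob P \<Longrightarrow> \<sigma> t \<cdot> \<iota> j t = flat_mor (\<tau> j) t"
        using U by blast
      have h: "unflat_mor X ?G H \<sigma> \<in> hom (lax_cat M X) ?G H"
        by (rule unflat_mor_hom[OF G' H lax_map_cong[OF \<sigma>]]) (simp_all add: flat_unflat)
      have "Cmp (lax_cat M X) (unflat_mor X ?G H \<sigma>) (?\<iota> j) = \<tau> j" if j: "j \<in> Ob J" for j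
        by (rule lax_hom_eqI[OF c[OF \<iota>'[OF j] h] \<tau>[OF j]])
          (simp add: flat_mor_Cmp flat_unflat_mor \<sigma>_eq j)
      with h show "\<exists>h. h \<in> hom (lax_cat M X) ?G H \<and> (\<forall>j \<in> Ob J. Cmp (lax_cat M X) h (?\<iota> j) = \<tau> j)" by blast
    next
      fix h h' assume a: "h \<in> hom (lax_cat M X) ?G H \<and> (\<forall>j \<in> Ob J. Cmp (lax_cat M X) h (?\<iota> j) = \<tau> j)"
        and b: "h' \<in> hom (lax_cat M X) ?G H \<and> (\<forall>j \<in> Ob J. Cmp (lax_cat M X) h' (?\<iota> j) = \<tau> j)"
      \<comment> \<open>\<open>flat ?G\<close> agrees with \<open>G\<close> on paths, so morphisms
        out of \<open>?G\<close> give lax maps out of \<open>G\<close>, to which the pointwise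
        uniqueness applies.\<close>
      have *: "lax_map G (flat H) (flat_mor k) \<and> (\<forall>j \<in> Ob J. \<forall>t \<in> Ob P. flat_mor k t \<cdot> \<iota> j t = flat_mor (\<tau> j) t)"
        if k: "k \<in> hom (lax_cat M X) ?G H" "\<forall>j \<in> Ob J. Cmp (lax_cat M X) k (?\<iota> j) = \<tau> j" for k
      proof (intro conjI ballI)
        show "lax_map G (flat H) (flat_mor k)"
          by (rule lax_map_cong[OF lax_hom_lax_map[OF k(1)]]) (simp_all add: flat_unflat)
        fix j t assume j: "j \<in> Ob J" and t: "t \<in> Ob P"
        show "flat_mor k t \<cdot> \<iota> j t = flat_mor (\<tau> j) t"
          unfolding k(2)[rule_format, OF j, symmetric] flat_mor_Cmp[OF t] flat_unflat_mor[OF t] ..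
      qed
      have "\<forall>t \<in> Ob P. flat_mor h t = flat_mor h' t"
        using U[THEN conjunct2] *[of h] *[of h'] a b by blast
      then show "h = h'" using lax_hom_eqI[of h ?G H h'] a b by blast
    qed
  qed
  then show "\<exists>c \<iota>. is_colimit J (lax_cat M X) D c \<iota>" by blast
qed

end

theorem theorem5p2:
  fixes M :: "('o, 'a) mon_cat" and X :: "'x set" and \<kappa> :: "'u rel"
  assumes "Card_order \<kappa>" and "infinite (Field \<kappa>)"
    and "symmetric_closed_monoidal_category M"
    and "cocomplete \<kappa> M"
    and "X \<noteq> {}"
  shows "cocomplete \<kappa> (lax_cat M X)"
proof -
  interpret M: symmetric_closed_monoidal_category M by fact
  interpret lax_functors M X by (rule lax_functors.intro) unfold_locales
  show ?thesis by (rule cocomplete_lax_cat[OF assms(1,2,4)])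
qed

end
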